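(* Part I (smooth case). Let $f\in C^r([A,B])$ be a real function on a segment $[A,B]$ such that $f'$ has no zeros on $[A,B]$. Consider four arbitrary points $x_1,x_2,x_3,x_4\in[A,B]$ and denote $\Delta=\operatorname{diam}\{x_1,x_2,x_3,x_4\}$. The following asymptotic estimates hold. (1) In the case $r=2+\alpha$, $\alpha\in[0,1]$, $\Delta\neq0$: $$\mathrm{Dist}(x_1,x_2,x_3,x_4;f)=1+(x_1-x_3)(x_2-x_4)\,\mathcal{O}(\Delta^{\alpha-1}).$$ (2) In the case $r=3+\beta$, $\beta\in[0,1]$: $$\mathrm{Dist}(x_1,x_2,x_3,x_4;f)=1+(x_1-x_3)(x_2-x_4)\left(\frac16\,\mathcal{S}f(\theta)+\mathcal{O}(\Delta^{\beta})\right)$$ with arbitrary $\theta\in[\min\{x_1,x_2,x_3,x_4\},\max\{x_1,x_2,x_3,x_4\}]$. (3) In the case $r=4+\gamma$, $\gamma\in[0,1]$: $$\mathrm{Dist}(x_1,x_2,x_3,x_4;f)=1+(x_1-x_3)(x_2-x_4)\left(\frac1{24}\bigl(\mathcal{S}f(x_1)+\mathcal{S}f(x_2)+\mathcal{S}f(x_3)+\mathcal{S}f(x_4)\bigr)+\mathcal{O}(\Delta^{1+\gamma})\right).$$ Part II (holomorphic case). (4) Let $F$ be a holomorphic function defined on a quasiconvex domain $\Omega\subset\mathbb{C}$ such that $F'$ has no zeros in $\Omega$. Then, uniformly on compact subsets of $\Omega$ (that is, for points $z_1,z_2,z_3,z_4$ in a chosen compact subset of $\Omega$, with the implicit constant depending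 only on $F$ and on that compact subset), the following asymptotic estimate holds: $$\mathrm{Dist}(z_1,z_2,z_3,z_4;F)=1+(z_1-z_3)(z_2-z_4)\left(\frac1{24}\bigl(\mathcal{S}F(z_1)+\mathcal{S}F(z_2)+\mathcal{S}F(z_3)+\mathcal{S}F(z_4)\bigr)+\mathcal{O}(\Delta^{2})\right),$$ where in this case $\Delta=\operatorname{diam}\{z_1,z_2,z_3,z_4\}$.
   Context: Implicit constants: $\mathcal{O}(g)$ denotes a quantity of absolute value at most $C g$. In (1)-(3) the constant $C$ depends only on the function $f$ and its segment of definition $[A,B]$, not on the points $x_i$ or $\theta$. In (4) it depends only on the function $F$ and the chosen compact subset of $\Omega$. Smoothness classes: for an integer $k$ and $\alpha\in[0,1]$, $C^{k+\alpha}([A,B])$ denotes the functions that are $k$ times continuously differentiable on $[A,B]$ and whose $k$-th derivative is $\alpha$-Hölder continuous (no extra condition if $\alpha=0$; Lipschitz if $\alpha=1$). Cross-ratio distortion: for four pairwise distinct points $x_1,x_2,x_3,x_4$ (real or complex) the cross-ratio is $\mathrm{Cr}(x_1,x_2,x_3,x_4)=\frac{(x_1-x_2)(x_3-x_4)}{(x_2-x_3)(x_4-x_1)}$, and the cross-ratio distortion with respect to $f$ is $$\mathrm{Dist}(x_1,x_2,x_3,x_4;f)=\frac{\mathrm{Cr}(f(x_1),f(x_2),f(x_3),f(x_4))}{\mathrm{Cr}(x_1,x_2,x_3,x_4)}=\frac{\dfrac{f(x_1)-f(x_2)}{x_1-x_2}\cdot\dfrac{f(x_3)-f(x_4)}{x_3-x_4}}{\dfrac{f(x_2)-f(x_3)}{x_2-x_3}\cdot\dfrac{f(x_4)-f(x_1)}{x_4-x_1}}.$$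 If $f$ is differentiable with non-vanishing derivative, the distortion is also defined for points that are not pairwise distinct, by substituting $f'(a)$ for $\frac{f(a)-f(a)}{a-a}$ (equivalently, as the appropriate limit). Schwarz derivative: $\mathcal{S}f(x)=\dfrac{f'''(x)}{f'(x)}-\dfrac32\left(\dfrac{f''(x)}{f'(x)}\right)^2$ whenever $f'(x)\ne0$ (same formula for holomorphic $F$). $\operatorname{diam}M$ is the diameter of a finite set $M$, i.e. the greatest distance between its points. A domain $\Omega\subset\mathbb{C}$ is quasiconvex if there is a constant $\Lambda\ge1$ such that any two points $a,b\in\Omega$ can be connected by a simple curve in $\Omega$ of length at most $\Lambda|a-b|$.
   Formalization: In (4), the estimate is stated for all quadruples of the compact set only if F is injective on it; otherwise only for Δ below some δ > 0 depending on F and the compact set, since Dist may be undefined or unbounded when F (e.g. exp) takes equal values at distinct points. *)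

theory Defs
  imports "HOL-Complex_Analysis.Complex_Analysis"
begin

(* Derivative on the segment [A,B], one-sided at the end points. *)
definition segment_deriv :: "real \<Rightarrow> real \<Rightarrow> (real \<Rightarrow> real) \<Rightarrow> real \<Rightarrow> real" where
  "segment_deriv A B f x = vector_derivative f (at x within {A..B})"

(* The class C^(k+a)([A,B]). It is indexed by the pair (k, a) and not by the sum k + a,
   because C^(k+1) with a = 1 (Lipschitz k-th derivative) differs from C^((k+1)+0). *)
definition C_Holder :: "nat \<Rightarrow> real \<Rightarrow> real \<Rightarrow> real \<Rightarrow> (real \<Rightarrow> real) \<Rightarrow> bool" where
  "C_Holder k a A B f \<longleftrightarrow>
     (\<forall>j<k. (segment_deriv A B ^^ j) f differentiable_on {A..B}) \<and>
     continuous_on {A..B} ((segment_deriv A B ^^ k) f) \<and>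
     (a > 0 \<longrightarrow> (\<exists>L. \<forall>x\<in>{A..B}. \<forall>y\<in>{A..B}.
        \<bar>(segment_deriv A B ^^ k) f x - (segment_deriv A B ^^ k) f y\<bar> \<le> L * \<bar>x - y\<bar> powr a))"

definition cross_ratio :: "'a \<Rightarrow> 'a \<Rightarrow> 'a \<Rightarrow> 'a \<Rightarrow> 'a::field" where
  "cross_ratio x1 x2 x3 x4 = ((x1 - x2) * (x3 - x4)) / ((x2 - x3) * (x4 - x1))"

(* In the following definitions the parameter d is the differentiation operator:
   segment_deriv A B on a real segment, deriv on a complex domain. *)

definition diff_quot :: "(('a \<Rightarrow> 'a) \<Rightarrow> 'a \<Rightarrow> 'a) \<Rightarrow> ('a \<Rightarrow> 'a) \<Rightarrow> 'a \<Rightarrow> 'a \<Rightarrow> 'a::field" where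
  "diff_quot d f a b = (if a = b then d f a else (f a - f b) / (a - b))"

definition cr_dist ::
  "(('a \<Rightarrow> 'a) \<Rightarrow> 'a \<Rightarrow> 'a) \<Rightarrow> ('a \<Rightarrow> 'a) \<Rightarrow> 'a \<Rightarrow> 'a \<Rightarrow> 'a \<Rightarrow> 'a \<Rightarrow> 'a::field" where
  "cr_dist d f x1 x2 x3 x4 =
     (diff_quot d f x1 x2 * diff_quot d f x3 x4) / (diff_quot d f x2 x3 * diff_quot d f x4 x1)"

lemma cr_dist_eq_cross_ratio:
  assumes "distinct [x1, x2, x3, x4]"
  shows "cr_dist d f x1 x2 x3 x4 =
    cross_ratio (f x1) (f x2) (f x3) (f x4) / cross_ratio x1 x2 x3 x4"
  using assms by (auto simp: cr_dist_def cross_ratio_def diff_quot_def mult_ac)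

definition schwarzian ::
  "(('a \<Rightarrow> 'a) \<Rightarrow> 'a \<Rightarrow> 'a) \<Rightarrow> ('a \<Rightarrow> 'a) \<Rightarrow> 'a \<Rightarrow> 'a::field" where
  "schwarzian d f x = (d ^^ 3) f x / d f x - 3 / 2 * ((d ^^ 2) f x / d f x)\<^sup>2"

(* Length as the supremum over inscribed polygons; infinite for non-rectifiable curves. *)
definition curve_length :: "(real \<Rightarrow> 'a::metric_space) \<Rightarrow> ennreal" where
  "curve_length g = (SUP ts \<in> {ts. sorted ts \<and> set ts \<subseteq> {0..1}}.
     ennreal (\<Sum>i<length ts - 1. dist (g (ts ! i)) (g (ts ! Suc i))))"

definition quasiconvex :: "'a::metric_space set \<Rightarrow> bool" where
  "quasiconvex S \<longleftrightarrow> (\<exists>\<Lambda>\<ge>1. \<forall>a\<in>S. \<forall>b\<in>S. a \<noteq> b \<longrightarrow>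
     (\<exists>g. arc g \<and> pathstart g = a \<and> pathfinish g = b \<and> path_image g \<subseteq> S \<and>
          curve_length g \<le> ennreal (\<Lambda> * dist a b)))"

end

theory Submission
  imports Defs "HOL-Library.Landau_Symbols"
begin

text \<open>
  Write \<open>f[\<dots>]\<close> for divided differences. For four points one has the exact identity
  \<open>f[1,2] f[3,4] - f[2,3] f[4,1] = (x\<^sub>1 - x\<^sub>3) (x\<^sub>2 - x\<^sub>4) (f[1,2,3,4] f[3,4] - f[1,3,4] f[2,3,4])\<close>,
  so the distortion is \<open>1 + (x\<^sub>1 - x\<^sub>3) (x\<^sub>2 - x\<^sub>4) T\<close> with \<open>T\<close> a rational expression in divided differences.
  Expanding each of them around \<open>x\<^sub>1\<close> to first order, with an error \<open>O(\<Delta>\<^sup>\<rho>)\<close>, gives an expansion of \<open>T\<close>; the same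
  is done for the Schwarz derivatives at the four points, and the two expansions agree.
  On a segment the expansions come from the mean value theorem for divided differences of distinct points,
  and coincident points are reached by continuity. In the complex case a divided difference is obtained by
  iterating \<open>g \<mapsto> (g w - g a) / (w - a)\<close>; by the maximum modulus principle this operator is bounded on a fixed
  compact neighbourhood of the points, which makes all remainders uniform without any convexity of the domain.
\<close>

section \<open>First-order expansions with uniform error\<close>

text \<open>Every estimate must hold for all quadruples at once, so \<open>F\<close> will be the
  principal filter of the admissible quadruples: \<open>O[F]\<close> then means a bound with one
  constant, and nothing tends to anything. With Taylor coefficients \<open>a1, a2, ...\<close> at
  the base point and \<open>h\<close> the sum of the four displacements, the unsymmetric quotient
  \<open>T\<close> turns out symmetric to first order:
  \<open>(a3/a1 - a2^2/a1^2) + (a4/a1 - 2 a2 a3/a1^2 + a2^3/a1^3) h\<close>. One Schwarz derivative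
  is six times this expression with \<open>h\<close> replaced by four times its own displacement. So
  the mean of the four values, divided by 6, matches \<open>T\<close>, whence 1/24. With three
  derivatives only the constant term is kept, and the four values are then replaced by the one at
  \<theta>. With two derivatives \<open>f[1,2,3,4]\<close> may be unbounded, and a separate argument
  bounds it by a multiple of \<Delta>^(\<alpha>-1). The constants also need lower bounds for the
  denominators. Real difference quotients are values of f'; complex ones may vanish at distant
  points unless the function is injective there.\<close>

locale jet_calculus =
  fixes F :: "'p filter" and d e :: "'p \<Rightarrow> 'a::real_normed_field"
  assumes d_bounded: "d \<in> O[F](\<lambda>_. 1)"
    and e_bounded: "e \<in> O[F](\<lambda>_. 1)"
    and d_square: "(\<lambda>p. d p * d p) \<in> O[F](e)"
begin

text \<open>\<open>x = u + v + O(e)\<close>, where \<open>v = O(d)\<close> is the linear part; products of linear parts are absorbed by \<open>e\<close>.\<close>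

definition jet :: "('p \<Rightarrow> 'a) \<Rightarrow> ('p \<Rightarrow> 'a) \<Rightarrow> ('p \<Rightarrow> 'a) \<Rightarrow> bool" where
  "jet x u v \<longleftrightarrow> u \<in> O[F](\<lambda>_. 1) \<and> v \<in> O[F](d) \<and>
     (\<exists>r. r \<in> O[F](e) \<and> x = (\<lambda>p. u p + v p + r p))"

lemma jetI:
  assumes "u \<in> O[F](\<lambda>_. 1)" "v \<in> O[F](d)" "r \<in> O[F](e)" "\<And>p. x p = u p + v p + r p"
  shows "jet x u v"
  using assms by (auto simp: jet_def)

lemma jetE:
  assumes "jet x u v"
  obtains r where "u \<in> O[F](\<lambda>_. 1)" "v \<in> O[F](d)" "r \<in> O[F](e)" "\<And>p. x p = u p + v p + r p"
  using assms by (auto simp: jet_def)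

lemma bigo_1_mult: "x \<in> O[F](\<lambda>_. 1) \<Longrightarrow> y \<in> O[F](g) \<Longrightarrow> (\<lambda>p. x p * y p) \<in> O[F](g)"
  and bigo_mult_1: "x \<in> O[F](g) \<Longrightarrow> y \<in> O[F](\<lambda>_. 1) \<Longrightarrow> (\<lambda>p. x p * y p) \<in> O[F](g)"
  for x y :: "'p \<Rightarrow> 'a"
  using landau_o.big_mult[of x F "\<lambda>_. 1" y g] landau_o.big_mult[of x F g y "\<lambda>_. 1"] by simp_all

lemma bigo_d_mult_d:
  assumes "x \<in> O[F](d)" "y \<in> O[F](d)"
  shows "(\<lambda>p. x p * y p) \<in> O[F](e)"
  using landau_o.big_mult[OF assms] d_square landau_o.big_trans by blast

lemma bigo_d_imp_bounded: "x \<in> O[F](d) \<Longrightarrow> x \<in> O[F](\<lambda>_. 1)"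
  using d_bounded landau_o.big_trans by blast

lemma bigo_e_imp_bounded: "x \<in> O[F](e) \<Longrightarrow> x \<in> O[F](\<lambda>_. 1)"
  using e_bounded landau_o.big_trans by blast

lemma jet_bounded:
  assumes "jet x u v" shows "x \<in> O[F](\<lambda>_. 1)"
proof -
  obtain r where r: "u \<in> O[F](\<lambda>_. 1)" "v \<in> O[F](d)" "r \<in> O[F](e)" "\<And>p. x p = u p + v p + r p"
    using assms by (rule jetE) blast
  show ?thesis
    using sum_in_bigo(1)[OF sum_in_bigo(1)[OF r(1) bigo_d_imp_bounded[OF r(2)]] bigo_e_imp_bounded[OF r(3)]]
    by (simp flip: r(4))
qed

lemma jet_add:
  assumes "jet x u v" "jet y w z"
  shows "jet (\<lambda>p. x p + y p) (\<lambda>p. u p + w p) (\<lambda>p. v p + z p)"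
proof -
  obtain r where r: "u \<in> O[F](\<lambda>_. 1)" "v \<in> O[F](d)" "r \<in> O[F](e)" "\<And>p. x p = u p + v p + r p"
    using assms(1) by (rule jetE) blast
  obtain s where s: "w \<in> O[F](\<lambda>_. 1)" "z \<in> O[F](d)" "s \<in> O[F](e)" "\<And>p. y p = w p + z p + s p"
    using assms(2) by (rule jetE) blast
  show ?thesis
    by (rule jetI[OF sum_in_bigo(1)[OF r(1) s(1)] sum_in_bigo(1)[OF r(2) s(2)] sum_in_bigo(1)[OF r(3) s(3)]])
      (simp add: r(4) s(4))
qed

lemma jet_mult:
  assumes "jet x u v" "jet y w z"
  shows "jet (\<lambda>p. x p * y p) (\<lambda>p. u p * w p) (\<lambda>p. u p * z p + v p * w p)"
proof -
  obtain r where r: "u \<in> O[F](\<lambda>_. 1)" "v \<in> O[F](d)" "r \<in> O[F](e)" "\<And>p. x p = u p + v p + r p"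
    using assms(1) by (rule jetE) blast
  obtain s where s: "w \<in> O[F](\<lambda>_. 1)" "z \<in> O[F](d)" "s \<in> O[F](e)" "\<And>p. y p = w p + z p + s p"
    using assms(2) by (rule jetE) blast
  have "(\<lambda>p. r p * y p + u p * s p + v p * s p + v p * z p) \<in> O[F](e)"
    using bigo_mult_1[OF r(3) jet_bounded[OF assms(2)]] bigo_1_mult[OF r(1) s(3)]
      bigo_1_mult[OF bigo_d_imp_bounded[OF r(2)] s(3)] bigo_d_mult_d[OF r(2) s(2)]
    by (intro sum_in_bigo(1))
  then show ?thesis
    by (rule jetI[OF bigo_1_mult[OF r(1) s(1)] sum_in_bigo(1)[OF bigo_1_mult[OF r(1) s(2)] bigo_mult_1[OF r(2) s(1)]]])
      (simp add: r(4) s(4) algebra_simps)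
qed

lemma jet_const: "jet (\<lambda>_. c) (\<lambda>_. c) (\<lambda>_. 0)"
  by (rule jetI[where r = "\<lambda>_. 0"]) auto

lemma jet_cmult:
  assumes "jet x u v" shows "jet (\<lambda>p. c * x p) (\<lambda>p. c * u p) (\<lambda>p. c * v p)"
  using jet_mult[OF jet_const assms] by simp

lemma jet_diff:
  assumes "jet x u v" "jet y w z"
  shows "jet (\<lambda>p. x p - y p) (\<lambda>p. u p - w p) (\<lambda>p. v p - z p)"
  using jet_add[OF assms(1) jet_cmult[OF assms(2), of "-1"]] by simp

text \<open>Bounds for both \<open>inverse x\<close> and \<open>inverse u\<close> are assumed:
  \<open>d\<close> need not be small along \<open>F\<close>, so neither bound follows from the
  other.\<close>

lemma jet_inverse:
  assumes xuv: "jet x u v"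
    and x: "eventually (\<lambda>p. x p \<noteq> 0) F" "(\<lambda>p. inverse (x p)) \<in> O[F](\<lambda>_. 1)"
    and u: "eventually (\<lambda>p. u p \<noteq> 0) F" "(\<lambda>p. inverse (u p)) \<in> O[F](\<lambda>_. 1)"
  shows "jet (\<lambda>p. inverse (x p)) (\<lambda>p. inverse (u p)) (\<lambda>p. - (inverse (u p))\<^sup>2 * v p)"
proof -
  obtain r where r: "u \<in> O[F](\<lambda>_. 1)" "v \<in> O[F](d)" "r \<in> O[F](e)" "\<And>p. x p = u p + v p + r p"
    using xuv by (rule jetE) blast
  have u2: "(\<lambda>p. (inverse (u p))\<^sup>2) \<in> O[F](\<lambda>_. 1)"
    using bigo_1_mult[OF u(2) u(2)] by (simp add: power2_eq_square)
  let ?y = "\<lambda>p. inverse (u p) + - (inverse (u p))\<^sup>2 * v p"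
  have "(\<lambda>p. v p * v p + r p * v p) \<in> O[F](e)"
    using bigo_d_mult_d[OF r(2) r(2)] bigo_mult_1[OF r(3) bigo_d_imp_bounded[OF r(2)]]
    by (intro sum_in_bigo(1))
  from sum_in_bigo(2)[OF bigo_1_mult[OF u2 this] bigo_1_mult[OF u(2) r(3)]]
  have "(\<lambda>p. inverse (x p) * ((inverse (u p))\<^sup>2 * (v p * v p + r p * v p) - inverse (u p) * r p)) \<in> O[F](e)"
    by (rule bigo_1_mult[OF x(2)])
  \<comment> \<open>With \<open>y\<close> for \<open>?y\<close>, multiplying out gives
    \<open>1 - x y = (v^2 + r v) / u^2 - r / u\<close>; the left-hand side is
    \<open>inverse x\<close> times this.\<close>
  moreover have "eventually (\<lambda>p. inverse (x p) * ((inverse (u p))\<^sup>2 * (v p * v p + r p * v p) - inverse (u p) * r p) =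
      inverse (x p) - ?y p) F"
    using x(1) u(1)
  proof eventually_elim
    case (elim p)
    then have "x p * inverse (x p) = 1" "u p * inverse (u p) = 1" by auto
    with r(4)[of p] show ?case by algebra
  qed
  ultimately have "(\<lambda>p. inverse (x p) - ?y p) \<in> O[F](e)"
    using landau_o.big.in_cong by fastforce
  moreover have "(\<lambda>p. - (inverse (u p))\<^sup>2 * v p) \<in> O[F](d)"
    using bigo_1_mult[OF u2 r(2)] by simp
  ultimately show ?thesis
    using u(2) by (intro jetI[where r = "\<lambda>p. inverse (x p) - ?y p"]) auto
qed

lemma jet_eqI:
  assumes "jet x u v" "\<And>p. u p = u' p" "\<And>p. v p = v' p"
  shows "jet x u' v'"
  using assms(1) assms(2,3)[abs_def] by metis

text \<open>The \<open>a1, ..., a4\<close> are Taylor coefficients at the base point and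
  \<open>g1, g2, g3\<close> the first three derivatives at displacement \<open>h\<close>; the
  factors 2, 6, 24 come from differentiating \<open>a1 h + a2 h^2 + a3 h^3 + a4 h^4\<close>.\<close>

lemma jet_schwarzian:
  assumes "jet g1 a1 (\<lambda>p. 2 * a2 p * h p)" "jet g2 (\<lambda>p. 2 * a2 p) (\<lambda>p. 6 * a3 p * h p)"
    "jet g3 (\<lambda>p. 6 * a3 p) (\<lambda>p. 24 * a4 p * h p)"
    and "eventually (\<lambda>p. g1 p \<noteq> 0) F" "(\<lambda>p. inverse (g1 p)) \<in> O[F](\<lambda>_. 1)"
    and "eventually (\<lambda>p. a1 p \<noteq> 0) F" "(\<lambda>p. inverse (a1 p)) \<in> O[F](\<lambda>_. 1)"
  shows "jet (\<lambda>p. g3 p / g1 p - 3 / 2 * (g2 p / g1 p)\<^sup>2)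
     (\<lambda>p. 6 * (a3 p * inverse (a1 p) - (a2 p)\<^sup>2 * (inverse (a1 p))\<^sup>2))
     (\<lambda>p. 24 * (a4 p * inverse (a1 p) - 2 * a2 p * a3 p * (inverse (a1 p))\<^sup>2
        + a2 p ^ 3 * (inverse (a1 p)) ^ 3) * h p)"
proof -
  define b where "b = (\<lambda>p. inverse (a1 p))"
  note inv = jet_inverse[OF assms(1,4-7)]
  have q: "jet (\<lambda>p. g2 p * inverse (g1 p)) (\<lambda>p. 2 * a2 p * b p)
     (\<lambda>p. (6 * a3 p * b p - 4 * (a2 p)\<^sup>2 * (b p)\<^sup>2) * h p)"
    apply (rule jet_eqI[OF jet_mult[OF assms(2) inv]])
    apply (unfold b_def)
    subgoal by (simp add: algebra_simps)
    subgoal by (simp add: power2_eq_square algebra_simps)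
    done
  have "jet (\<lambda>p. g3 p * inverse (g1 p) - 3 / 2 * ((g2 p * inverse (g1 p)) * (g2 p * inverse (g1 p))))
     (\<lambda>p. 6 * (a3 p * b p - (a2 p)\<^sup>2 * (b p)\<^sup>2))
     (\<lambda>p. 24 * (a4 p * b p - 2 * a2 p * a3 p * (b p)\<^sup>2 + a2 p ^ 3 * (b p) ^ 3) * h p)"
    apply (rule jet_eqI[OF jet_diff[OF jet_mult[OF assms(3) inv] jet_cmult[OF jet_mult[OF q q]]]])
    apply (unfold b_def)
    subgoal by (simp add: power2_eq_square algebra_simps)
    subgoal by (simp add: power2_eq_square power3_eq_cube algebra_simps)
    done
  then show ?thesis
    unfolding b_def power2_eq_square divide_inverse[of _ "g1 _"] .
qed

text \<open>The hypotheses describe divided differences on two, three and four nodes: the linear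
  part is the next Taylor coefficient times the sum of the displacements of the nodes. In the
  numerator and in the denominator these partial sums combine to the full sum of all four
  displacements, as in the sum \<open>s\<close> of the Schwarz derivatives.\<close>

lemma jet_distortion:
  assumes jets: "jet q34 a1 (\<lambda>p. a2 p * (h3 p + h4 p))" "jet q23 a1 (\<lambda>p. a2 p * (h2 p + h3 p))"
    "jet q14 a1 (\<lambda>p. a2 p * (h1 p + h4 p))"
    "jet t134 a2 (\<lambda>p. a3 p * (h1 p + h3 p + h4 p))"
    "jet t234 a2 (\<lambda>p. a3 p * (h2 p + h3 p + h4 p))"
    "jet w a3 (\<lambda>p. a4 p * (h1 p + h2 p + h3 p + h4 p))"
    and q23: "eventually (\<lambda>p. q23 p \<noteq> 0) F" "(\<lambda>p. inverse (q23 p)) \<in> O[F](\<lambda>_. 1)"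
    and q14: "eventually (\<lambda>p. q14 p \<noteq> 0) F" "(\<lambda>p. inverse (q14 p)) \<in> O[F](\<lambda>_. 1)"
    and a1: "eventually (\<lambda>p. a1 p \<noteq> 0) F" "(\<lambda>p. inverse (a1 p)) \<in> O[F](\<lambda>_. 1)"
    and s: "jet s (\<lambda>p. 24 * (a3 p * inverse (a1 p) - (a2 p)\<^sup>2 * (inverse (a1 p))\<^sup>2))
     (\<lambda>p. 24 * (a4 p * inverse (a1 p) - 2 * a2 p * a3 p * (inverse (a1 p))\<^sup>2
        + a2 p ^ 3 * (inverse (a1 p)) ^ 3) * (h1 p + h2 p + h3 p + h4 p))"
  shows "(\<lambda>p. (w p * q34 p - t134 p * t234 p) / (q23 p * q14 p) - 1 / 24 * s p) \<in> O[F](e)"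
proof -
  define b where "b = (\<lambda>p. inverse (a1 p))"
  define h where "h = (\<lambda>p. h1 p + h2 p + h3 p + h4 p)"
  have D: "jet (\<lambda>p. inverse (q23 p) * inverse (q14 p)) (\<lambda>p. (b p)\<^sup>2) (\<lambda>p. - (b p ^ 3 * a2 p * h p))"
    apply (rule jet_eqI[OF jet_mult[OF jet_inverse[OF jets(2) q23 a1] jet_inverse[OF jets(3) q14 a1]]])
    apply (unfold b_def h_def)
    subgoal by (simp add: power2_eq_square)
    subgoal by (simp add: power2_eq_square power3_eq_cube algebra_simps)
    done
  have n: "jet (\<lambda>p. w p * q34 p - t134 p * t234 p) (\<lambda>p. a3 p * a1 p - (a2 p)\<^sup>2)
      (\<lambda>p. (a4 p * a1 p - a2 p * a3 p) * h p)"
    apply (rule jet_eqI[OF jet_diff[OF jet_mult[OF jets(6,1)] jet_mult[OF jets(4,5)]]])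
    apply (unfold h_def)
    subgoal by (simp add: power2_eq_square)
    subgoal by (simp add: algebra_simps)
    done
  let ?R = "\<lambda>p. (w p * q34 p - t134 p * t234 p) * (inverse (q23 p) * inverse (q14 p)) - 1 / 24 * s p"
  note R = jet_diff[OF jet_mult[OF n D] jet_cmult[OF s, of "1 / 24"]]
  obtain r where r: "r \<in> O[F](e)" and req: "\<And>p. ?R p =
     ((a3 p * a1 p - (a2 p)\<^sup>2) * (b p)\<^sup>2 - 1 / 24 * (24 * (a3 p * b p - (a2 p)\<^sup>2 * (b p)\<^sup>2)))
     + (((a3 p * a1 p - (a2 p)\<^sup>2) * (- (b p ^ 3 * a2 p * h p))
        + (a4 p * a1 p - a2 p * a3 p) * h p * (b p)\<^sup>2)
        - 1 / 24 * (24 * (a4 p * b p - 2 * a2 p * a3 p * (b p)\<^sup>2 + a2 p ^ 3 * (b p) ^ 3) * h p))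
     + r p"
    unfolding b_def h_def by (rule jetE[OF R[unfolded b_def h_def]]) blast
  \<comment> \<open>Modulo \<open>a1 * b = 1\<close> the constant part and the linear part of
    \<open>?R\<close> both cancel, so that only the remainder is left.\<close>
  have "eventually (\<lambda>p. ?R p = r p) F"
    using a1(1)
  proof eventually_elim
    case (elim p)
    then have ab: "a1 p * b p = 1" by (simp add: b_def)
    have "(a3 p * a1 p - (a2 p)\<^sup>2) * (b p)\<^sup>2 - (a3 p * b p - (a2 p)\<^sup>2 * (b p)\<^sup>2) = 0"
      using ab by algebra
    moreover have "((a3 p * a1 p - (a2 p)\<^sup>2) * (- (b p ^ 3 * a2 p * h p))
        + (a4 p * a1 p - a2 p * a3 p) * h p * (b p)\<^sup>2)
        - (a4 p * b p - 2 * a2 p * a3 p * (b p)\<^sup>2 + a2 p ^ 3 * (b p) ^ 3) * h p = 0"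
      using ab by algebra
    ultimately show ?case unfolding req by (simp only: mult.assoc[symmetric]) simp
  qed
  then have "?R \<in> O[F](e)" using r by (subst landau_o.big.in_cong)
  then show ?thesis by (simp only: divide_inverse inverse_mult_distrib)
qed

end

section \<open>Divided differences of real functions\<close>

text \<open>Induction by adding a new largest point: Rolle's theorem between the old maximum and the
  new one gives a zero beyond all the earlier ones, so it is new and the count is exact.\<close>

lemma rolle_finite_set:
  fixes g g' :: "real \<Rightarrow> real"
  assumes deriv: "\<And>x. x \<in> {A..B} \<Longrightarrow> (g has_real_derivative g' x) (at x within {A..B})"
    and X: "finite X" "X \<noteq> {}" "X \<subseteq> {A..B}" "\<And>x. x \<in> X \<Longrightarrow> g x = 0"
  shows "\<exists>Y. finite Y \<and> Suc (card Y) = card X \<and> Y \<subseteq> {Min X..Max X} \<and> (\<forall>y\<in>Y. y < Max X \<and> g' y = 0)"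
  using X
proof (induction X rule: finite_linorder_max_induct)
  case empty
  then show ?case by simp
next
  case (insert b X)
  show ?case
  proof (cases "X = {}")
    case True
    then show ?thesis by (intro exI[of _ "{}"]) auto
  next
    case False
    then obtain Y where Y: "finite Y" "Suc (card Y) = card X" "Y \<subseteq> {Min X..Max X}"
      "\<forall>y\<in>Y. y < Max X \<and> g' y = 0"
      using insert by auto
    have M: "Max X \<in> X" "Max X < b" using insert False by auto
    have "Min X < b" using insert False by auto
    then have ext: "Max (insert b X) = b" "Min (insert b X) = Min X"
      using insert.hyps(1) False M by (simp_all add: Max_insert Min_insert)
    have sub: "{Max X..b} \<subseteq> {A..B}" using insert.prems M by auto
    have "\<exists>z\<in>{Max X<..<b}. g b - g (Max X) = g' z * (b - Max X)"
    proof (rule mvt_simple[OF M(2), where f' = "\<lambda>x v. g' x * v"])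
      fix x assume "Max X \<le> x" "x \<le> b"
      then have "(g has_real_derivative g' x) (at x within {Max X..b})"
        using deriv[of x] sub by (meson DERIV_subset atLeastAtMost_iff subsetD)
      then show "(g has_derivative (\<lambda>v. g' x * v)) (at x within {Max X..b})"
        by (simp add: has_field_derivative_def)
    qed
    then obtain z where z: "Max X < z" "z < b" "g' z = 0"
      using insert.prems(3)[of b] insert.prems(3)[of "Max X"] M by auto
    have "Min X \<le> Max X" using insert.hyps(1) M(1) by simp
    have "finite (insert z Y) \<and> Suc (card (insert z Y)) = card (insert b X) \<and>
        insert z Y \<subseteq> {Min (insert b X)..Max (insert b X)} \<and>
        (\<forall>y\<in>insert z Y. y < Max (insert b X) \<and> g' y = 0)"
    proof -
      have "z \<notin> Y" using Y z by auto
      moreover have "b \<notin> X" using insert.hyps by auto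
      ultimately show ?thesis
        unfolding ext using Y(1,2) Y(3) Y(4) z M(2) insert.hyps(1) \<open>Min X \<le> Max X\<close>
        by (auto simp: subset_iff)
    qed
    then show ?thesis by blast
  qed
qed

text \<open>The difference \<open>fs 0 - p\<close> has \<open>n + 1\<close> zeros, and each
  differentiation costs one. A zero of the \<open>n\<close>-th derivative therefore remains between
  the extreme points, and the \<open>n\<close>-th derivative of \<open>p\<close> is constant because
  of the degree bound.\<close>

lemma interpolation_mvt:
  fixes fs :: "nat \<Rightarrow> real \<Rightarrow> real"
  assumes deriv: "\<And>k x. k < n \<Longrightarrow> x \<in> {A..B} \<Longrightarrow> (fs k has_real_derivative fs (Suc k) x) (at x within {A..B})"
    and X: "finite X" "card X = Suc n" "X \<subseteq> {A..B}" "\<And>x. x \<in> X \<Longrightarrow> fs 0 x = poly p x"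
    and p: "degree p \<le> n"
  shows "\<exists>\<xi>\<in>{Min X..Max X}. fs n \<xi> = fact n * coeff p n"
proof -
  let ?g = "\<lambda>k x. fs k x - poly ((pderiv ^^ k) p) x"
  have "k \<le> n \<Longrightarrow> \<exists>Y. finite Y \<and> card Y = Suc n - k \<and> Y \<subseteq> {Min X..Max X} \<and> (\<forall>y\<in>Y. ?g k y = 0)" for k
  proof (induction k)
    case 0
    then show ?case using X by (intro exI[of _ X]) auto
  next
    case (Suc k)
    then obtain Y where Y: "finite Y" "card Y = Suc n - k" "Y \<subseteq> {Min X..Max X}" "\<forall>y\<in>Y. ?g k y = 0"
      by auto
    have ne: "Y \<noteq> {}" using Y Suc by auto
    have "X \<noteq> {}" using X by auto
    then have "Min X \<in> X" "Max X \<in> X" using X by auto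
    then have sub: "{Min X..Max X} \<subseteq> {A..B}" using X by auto
    have "(?g k has_real_derivative ?g (Suc k) x) (at x within {A..B})" if "x \<in> {A..B}" for x
      using DERIV_diff[OF deriv[of k x] has_field_derivative_at_within[OF poly_DERIV]] Suc.prems that by simp
    from rolle_finite_set[OF this Y(1) ne]
    obtain Z where Z: "finite Z" "Suc (card Z) = card Y" "Z \<subseteq> {Min Y..Max Y}" "\<forall>y\<in>Z. ?g (Suc k) y = 0"
      using Y(3,4) sub by (auto simp: subset_iff)
    have "{Min Y..Max Y} \<subseteq> {Min X..Max X}"
      using Y(3) Min_in[OF Y(1) ne] Max_in[OF Y(1) ne] by fastforce
    then have "Z \<subseteq> {Min X..Max X}" using Z(3) by blast
    then show ?case using Z Y(2) Suc.prems by (intro exI[of _ Z]) auto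
  qed
  from this[of n] obtain Y where Y: "card Y = 1" "Y \<subseteq> {Min X..Max X}" "\<forall>y\<in>Y. ?g n y = 0"
    by auto
  then obtain \<xi> where "Y = {\<xi>}" by (auto simp: card_1_singleton_iff)
  moreover have "(pderiv ^^ n) p = [:fact n * coeff p n:]"
  proof (rule poly_eqI)
    fix i
    show "coeff ((pderiv ^^ n) p) i = coeff [:fact n * coeff p n:] i"
    proof (cases i)
      case 0
      then show ?thesis by (simp add: coeff_higher_pderiv pochhammer_fact)
    next
      case (Suc j)
      then have "coeff p (n + i) = 0" using p by (intro coeff_eq_0) simp
      with Suc show ?thesis by (simp add: coeff_higher_pderiv add.commute)
    qed
  qed
  ultimately show ?thesis using Y by auto
qed

text \<open>Plain recursion, meaningful at distinct nodes only; on a segment, coincident points are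
  reached through limits of \<open>diff_quot\<close>.\<close>

definition dd2 :: "(real \<Rightarrow> real) \<Rightarrow> real \<Rightarrow> real \<Rightarrow> real" where
  "dd2 f a b = (f a - f b) / (a - b)"
definition dd3 :: "(real \<Rightarrow> real) \<Rightarrow> real \<Rightarrow> real \<Rightarrow> real \<Rightarrow> real" where
  "dd3 f a b c = (dd2 f a b - dd2 f b c) / (a - c)"
definition dd4 :: "(real \<Rightarrow> real) \<Rightarrow> real \<Rightarrow> real \<Rightarrow> real \<Rightarrow> real \<Rightarrow> real" where
  "dd4 f a b c d = (dd3 f a b c - dd3 f b c d) / (a - d)"

lemma dd_newton:
  assumes "distinct [a, b, c, d]"
  shows "f b = f a + (b - a) * dd2 f a b"
    "f c = f a + (c - a) * (dd2 f a b + (c - b) * dd3 f a b c)"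
    "f d = f a + (d - a) * (dd2 f a b + (d - b) * (dd3 f a b c + (d - c) * dd4 f a b c d))"
  using assms unfolding dd4_def dd3_def dd2_def
  apply (auto simp: divide_simps)
  subgoal premises by algebra
  subgoal premises by algebra
  subgoal premises by algebra
  done

lemma dd2_commute: "dd2 f a b = dd2 f b a"
  unfolding dd2_def using minus_divide_divide[of "f a - f b" "a - b"] by simp

lemma dd3_commute:
  assumes "distinct [a, b, c]"
  shows "dd3 f b a c = dd3 f a b c" "dd3 f a c b = dd3 f a b c"
  using assms unfolding dd3_def dd2_def
  apply (auto simp: divide_simps)
  subgoal premises by algebra
  subgoal premises by algebra
  done

text \<open>Adjacent transpositions generate all permutations of the nodes, so these three equations
  amount to full symmetry.\<close>

lemma dd4_commute:
  assumes "distinct [a, b, c, d]"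
  shows "dd4 f b a c d = dd4 f a b c d" "dd4 f a c b d = dd4 f a b c d" "dd4 f a b d c = dd4 f a b c d"
  using assms unfolding dd4_def dd3_def dd2_def
  apply (auto simp: divide_simps)
  subgoal premises by algebra
  subgoal premises by algebra
  subgoal premises by algebra
  done

text \<open>Here \<open>g n u0 u1 c k\<close> is the \<open>k\<close>-th derivative of
  \<open>fs 0\<close> minus a polynomial whose \<open>n\<close>-th derivative is
  \<open>u0 + u1 * (x - c)\<close>. As \<open>k < n\<close>, no exponent is truncated by the
  subtraction of naturals.\<close>

lemma taylor_polynomial_subtracted:
  fixes fs :: "nat \<Rightarrow> real \<Rightarrow> real"
  defines "g \<equiv> \<lambda>n u0 u1 c k x. fs k x - (u0 * ((x - c) ^ (n - k) / fact (n - k)) + u1 * ((x - c) ^ (Suc n - k) / fact (Suc n - k)))"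
  assumes "(fs k has_real_derivative fs (Suc k) x) (at x within S)" "k < n"
  shows "(g n u0 u1 c k has_real_derivative g n u0 u1 c (Suc k) x) (at x within S)"
proof -
  have pw: "((\<lambda>x. (x - c) ^ Suc m / fact (Suc m)) has_real_derivative ((x - c) ^ m / fact m)) (at x within S)" for m
    by (rule derivative_eq_intros refl | simp)+
  obtain m where m: "n - k = Suc m" "n - Suc k = m" "Suc n - k = Suc (Suc m)" "Suc n - Suc k = Suc m"
    using assms(3) by (metis Suc_diff_Suc Suc_diff_le diff_Suc_Suc less_imp_le)
  show ?thesis
    unfolding g_def m
    by (intro DERIV_diff assms(2) DERIV_add DERIV_cmult pw)
qed

text \<open>In this lemma and its two analogues \<open>?p\<close> is the Newton form of the
  interpolation polynomial; its leading coefficient is the divided difference.\<close>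

lemma dd2_mvt:
  fixes fs :: "nat \<Rightarrow> real \<Rightarrow> real"
  assumes deriv: "\<And>k x. k < 1 \<Longrightarrow> x \<in> {A..B} \<Longrightarrow> (fs k has_real_derivative fs (Suc k) x) (at x within {A..B})"
    and x: "a \<noteq> b" "{a, b} \<subseteq> {A..B}"
  shows "\<exists>\<xi>\<in>{Min {a, b}..Max {a, b}}. fs 1 \<xi> = dd2 (fs 0) a b"
proof -
  let ?p = "[:fs 0 a:] + [:-a, 1:] * [:dd2 (fs 0) a b:]"
  have "\<exists>\<xi>\<in>{Min {a, b}..Max {a, b}}. fs 1 \<xi> = fact 1 * coeff ?p 1"
  proof (rule interpolation_mvt)
    have "fs 0 b = fs 0 a + (b - a) * dd2 (fs 0) a b"
      using x(1) unfolding dd2_def by (auto simp: divide_simps) (simp add: algebra_simps)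
    then show "fs 0 x = poly ?p x" if "x \<in> {a, b}" for x
      using that by (auto simp: algebra_simps)
  qed (use assms deriv in auto)
  then show ?thesis by simp
qed

lemma dd3_mvt:
  fixes fs :: "nat \<Rightarrow> real \<Rightarrow> real"
  assumes deriv: "\<And>k x. k < 2 \<Longrightarrow> x \<in> {A..B} \<Longrightarrow> (fs k has_real_derivative fs (Suc k) x) (at x within {A..B})"
    and x: "distinct [a, b, c]" "{a, b, c} \<subseteq> {A..B}"
  shows "\<exists>\<xi>\<in>{Min {a, b, c}..Max {a, b, c}}. fs 2 \<xi> = 2 * dd3 (fs 0) a b c"
proof -
  let ?p = "[:fs 0 a:] + [:-a, 1:] * ([:dd2 (fs 0) a b:] + [:-b, 1:] * [:dd3 (fs 0) a b c:])"
  have "\<exists>\<xi>\<in>{Min {a, b, c}..Max {a, b, c}}. fs 2 \<xi> = fact 2 * coeff ?p 2"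
  proof (rule interpolation_mvt)
    have "fs 0 c = fs 0 a + (c - a) * (dd2 (fs 0) a b + (c - b) * dd3 (fs 0) a b c)"
      "fs 0 b = fs 0 a + (b - a) * dd2 (fs 0) a b"
      using x(1) unfolding dd3_def dd2_def
       apply (auto simp: divide_simps)
      subgoal premises by algebra
      subgoal premises by algebra
      done
    then show "fs 0 x = poly ?p x" if "x \<in> {a, b, c}" for x
      using that by (auto simp: algebra_simps)
  qed (use assms deriv in auto)
  then show ?thesis by (simp add: numeral_2_eq_2)
qed

lemma dd4_mvt:
  fixes fs :: "nat \<Rightarrow> real \<Rightarrow> real"
  assumes deriv: "\<And>k x. k < 3 \<Longrightarrow> x \<in> {A..B} \<Longrightarrow> (fs k has_real_derivative fs (Suc k) x) (at x within {A..B})"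
    and x: "distinct [a, b, c, d]" "{a, b, c, d} \<subseteq> {A..B}"
  shows "\<exists>\<xi>\<in>{Min {a, b, c, d}..Max {a, b, c, d}}. fs 3 \<xi> = 6 * dd4 (fs 0) a b c d"
proof -
  let ?p = "[:fs 0 a:] + [:-a, 1:] * ([:dd2 (fs 0) a b:] + [:-b, 1:] * ([:dd3 (fs 0) a b c:] + [:-c, 1:] * [:dd4 (fs 0) a b c d:]))"
  have "\<exists>\<xi>\<in>{Min {a, b, c, d}..Max {a, b, c, d}}. fs 3 \<xi> = fact 3 * coeff ?p 3"
  proof (rule interpolation_mvt)
    show "fs 0 x = poly ?p x" if "x \<in> {a, b, c, d}" for x
      using that dd_newton[OF x(1), of "fs 0"] by (auto simp: algebra_simps)
  qed (use assms deriv in auto)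
  then show ?thesis by (simp add: numeral_3_eq_3 fact_numeral)
qed

lemma dd_linear:
  "dd2 (\<lambda>x. f x - (u * p x + v * q x)) a b = dd2 f a b - (u * dd2 p a b + v * dd2 q a b)"
  "dd3 (\<lambda>x. f x - (u * p x + v * q x)) a b c = dd3 f a b c - (u * dd3 p a b c + v * dd3 q a b c)"
  "dd4 (\<lambda>x. f x - (u * p x + v * q x)) a b c d = dd4 f a b c d - (u * dd4 p a b c d + v * dd4 q a b c d)"
  unfolding dd4_def dd3_def dd2_def by (simp_all add: divide_inverse algebra_simps)

text \<open>The numerators, here and for more nodes, are the complete homogeneous symmetric
  polynomials in the shifted nodes.\<close>

lemma dd2_power:
  assumes "a \<noteq> b"
  shows "dd2 (\<lambda>x. (x - c) ^ 1 / fact 1) a b = 1"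
    "dd2 (\<lambda>x. (x - c) ^ 2 / fact 2) a b = ((a - c) + (b - c)) / 2"
    "dd2 (\<lambda>x. (x - c) ^ 3 / fact 3) a b = ((a - c)\<^sup>2 + (a - c) * (b - c) + (b - c)\<^sup>2) / 6"
    "dd2 (\<lambda>x. (x - c) ^ 4 / fact 4) a b = ((a - c) ^ 3 + (a - c)\<^sup>2 * (b - c) + (a - c) * (b - c)\<^sup>2 + (b - c) ^ 3) / 24"
  using assms unfolding dd2_def
     apply (auto simp: divide_simps fact_numeral)
  subgoal premises by algebra
  subgoal premises by algebra
  subgoal premises by algebra
  done

lemma dd3_power:
  assumes "distinct [a, b, e]"
  shows "dd3 (\<lambda>x. (x - c) ^ 2 / fact 2) a b e = 1 / 2"
    "dd3 (\<lambda>x. (x - c) ^ 3 / fact 3) a b e = ((a - c) + (b - c) + (e - c)) / 6"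
    "dd3 (\<lambda>x. (x - c) ^ 4 / fact 4) a b e = ((a - c)\<^sup>2 + (b - c)\<^sup>2 + (e - c)\<^sup>2
        + (a - c) * (b - c) + (a - c) * (e - c) + (b - c) * (e - c)) / 24"
proof -
  have ne: "a \<noteq> b" "b \<noteq> e" "a \<noteq> e" using assms by auto
  show "dd3 (\<lambda>x. (x - c) ^ 2 / fact 2) a b e = 1 / 2"
    using ne(3) unfolding dd3_def dd2_power[OF ne(1)] dd2_power[OF ne(2)] by (auto simp: divide_simps)
  show "dd3 (\<lambda>x. (x - c) ^ 3 / fact 3) a b e = ((a - c) + (b - c) + (e - c)) / 6"
    using ne(3) unfolding dd3_def dd2_power[OF ne(1)] dd2_power[OF ne(2)]
    apply (auto simp: divide_simps)
    subgoal premises by algebra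
    done
  show "dd3 (\<lambda>x. (x - c) ^ 4 / fact 4) a b e = ((a - c)\<^sup>2 + (b - c)\<^sup>2 + (e - c)\<^sup>2
        + (a - c) * (b - c) + (a - c) * (e - c) + (b - c) * (e - c)) / 24"
    using ne(3) unfolding dd3_def dd2_power[OF ne(1)] dd2_power[OF ne(2)]
    apply (auto simp: divide_simps)
    subgoal premises by algebra
    done
qed

lemma dd4_power:
  assumes "distinct [a, b, e, d]"
  shows "dd4 (\<lambda>x. (x - c) ^ 3 / fact 3) a b e d = 1 / 6"
    "dd4 (\<lambda>x. (x - c) ^ 4 / fact 4) a b e d = ((a - c) + (b - c) + (e - c) + (d - c)) / 24"
proof -
  have ne: "distinct [a, b, e]" "distinct [b, e, d]" "a \<noteq> d" using assms by auto
  show "dd4 (\<lambda>x. (x - c) ^ 3 / fact 3) a b e d = 1 / 6"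
    using ne(3) unfolding dd4_def dd3_power[OF ne(1)] dd3_power[OF ne(2)] by (auto simp: divide_simps)
  show "dd4 (\<lambda>x. (x - c) ^ 4 / fact 4) a b e d = ((a - c) + (b - c) + (e - c) + (d - c)) / 24"
    using ne(3) unfolding dd4_def dd3_power[OF ne(1)] dd3_power[OF ne(2)]
    apply (auto simp: divide_simps)
    subgoal premises by algebra
    done
qed

text \<open>Mean value theorem for \<open>fs 0\<close> minus the polynomial with \<open>n\<close>-th derivative \<open>u + v (x - c)\<close>.\<close>

lemma dd_taylor:
  fixes fs :: "nat \<Rightarrow> real \<Rightarrow> real"
  assumes deriv: "\<And>k x. k < 3 \<Longrightarrow> x \<in> {A..B} \<Longrightarrow> (fs k has_real_derivative fs (Suc k) x) (at x within {A..B})"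
    and x: "distinct [x1, x2, x3, x4]" "{x1, x2, x3, x4} \<subseteq> {lo..hi}" "{lo..hi} \<subseteq> {A..B}"
    and E: "\<And>x. x \<in> {lo..hi} \<Longrightarrow> \<bar>fs n x - (u + v * (x - c))\<bar> \<le> E"
  shows "n = 1 \<Longrightarrow> \<bar>dd2 (fs 0) x1 x2 - (u + v / 2 * ((x1 - c) + (x2 - c)))\<bar> \<le> E"
    "n = 2 \<Longrightarrow> \<bar>dd3 (fs 0) x1 x2 x3 - (u / 2 + v / 6 * ((x1 - c) + (x2 - c) + (x3 - c)))\<bar> \<le> E"
    "n = 3 \<Longrightarrow> \<bar>dd4 (fs 0) x1 x2 x3 x4 - (u / 6 + v / 24 * ((x1 - c) + (x2 - c) + (x3 - c) + (x4 - c)))\<bar> \<le> E"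
proof -
  have E0: "0 \<le> E" using E[of x1] x(2) by (force intro: order_trans[OF abs_ge_zero])
  \<comment> \<open>Beyond order \<open>n\<close> the formula would suffer from truncated exponents;
    the value 0 there is a filler, since the mean value theorem is applied at order \<open>n\<close>
    only.\<close>
  define gs where "gs = (\<lambda>k x. if k \<le> n then fs k x - (u * ((x - c) ^ (n - k) / fact (n - k))
      + v * ((x - c) ^ (Suc n - k) / fact (Suc n - k))) else 0)"
  have g0: "gs 0 = (\<lambda>x. fs 0 x - (u * ((x - c) ^ n / fact n) + v * ((x - c) ^ Suc n / fact (Suc n))))"
    by (simp add: gs_def)
  have gn: "gs n x = fs n x - (u + v * (x - c))" for x
    by (simp add: gs_def)
  have gd: "(gs k has_real_derivative gs (Suc k) x) (at x within {A..B})" if "k < n" "n \<le> 3" "x \<in> {A..B}" for k x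
    using taylor_polynomial_subtracted[OF deriv[of k x], of n u c v] that by (simp add: gs_def[abs_def])
  have ne: "x1 \<noteq> x2" "distinct [x1, x2, x3]" using x by auto
  have sucs: "Suc 1 = 2" "Suc 2 = 3" "Suc 3 = 4" by simp_all
  have E': "\<bar>gs n \<xi>\<bar> \<le> E" if "\<xi> \<in> {Min X..Max X}" "X \<noteq> {}" "X \<subseteq> {x1, x2, x3, x4}" for \<xi> X
  proof -
    have "finite X" using that finite_subset by blast
    then have "Min X \<in> {lo..hi}" "Max X \<in> {lo..hi}"
      using Min_in[OF _ that(2)] Max_in[OF _ that(2)] that(3) x(2) by (meson subsetD)+
    then show ?thesis unfolding gn using that(1) by (intro E) auto
  qed
  show "\<bar>dd2 (fs 0) x1 x2 - (u + v / 2 * ((x1 - c) + (x2 - c)))\<bar> \<le> E" if n: "n = 1"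
  proof -
    have "\<exists>\<xi>\<in>{Min {x1, x2}..Max {x1, x2}}. gs 1 \<xi> = dd2 (gs 0) x1 x2"
      by (rule dd2_mvt[where fs = gs, OF gd]) (use x n in \<open>auto simp: subset_iff\<close>)
    then obtain \<xi> where \<xi>: "\<xi> \<in> {Min {x1, x2}..Max {x1, x2}}" "gs 1 \<xi> = dd2 (gs 0) x1 x2" by blast
    have "\<bar>gs 1 \<xi>\<bar> \<le> E" using E'[OF \<xi>(1)] by (simp add: n)
    then have "\<bar>dd2 (gs 0) x1 x2\<bar> \<le> E" unfolding \<xi>(2) .
    moreover have "dd2 (gs 0) x1 x2 = dd2 (fs 0) x1 x2 - (u * 1 + v * (((x1 - c) + (x2 - c)) / 2))"
      unfolding g0 dd_linear n sucs dd2_power[OF ne(1)] ..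
    ultimately show ?thesis by simp
  qed
  show "\<bar>dd3 (fs 0) x1 x2 x3 - (u / 2 + v / 6 * ((x1 - c) + (x2 - c) + (x3 - c)))\<bar> \<le> E" if n: "n = 2"
  proof -
    have "\<exists>\<xi>\<in>{Min {x1, x2, x3}..Max {x1, x2, x3}}. gs 2 \<xi> = 2 * dd3 (gs 0) x1 x2 x3"
      by (rule dd3_mvt[where fs = gs, OF gd]) (use x n in \<open>auto simp: subset_iff\<close>)
    then obtain \<xi> where \<xi>: "\<xi> \<in> {Min {x1, x2, x3}..Max {x1, x2, x3}}" "gs 2 \<xi> = 2 * dd3 (gs 0) x1 x2 x3" by blast
    have "\<bar>gs 2 \<xi>\<bar> \<le> E" using E'[OF \<xi>(1)] by (simp add: n)
    then have "\<bar>2 * dd3 (gs 0) x1 x2 x3\<bar> \<le> E" unfolding \<xi>(2) .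
    moreover have "dd3 (gs 0) x1 x2 x3 = dd3 (fs 0) x1 x2 x3 - (u * (1 / 2) + v * (((x1 - c) + (x2 - c) + (x3 - c)) / 6))"
      unfolding g0 dd_linear n sucs dd3_power[OF ne(2)] ..
    ultimately show ?thesis using E0 by (simp add: abs_mult)
  qed
  show "\<bar>dd4 (fs 0) x1 x2 x3 x4 - (u / 6 + v / 24 * ((x1 - c) + (x2 - c) + (x3 - c) + (x4 - c)))\<bar> \<le> E" if n: "n = 3"
  proof -
    have "\<exists>\<xi>\<in>{Min {x1, x2, x3, x4}..Max {x1, x2, x3, x4}}. gs 3 \<xi> = 6 * dd4 (gs 0) x1 x2 x3 x4"
      by (rule dd4_mvt[where fs = gs, OF gd]) (use x n in \<open>auto simp: subset_iff\<close>)
    then obtain \<xi> where \<xi>: "\<xi> \<in> {Min {x1, x2, x3, x4}..Max {x1, x2, x3, x4}}" "gs 3 \<xi> = 6 * dd4 (gs 0) x1 x2 x3 x4" by blast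
    have "\<bar>gs 3 \<xi>\<bar> \<le> E" using E'[OF \<xi>(1)] by (simp add: n)
    then have "\<bar>6 * dd4 (gs 0) x1 x2 x3 x4\<bar> \<le> E" unfolding \<xi>(2) .
    moreover have "dd4 (gs 0) x1 x2 x3 x4 = dd4 (fs 0) x1 x2 x3 x4 - (u * (1 / 6) + v * (((x1 - c) + (x2 - c) + (x3 - c) + (x4 - c)) / 24))"
      unfolding g0 dd_linear n sucs dd4_power[OF x(1)] ..
    ultimately show ?thesis using E0 by (simp add: abs_mult)
  qed
qed

section \<open>Quadruples of distinct points\<close>

text \<open>Insert \<open>f[1,2] = f[2,3] + (x1 - x3) f[1,2,3]\<close> and
  \<open>f[4,1] = f[3,4] + (x1 - x3) f[1,3,4]\<close>: the product \<open>f[2,3] f[3,4]\<close>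
  cancels and a factor \<open>x1 - x3\<close> comes out. Then
  \<open>f[1,2,3] = f[1,3,4] + (x2 - x4) f[1,2,3,4]\<close> and
  \<open>f[3,4] - f[2,3] = (x4 - x2) f[2,3,4]\<close> yield the factor
  \<open>x2 - x4\<close>.\<close>

lemma dd_cross_identity:
  assumes "distinct [x1, x2, x3, x4]"
  shows "dd2 f x1 x2 * dd2 f x3 x4 - dd2 f x2 x3 * dd2 f x4 x1 =
    (x1 - x3) * (x2 - x4) * (dd4 f x1 x2 x3 x4 * dd2 f x3 x4 - dd3 f x1 x3 x4 * dd3 f x2 x3 x4)"
proof -
  have "dd2 f x1 x2 - dd2 f x2 x3 = (x1 - x3) * dd3 f x1 x2 x3"
    using assms by (simp add: dd3_def)
  moreover have "dd2 f x3 x4 - dd2 f x4 x1 = (x3 - x1) * dd3 f x1 x3 x4"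
    using assms dd3_commute[of x3 x4 x1 f] dd3_commute[of x3 x1 x4 f] by (simp add: dd3_def[of f x3 x4 x1])
  moreover have "dd3 f x1 x2 x3 - dd3 f x1 x3 x4 = (x2 - x4) * dd4 f x1 x2 x3 x4"
    using assms dd4_commute(1)[OF assms, of f] dd3_commute(1)[of x1 x2 x3 f] by (simp add: dd4_def[of f x2 x1] field_simps)
  moreover have "dd2 f x3 x4 - dd2 f x2 x3 = (x4 - x2) * dd3 f x2 x3 x4"
    using assms by (simp add: dd3_def field_simps)
  ultimately show ?thesis by algebra
qed

lemma dd2_mean_value:
  assumes "\<And>x. x \<in> {A..B} \<Longrightarrow> (f has_real_derivative f' x) (at x within {A..B})"
    and "a \<noteq> b" "a \<in> {A..B}" "b \<in> {A..B}"
  shows "\<exists>\<xi>\<in>{min a b..max a b}. f' \<xi> = dd2 f a b"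
  using dd2_mvt[where fs = "\<lambda>k. if k = 0 then f else f'" and A = A and B = B and a = a and b = b] assms
  by simp

lemma diff_quot_eq_dd2: "a \<noteq> b \<Longrightarrow> diff_quot d f a b = dd2 f a b"
  by (simp add: diff_quot_def dd2_def)

lemma cr_dist_eq_dd:
  assumes "distinct [x1, x2, x3, x4]" "dd2 f x2 x3 \<noteq> 0" "dd2 f x1 x4 \<noteq> 0"
  shows "cr_dist d f x1 x2 x3 x4 = 1 + (x1 - x3) * (x2 - x4) *
    ((dd4 f x1 x2 x3 x4 * dd2 f x3 x4 - dd3 f x1 x3 x4 * dd3 f x2 x3 x4) / (dd2 f x2 x3 * dd2 f x1 x4))"
  using dd_cross_identity[OF assms(1), of f] assms dd2_commute[of f x4 x1]
  by (simp add: cr_dist_def diff_quot_eq_dd2 field_simps)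

lemma abs_bounded_below:
  fixes g :: "real \<Rightarrow> real"
  assumes "continuous_on {A..B} g" "A < B" "\<And>x. x \<in> {A..B} \<Longrightarrow> g x \<noteq> 0"
  obtains m where "m > 0" "\<And>x. x \<in> {A..B} \<Longrightarrow> m \<le> \<bar>g x\<bar>"
proof -
  have "continuous_on {A..B} (\<lambda>x. \<bar>g x\<bar>)" using assms(1) by (intro continuous_intros)
  from continuous_attains_inf[OF compact_Icc _ this] assms(2)
  obtain x where "x \<in> {A..B}" "\<And>y. y \<in> {A..B} \<Longrightarrow> \<bar>g x\<bar> \<le> \<bar>g y\<bar>" by auto
  then show ?thesis using assms(3)[of x] by (intro that[of "\<bar>g x\<bar>"]) auto
qed

lemma dist_le_diameter_quad:
  fixes p :: "nat \<Rightarrow> 'a::real_normed_vector"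
  assumes "i \<in> {1, 2, 3, 4}" "j \<in> {1, 2, 3, 4}"
  shows "norm (p i - p j) \<le> diameter {p 1, p 2, p 3, p 4}"
  using diameter_bounded_bound[of "{p 1, p 2, p 3, p 4}" "p i" "p j"] assms
  by (auto simp: dist_norm)

lemma bigo_principalI:
  assumes "\<And>p. p \<in> P \<Longrightarrow> norm (f p) \<le> C * norm (g p)"
  shows "f \<in> O[principal P](g)"
  using assms by (intro bigoI[of _ C]) (simp add: eventually_principal)

lemma bigo_principalE:
  assumes "f \<in> O[principal P](g)"
  obtains C where "C > 0" "\<And>p. p \<in> P \<Longrightarrow> norm (f p) \<le> C * norm (g p)"
  using assms by (elim landau_o.bigE) (auto simp: eventually_principal)

text \<open>
  The factor \<open>s\<close> switches the linear terms of all expansions on (\<open>s = 1\<close>, four derivatives, \<open>\<rho> = 1 + \<gamma>\<close>)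
  or off (\<open>s = 0\<close>, three derivatives, \<open>\<rho> = \<beta>\<close>; then \<open>fs 4\<close> is irrelevant).
\<close>

context
  fixes A B s \<rho> C :: real and fs :: "nat \<Rightarrow> real \<Rightarrow> real"
  assumes AB: "A < B" and rho: "0 \<le> \<rho>" "\<rho> \<le> 2" 
    and deriv: "\<And>k x. k < 3 \<Longrightarrow> x \<in> {A..B} \<Longrightarrow> (fs k has_real_derivative fs (Suc k) x) (at x within {A..B})"
    and cont: "continuous_on {A..B} (fs 3)"
    and nz: "\<And>x. x \<in> {A..B} \<Longrightarrow> fs 1 x \<noteq> 0"
    and rem: "\<And>n x y. n \<in> {1, 2, 3} \<Longrightarrow> x \<in> {A..B} \<Longrightarrow> y \<in> {A..B} \<Longrightarrow>
       \<bar>fs n x - (fs n y + s * fs (Suc n) y * (x - y))\<bar> \<le> C * \<bar>x - y\<bar> powr \<rho>"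
    and fs4: "\<And>x. x \<in> {A..B} \<Longrightarrow> \<bar>fs 4 x\<bar> \<le> C"
begin

lemma distinct_expansion:
  "\<exists>K. \<forall>x1\<in>{A..B}. \<forall>x2\<in>{A..B}. \<forall>x3\<in>{A..B}. \<forall>x4\<in>{A..B}. distinct [x1, x2, x3, x4] \<longrightarrow>
     \<bar>cr_dist d (fs 0) x1 x2 x3 x4 - (1 + (x1 - x3) * (x2 - x4) * (1 / 24 *
        (\<Sum>x\<leftarrow>[x1, x2, x3, x4]. fs 3 x / fs 1 x - 3 / 2 * (fs 2 x / fs 1 x)\<^sup>2)))\<bar>
      \<le> K * \<bar>(x1 - x3) * (x2 - x4)\<bar> * diameter {x1, x2, x3, x4} powr \<rho>"
proof -
  \<comment> \<open>A quadruple is encoded by a function \<open>p\<close>, of which only \<open>p 1, \<dots>, p 4\<close> matter.\<close>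
  define P where "P = {p :: nat \<Rightarrow> real. {p 1, p 2, p 3, p 4} \<subseteq> {A..B} \<and> distinct [p 1, p 2, p 3, p 4]}"
  define F where "F = principal P"
  define \<Delta> where "\<Delta> = (\<lambda>p :: nat \<Rightarrow> real. diameter {p 1, p 2, p 3, p 4})"
  define I where "I = {1::nat, 2, 3, 4}"
  have \<Delta>0: "0 \<le> \<Delta> p" for p
    unfolding \<Delta>_def by (rule diameter_ge_0) auto
  have \<Delta>: "\<bar>p i - p j\<bar> \<le> \<Delta> p" if "i \<in> I" "j \<in> I" for p i j
    using dist_le_diameter_quad[of i j p] that by (simp add: \<Delta>_def I_def)
  have PI: "p i \<in> {A..B}" if "p \<in> P" "i \<in> I" for p i
    using that by (auto simp: P_def I_def)
  have \<Delta>le: "\<Delta> p \<le> B - A" if "p \<in> P" for p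
    unfolding \<Delta>_def by (rule diameter_le) (use that in \<open>auto simp: P_def\<close>)
  \<comment> \<open>This is where \<open>\<rho> \<le> 2\<close> enters: on a bounded segment the
    square of \<Delta> is then dominated by \<Delta>^\<rho>, as the calculus of jets
    requires.\<close>
  have pw: "\<Delta> p * \<Delta> p \<le> (B - A) powr (2 - \<rho>) * \<Delta> p powr \<rho>" if "p \<in> P" for p
  proof (cases "\<Delta> p = 0")
    case False
    then have "\<Delta> p * \<Delta> p = \<Delta> p powr (2 - \<rho>) * \<Delta> p powr \<rho>"
      using \<Delta>0[of p] by (simp add: powr_add[symmetric] power2_eq_square[symmetric])
    also have "\<dots> \<le> (B - A) powr (2 - \<rho>) * \<Delta> p powr \<rho>"
      by (intro mult_right_mono powr_mono2) (use \<Delta>0[of p] \<Delta>le[OF that] rho in auto)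
    finally show ?thesis .
  qed simp
  interpret jet_calculus F \<Delta> "\<lambda>p. \<Delta> p powr \<rho>"
  proof
    show "\<Delta> \<in> O[F](\<lambda>_. 1)"
      unfolding F_def by (rule bigo_principalI[of _ _ "B - A"]) (use \<Delta>0 \<Delta>le in simp)
    show "(\<lambda>p. \<Delta> p powr \<rho>) \<in> O[F](\<lambda>_. 1)"
      unfolding F_def by (rule bigo_principalI[of _ _ "(B - A) powr \<rho>"])
        (use \<Delta>0 \<Delta>le rho in \<open>simp add: powr_mono2\<close>)
    show "(\<lambda>p. \<Delta> p * \<Delta> p) \<in> O[F](\<lambda>p. \<Delta> p powr \<rho>)"
      unfolding F_def by (rule bigo_principalI[of _ _ "(B - A) powr (2 - \<rho>)"]) (use pw \<Delta>0 in simp)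
  qed
  have cont_fs: "continuous_on {A..B} (fs n)" if "n \<le> 3" for n
  proof (cases "n = 3")
    case False
    then have "continuous (at x within {A..B}) (fs n)" if "x \<in> {A..B}" for x
      using DERIV_continuous[OF deriv[of n x]] that \<open>n \<le> 3\<close> by simp
    then show ?thesis by (simp add: continuous_on_eq_continuous_within)
  qed (use cont in simp)
  have bdd: "(\<lambda>p. fs n (p 1)) \<in> O[F](\<lambda>_. 1)" if "n \<le> 4" for n
  proof -
    have "\<exists>M. \<forall>x\<in>{A..B}. \<bar>fs n x\<bar> \<le> M"
    proof (cases "n = 4")
      case True
      then show ?thesis using fs4 by blast
    next
      case False
      then have "n \<le> 3" using that by simp
      from compact_imp_bounded[OF compact_continuous_image[OF cont_fs[OF this]]]
      show ?thesis by (auto simp: bounded_iff)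
    qed
    then obtain M where "\<And>x. x \<in> {A..B} \<Longrightarrow> \<bar>fs n x\<bar> \<le> M" by blast
    then show ?thesis
      unfolding F_def by (intro bigo_principalI[of _ _ M]) (use PI in \<open>simp add: I_def\<close>)
  qed
  obtain m where m: "m > 0" "\<And>x. x \<in> {A..B} \<Longrightarrow> m \<le> \<bar>fs 1 x\<bar>"
    using abs_bounded_below[OF _ AB, of "fs 1"] cont_fs[of 1] nz by auto
  have inv: "eventually (\<lambda>p. x p \<noteq> 0) F \<and> (\<lambda>p. inverse (x p)) \<in> O[F](\<lambda>_. 1)"
    if "\<And>p. p \<in> P \<Longrightarrow> m \<le> \<bar>x p\<bar>" for x :: "_ \<Rightarrow> real"
  proof
    show "eventually (\<lambda>p. x p \<noteq> 0) F"
      using m(1) that unfolding F_def eventually_principal by fastforce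
    show "(\<lambda>p. inverse (x p)) \<in> O[F](\<lambda>_. 1)"
      unfolding F_def by (rule bigo_principalI[of _ _ "inverse m"]) (use m(1) that in \<open>simp add: le_imp_inverse_le\<close>)
  qed
  define h where "h = (\<lambda>i (p :: nat \<Rightarrow> real). s * (p i - p 1))"
  have h: "h i \<in> O[F](\<Delta>)" if "i \<in> I" for i
    unfolding F_def h_def using \<Delta>[OF that, of 1] \<Delta>0
    by (intro bigo_principalI[of _ _ "\<bar>s\<bar>"]) (auto simp: abs_mult I_def intro!: mult_left_mono)
  have C0: "0 \<le> C" using fs4[of A] AB by force
  \<comment> \<open>The interval from \<open>lo p\<close> to \<open>hi p\<close> contains all four
    points and the intermediate points between them, yet stays within \<Delta> of the base point
    \<open>p 1\<close>; hence the remainder at any of its points is at most \<open>C\<close> times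
    \<Delta>^\<rho>.\<close>
  define lo where "lo = (\<lambda>p. max A (p 1 - \<Delta> p))"
  define hi where "hi = (\<lambda>p. min B (p 1 + \<Delta> p))"
  have hull: "p i \<in> {lo p..hi p}" "{lo p..hi p} \<subseteq> {A..B}" if "p \<in> P" "i \<in> I" for p i
    using \<Delta>[of i 1 p] PI[OF that] that by (auto simp: lo_def hi_def I_def)
  have rem': "\<bar>fs n x - (fs n (p 1) + s * fs (Suc n) (p 1) * (x - p 1))\<bar> \<le> C * \<Delta> p powr \<rho>"
    if "n \<in> {1, 2, 3}" "p \<in> P" "x \<in> {lo p..hi p}" for n p x
  proof -
    have "\<bar>fs n x - (fs n (p 1) + s * fs (Suc n) (p 1) * (x - p 1))\<bar> \<le> C * \<bar>x - p 1\<bar> powr \<rho>"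
      by (rule rem) (use that hull[of p 1] PI[of p 1] in \<open>auto simp: I_def\<close>)
    also have "\<dots> \<le> C * \<Delta> p powr \<rho>"
      by (intro mult_left_mono powr_mono2) (use that rho C0 in \<open>auto simp: lo_def hi_def\<close>)
    finally show ?thesis .
  qed
  have jet: "jet x u (\<lambda>p. b p * H p)"
    if "u \<in> O[F](\<lambda>_. 1)" "b \<in> O[F](\<lambda>_. 1)" "H \<in> O[F](\<Delta>)"
      "\<And>p. p \<in> P \<Longrightarrow> \<bar>x p - (u p + b p * H p)\<bar> \<le> C * \<Delta> p powr \<rho>" for x u b H
  proof (rule jetI[OF that(1) bigo_1_mult[OF that(2,3)]])
    show "(\<lambda>p. x p - (u p + b p * H p)) \<in> O[F](\<lambda>p. \<Delta> p powr \<rho>)"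
      unfolding F_def by (rule bigo_principalI[of _ _ C]) (use that(4) in simp)
  qed simp
  \<comment> \<open>Taylor coefficients at the base point \<open>p 1\<close>.\<close>
  define a1 a2 a3 a4 where "a1 = (\<lambda>p :: nat \<Rightarrow> real. fs 1 (p 1))" and "a2 = (\<lambda>p :: nat \<Rightarrow> real. fs 2 (p 1) / 2)"
    and "a3 = (\<lambda>p :: nat \<Rightarrow> real. fs 3 (p 1) / 6)" and "a4 = (\<lambda>p :: nat \<Rightarrow> real. fs 4 (p 1) / 24)"
  note a_def = a1_def a2_def a3_def a4_def
  have a: "a1 \<in> O[F](\<lambda>_. 1)" "a2 \<in> O[F](\<lambda>_. 1)" "a3 \<in> O[F](\<lambda>_. 1)" "a4 \<in> O[F](\<lambda>_. 1)"
    using bdd[of 1] bdd[of 2] bdd[of 3] bdd[of 4] by (simp_all add: a_def)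
  have ca: "(\<lambda>p. c * x p) \<in> O[F](\<lambda>_. 1)" if "x \<in> O[F](\<lambda>_. 1)" for c :: real and x :: "_ \<Rightarrow> real"
    using that by (cases "c = 0") auto
  have pts: "distinct [p i, p j, p k, p l]" "{p i, p j, p k, p l} \<subseteq> {lo p..hi p}" "{lo p..hi p} \<subseteq> {A..B}"
    if I: "{i, j, k, l} = I" and p: "p \<in> P" for i j k l p
  proof -
    have "card {i, j, k, l} = 4" by (simp add: I I_def)
    then have "distinct [i, j, k, l]" by (intro card_distinct) simp
    moreover have "inj_on p I" using p by (auto simp: P_def I_def inj_on_def)
    ultimately show "distinct [p i, p j, p k, p l]"
      using distinct_map[of p "[i, j, k, l]"] I by simp
    show "{p i, p j, p k, p l} \<subseteq> {lo p..hi p}" "{lo p..hi p} \<subseteq> {A..B}"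
      using hull[OF p] I by blast+
  qed
  \<comment> \<open>The indices \<open>k\<close> and \<open>l\<close> complete \<open>i, j\<close>
    to the full quadruple for which \<open>dd_taylor\<close> is stated; \<open>l\<close> serves the
    same purpose in the next claim.\<close>
  have J2: "jet (\<lambda>p. dd2 (fs 0) (p i) (p j)) a1 (\<lambda>p. a2 p * (h i p + h j p))"
    if I: "{i, j, k, l} = I" for i j k l
  proof (rule jet[OF a(1,2) sum_in_bigo(1)[OF h h]])
    fix p assume p: "p \<in> P"
    have eq: "a2 p * (h i p + h j p) = s * fs (Suc 1) (p 1) / 2 * ((p i - p 1) + (p j - p 1))"
      by (simp add: a_def h_def algebra_simps numeral_2_eq_2)
    show "\<bar>dd2 (fs 0) (p i) (p j) - (a1 p + a2 p * (h i p + h j p))\<bar> \<le> C * \<Delta> p powr \<rho>"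
      unfolding eq a1_def by (rule dd_taylor(1)[where fs = fs, OF deriv pts[OF I p] rem'[OF _ p, of 1] refl]) auto
  qed (use I in auto)
  have J3: "jet (\<lambda>p. dd3 (fs 0) (p i) (p j) (p k)) a2 (\<lambda>p. a3 p * (h i p + h j p + h k p))"
    if I: "{i, j, k, l} = I" for i j k l
  proof (rule jet[OF a(2,3) sum_in_bigo(1)[OF sum_in_bigo(1)[OF h h] h]])
    fix p assume p: "p \<in> P"
    have eq: "a3 p * (h i p + h j p + h k p) = s * fs (Suc 2) (p 1) / 6 * ((p i - p 1) + (p j - p 1) + (p k - p 1))"
      by (simp add: a_def h_def algebra_simps)
    show "\<bar>dd3 (fs 0) (p i) (p j) (p k) - (a2 p + a3 p * (h i p + h j p + h k p))\<bar> \<le> C * \<Delta> p powr \<rho>"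
      unfolding eq a2_def by (rule dd_taylor(2)[where fs = fs, OF deriv pts[OF I p] rem'[OF _ p, of 2] refl]) auto
  qed (use I in auto)
  have J4: "jet (\<lambda>p. dd4 (fs 0) (p 1) (p 2) (p 3) (p 4)) a3 (\<lambda>p. a4 p * (h 1 p + h 2 p + h 3 p + h 4 p))"
  proof (rule jet[OF a(3,4) sum_in_bigo(1)[OF sum_in_bigo(1)[OF sum_in_bigo(1)[OF h h] h] h]])
    fix p assume p: "p \<in> P"
    have eq: "a4 p * (h 1 p + h 2 p + h 3 p + h 4 p) =
        s * fs (Suc 3) (p 1) / 24 * ((p 1 - p 1) + (p 2 - p 1) + (p 3 - p 1) + (p 4 - p 1))"
      by (simp add: a_def h_def algebra_simps)
    show "\<bar>dd4 (fs 0) (p 1) (p 2) (p 3) (p 4) - (a3 p + a4 p * (h 1 p + h 2 p + h 3 p + h 4 p))\<bar> \<le> C * \<Delta> p powr \<rho>"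
      unfolding eq a3_def
      by (rule dd_taylor(3)[where fs = fs, OF deriv pts[OF I_def[symmetric] p] rem'[OF _ p, of 3] refl]) auto
  qed (auto simp: I_def)
  have Jf: "jet (\<lambda>p. fs n (p i)) (\<lambda>p. fs n (p 1)) (\<lambda>p. fs (Suc n) (p 1) * h i p)"
    if n: "n \<in> {1, 2, 3}" and i: "i \<in> I" for n i
  proof (rule jet[OF bdd bdd h[OF i]])
    fix p assume p: "p \<in> P"
    show "\<bar>fs n (p i) - (fs n (p 1) + fs (Suc n) (p 1) * h i p)\<bar> \<le> C * \<Delta> p powr \<rho>"
      using rem'[OF n p hull(1)[OF p i]] by (simp add: h_def mult_ac)
  qed (use n in auto)
  have a1: "eventually (\<lambda>p. a1 p \<noteq> 0) F" "(\<lambda>p. inverse (a1 p)) \<in> O[F](\<lambda>_. 1)"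
    using inv[of a1] m(2) PI by (simp_all add: a_def I_def)
  have JS: "jet (\<lambda>p. fs 3 (p i) / fs 1 (p i) - 3 / 2 * (fs 2 (p i) / fs 1 (p i))\<^sup>2)
     (\<lambda>p. 6 * (a3 p * inverse (a1 p) - (a2 p)\<^sup>2 * (inverse (a1 p))\<^sup>2))
     (\<lambda>p. 24 * (a4 p * inverse (a1 p) - 2 * a2 p * a3 p * (inverse (a1 p))\<^sup>2
        + a2 p ^ 3 * (inverse (a1 p)) ^ 3) * h i p)" if i: "i \<in> I" for i
  proof (rule jet_schwarzian[OF _ _ _ _ _ a1])
    show "jet (\<lambda>p. fs 1 (p i)) a1 (\<lambda>p. 2 * a2 p * h i p)"
      by (rule jet_eqI[OF Jf[of 1, OF _ i]]) (simp_all add: a_def numeral_2_eq_2)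
    show "jet (\<lambda>p. fs 2 (p i)) (\<lambda>p. 2 * a2 p) (\<lambda>p. 6 * a3 p * h i p)"
      by (rule jet_eqI[OF Jf[of 2, OF _ i]]) (simp_all add: a_def)
    show "jet (\<lambda>p. fs 3 (p i)) (\<lambda>p. 6 * a3 p) (\<lambda>p. 24 * a4 p * h i p)"
      by (rule jet_eqI[OF Jf[of 3, OF _ i]]) (simp_all add: a_def)
    show "eventually (\<lambda>p. fs 1 (p i) \<noteq> 0) F" "(\<lambda>p. inverse (fs 1 (p i))) \<in> O[F](\<lambda>_. 1)"
      using inv[of "\<lambda>p. fs 1 (p i)"] m(2) PI i by simp_all
  qed
  define S where "S = (\<lambda>x. fs 3 x / fs 1 x - 3 / 2 * (fs 2 x / fs 1 x)\<^sup>2)"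
  have J: "jet (\<lambda>p. S (p 1) + S (p 2) + S (p 3) + S (p 4))
     (\<lambda>p. 24 * (a3 p * inverse (a1 p) - (a2 p)\<^sup>2 * (inverse (a1 p))\<^sup>2))
     (\<lambda>p. 24 * (a4 p * inverse (a1 p) - 2 * a2 p * a3 p * (inverse (a1 p))\<^sup>2
        + a2 p ^ 3 * (inverse (a1 p)) ^ 3) * (h 1 p + h 2 p + h 3 p + h 4 p))"
    unfolding S_def
    by (rule jet_eqI[OF jet_add[OF jet_add[OF jet_add[OF JS[of 1] JS[of 2]] JS[of 3]] JS[of 4]]])
      (simp_all add: I_def distrib_left)
  \<comment> \<open>A difference quotient is a value of \<open>fs 1\<close>, so the lower bound
    \<open>m\<close> for the derivative passes to both denominators, however far apart the points
    are.\<close>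
  have mq: "m \<le> \<bar>dd2 (fs 0) x y\<bar>" if xy: "x \<noteq> y" "{x, y} \<subseteq> {A..B}" for x y
  proof -
    obtain \<xi> where "\<xi> \<in> {min x y..max x y}" and \<xi>: "fs 1 \<xi> = dd2 (fs 0) x y"
      using dd2_mean_value[OF deriv[of 0] xy(1)] xy(2) by auto
    then have "\<xi> \<in> {A..B}" using xy by auto
    then show ?thesis using m(2) \<xi> by metis
  qed
  have q: "eventually (\<lambda>p. dd2 (fs 0) (p i) (p j) \<noteq> 0) F \<and> (\<lambda>p. inverse (dd2 (fs 0) (p i) (p j))) \<in> O[F](\<lambda>_. 1)"
    if "i \<in> I" "j \<in> I" "i \<noteq> j" for i j
  proof (rule inv[OF mq])
    fix p assume "p \<in> P"
    then show "p i \<noteq> p j" "{p i, p j} \<subseteq> {A..B}" using that by (auto simp: P_def I_def)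
  qed
  define T where "T = (\<lambda>p :: nat \<Rightarrow> real. (dd4 (fs 0) (p 1) (p 2) (p 3) (p 4) * dd2 (fs 0) (p 3) (p 4)
     - dd3 (fs 0) (p 1) (p 3) (p 4) * dd3 (fs 0) (p 2) (p 3) (p 4)) / (dd2 (fs 0) (p 2) (p 3) * dd2 (fs 0) (p 1) (p 4)))"
  have "(\<lambda>p. T p - 1 / 24 * (S (p 1) + S (p 2) + S (p 3) + S (p 4))) \<in> O[F](\<lambda>p. \<Delta> p powr \<rho>)"
    unfolding T_def
    by (rule jet_distortion[OF J2[of 3 4 1 2] J2[of 2 3 1 4] J2[of 1 4 2 3] J3[of 1 3 4 2] J3[of 2 3 4 1] J4 _ _ _ _ a1 J])
      (use q[of 2 3] q[of 1 4] in \<open>auto simp: I_def\<close>)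
  then obtain K where K: "K > 0" "\<And>p. p \<in> P \<Longrightarrow>
      \<bar>T p - 1 / 24 * (S (p 1) + S (p 2) + S (p 3) + S (p 4))\<bar> \<le> K * \<Delta> p powr \<rho>"
    unfolding F_def by (rule bigo_principalE) auto
  show ?thesis
    unfolding S_def[symmetric]
  proof (intro exI[of _ K] ballI impI)
    fix x1 x2 x3 x4
    assume x: "x1 \<in> {A..B}" "x2 \<in> {A..B}" "x3 \<in> {A..B}" "x4 \<in> {A..B}" "distinct [x1, x2, x3, x4]"
    \<comment> \<open>The leading 0 shifts the list so that the points sit at the indices 1 to
      4.\<close>
    define p where "p = (\<lambda>i. [0, x1, x2, x3, x4] ! i)"
    have p: "p 1 = x1" "p 2 = x2" "p 3 = x3" "p 4 = x4" by (simp_all add: p_def)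
    have "p \<in> P" using x unfolding P_def mem_Collect_eq p by auto
    have "cr_dist d (fs 0) x1 x2 x3 x4 = 1 + (x1 - x3) * (x2 - x4) * T p"
      unfolding T_def p by (rule cr_dist_eq_dd[OF x(5)]) (use mq[of x2 x3] mq[of x1 x4] x m(1) in auto)
    then have "cr_dist d (fs 0) x1 x2 x3 x4 - (1 + (x1 - x3) * (x2 - x4) * (1 / 24 * (\<Sum>x\<leftarrow>[x1, x2, x3, x4]. S x)))
      = ((x1 - x3) * (x2 - x4)) * (T p - 1 / 24 * (S (p 1) + S (p 2) + S (p 3) + S (p 4)))"
      unfolding p right_diff_distrib by (simp add: add.assoc)
    also have "\<bar>\<dots>\<bar> \<le> \<bar>(x1 - x3) * (x2 - x4)\<bar> * (K * \<Delta> p powr \<rho>)"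
      unfolding abs_mult[of "_ * _"] using K(2)[OF \<open>p \<in> P\<close>] by (intro mult_left_mono) auto
    finally show "\<bar>cr_dist d (fs 0) x1 x2 x3 x4 - (1 + (x1 - x3) * (x2 - x4) * (1 / 24 * (\<Sum>x\<leftarrow>[x1, x2, x3, x4]. S x)))\<bar>
      \<le> K * \<bar>(x1 - x3) * (x2 - x4)\<bar> * diameter {x1, x2, x3, x4} powr \<rho>"
      unfolding \<Delta>_def p by (simp only: mult_ac)
  qed
qed

end

section \<open>Coincident points\<close>

text \<open>The closed form makes the diameter visibly continuous in the four points, which the
  passage to coincident points needs.\<close>

lemma diameter_quad:
  fixes x1 x2 x3 x4 :: real
  shows "diameter {x1, x2, x3, x4} = max (max x1 x2) (max x3 x4) - min (min x1 x2) (min x3 x4)"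
    (is "_ = ?M - ?m")
proof (rule antisym)
  have between: "?m \<le> u \<and> u \<le> ?M" if "u \<in> {x1, x2, x3, x4}" for u
    using that by (elim insertE emptyE) (simp_all add: min_le_iff_disj le_max_iff_disj)
  show "diameter {x1, x2, x3, x4} \<le> ?M - ?m"
  proof (rule diameter_le)
    fix u v assume "u \<in> {x1, x2, x3, x4}" "v \<in> {x1, x2, x3, x4}"
    from between[OF this(1)] between[OF this(2)] show "norm (u - v) \<le> ?M - ?m"
      unfolding real_norm_def abs_le_iff by linarith
  qed simp
  have "?M \<in> {x1, x2, x3, x4}" "?m \<in> {x1, x2, x3, x4}"
    unfolding max_def min_def by simp_all
  from diameter_bounded_bound[OF _ this] show "?M - ?m \<le> diameter {x1, x2, x3, x4}"
    by (simp add: dist_real_def)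
qed

context
  fixes A B :: real and f f1 :: "real \<Rightarrow> real" and d
  assumes AB: "A < B"
    and deriv: "\<And>x. x \<in> {A..B} \<Longrightarrow> (f has_real_derivative f1 x) (at x within {A..B})"
    and cont: "continuous_on {A..B} f1"
    and d: "\<And>x. x \<in> {A..B} \<Longrightarrow> d f x = f1 x"
begin

lemma diff_quot_mean_value:
  assumes "a \<in> {A..B}" "b \<in> {A..B}"
  shows "\<exists>\<xi>\<in>{min a b..max a b}. diff_quot d f a b = f1 \<xi>"
proof (cases "a = b")
  case True
  then show ?thesis using d[of a] assms by (auto simp: diff_quot_def)
next
  case False
  then show ?thesis using dd2_mean_value[OF deriv _ assms] diff_quot_eq_dd2[of a b d f] by metis
qed

text \<open>If the limits coincide, the point supplied by the mean value theorem is squeezed between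
  \<open>y t\<close> and \<open>z t\<close>, and continuity of the derivative finishes the argument;
  mere differentiability at \<open>a\<close> would not control quotients with two moving
  points.\<close>

lemma tendsto_diff_quot:
  assumes y: "(y \<longlongrightarrow> a) F" "(z \<longlongrightarrow> b) F"
    and ev: "eventually (\<lambda>t. y t \<in> {A..B} \<and> z t \<in> {A..B} \<and> y t \<noteq> z t) F"
    and ab: "a \<in> {A..B}" "b \<in> {A..B}"
  shows "((\<lambda>t. diff_quot d f (y t) (z t)) \<longlongrightarrow> diff_quot d f a b) F"
proof (cases "a = b")
  case True
  obtain \<xi> where \<xi>: "\<And>u v. u \<in> {A..B} \<Longrightarrow> v \<in> {A..B} \<Longrightarrow>
      min u v \<le> \<xi> u v \<and> \<xi> u v \<le> max u v \<and> diff_quot d f u v = f1 (\<xi> u v)"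
    using diff_quot_mean_value by (metis atLeastAtMost_iff)
  have ev': "eventually (\<lambda>t. min (y t) (z t) \<le> \<xi> (y t) (z t) \<and> \<xi> (y t) (z t) \<le> max (y t) (z t) \<and>
      \<xi> (y t) (z t) \<in> {A..B} \<and> f1 (\<xi> (y t) (z t)) = diff_quot d f (y t) (z t)) F"
    using ev
  proof eventually_elim
    case (elim t)
    then have yz: "y t \<in> {A..B}" "z t \<in> {A..B}" by blast+
    then have "A \<le> min (y t) (z t)" "max (y t) (z t) \<le> B" by simp_all
    then show ?case using \<xi>[OF yz] order_trans by auto
  qed
  have "((\<lambda>t. min (y t) (z t)) \<longlongrightarrow> a) F" "((\<lambda>t. max (y t) (z t)) \<longlongrightarrow> a) F"
    using tendsto_min[OF y] tendsto_max[OF y] True by simp_all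
  then have "((\<lambda>t. \<xi> (y t) (z t)) \<longlongrightarrow> a) F"
    by (rule tendsto_sandwich[rotated 2]) (use ev' in \<open>auto elim: eventually_mono\<close>)
  then have "((\<lambda>t. f1 (\<xi> (y t) (z t))) \<longlongrightarrow> f1 a) F"
    by (rule continuous_on_tendsto_compose[OF cont _ ab(1)]) (rule eventually_mono[OF ev'], blast)
  then have "((\<lambda>t. diff_quot d f (y t) (z t)) \<longlongrightarrow> f1 a) F"
    by (rule Lim_transform_eventually) (use ev' in \<open>auto elim: eventually_mono\<close>)
  then show ?thesis using True d ab by (simp add: diff_quot_def)
next
  case False
  have cf: "continuous_on {A..B} f"
    using DERIV_continuous[OF deriv] by (simp add: continuous_on_eq_continuous_within)
  have "((\<lambda>t. f (y t)) \<longlongrightarrow> f a) F" "((\<lambda>t. f (z t)) \<longlongrightarrow> f b) F"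
    using ev by (auto intro!: continuous_on_tendsto_compose[OF cf] y ab elim: eventually_mono)
  then have "((\<lambda>t. (f (y t) - f (z t)) / (y t - z t)) \<longlongrightarrow> (f a - f b) / (a - b)) F"
    using False by (intro tendsto_intros y) auto
  then have "((\<lambda>t. diff_quot d f (y t) (z t)) \<longlongrightarrow> (f a - f b) / (a - b)) F"
    by (rule Lim_transform_eventually)
      (use ev in \<open>auto elim!: eventually_mono simp: diff_quot_def\<close>)
  then show ?thesis using False by (simp add: diff_quot_def)
qed

text \<open>Both sides of the inequality are continuous along an approach by distinct points. The
  exponent \<rho> may be negative or zero, so the limit of the power requires a nonzero diameter.
  \<open>S\<close> is kept general: it is the Schwarz derivative, or 0 when there are only two
  derivatives.\<close>

lemma expansion_from_distinct:
  assumes nz: "\<And>x. x \<in> {A..B} \<Longrightarrow> f1 x \<noteq> 0"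
    and S: "continuous_on {A..B} S"
    and K: "\<forall>x1\<in>{A..B}. \<forall>x2\<in>{A..B}. \<forall>x3\<in>{A..B}. \<forall>x4\<in>{A..B}. distinct [x1, x2, x3, x4] \<longrightarrow>
     \<bar>cr_dist d f x1 x2 x3 x4 - (1 + (x1 - x3) * (x2 - x4) * (1 / 24 * (\<Sum>x\<leftarrow>[x1, x2, x3, x4]. S x)))\<bar>
      \<le> K * \<bar>(x1 - x3) * (x2 - x4)\<bar> * diameter {x1, x2, x3, x4} powr \<rho>"
    and x: "x1 \<in> {A..B}" "x2 \<in> {A..B}" "x3 \<in> {A..B}" "x4 \<in> {A..B}"
    and \<Delta>: "diameter {x1, x2, x3, x4} \<noteq> 0"
  shows "\<bar>cr_dist d f x1 x2 x3 x4 - (1 + (x1 - x3) * (x2 - x4) * (1 / 24 * (\<Sum>x\<leftarrow>[x1, x2, x3, x4]. S x)))\<bar>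
      \<le> K * \<bar>(x1 - x3) * (x2 - x4)\<bar> * diameter {x1, x2, x3, x4} powr \<rho>"
proof -
  define x where "x = (\<lambda>i. [x1, x2, x3, x4] ! i)"
  \<comment> \<open>Moving the points towards four equally spaced ones makes them distinct for small \<open>t > 0\<close>.\<close>
  define y where "y = (\<lambda>i t. (1 - t) * x i + t * (A + of_nat i * (B - A) / 4))"
  define F where "F = at_right (0::real)"
  have x': "x 0 = x1" "x 1 = x2" "x 2 = x3" "x 3 = x4" by (simp_all add: x_def)
  have xAB: "x i \<in> {A..B}" if "i < 4" for i
    using that x by (auto simp: x_def less_Suc_eq numeral_eq_Suc)
  have lim: "(y i \<longlongrightarrow> x i) F" for i
  proof -
    have "(y i \<longlongrightarrow> (1 - 0) * x i + 0 * (A + of_nat i * (B - A) / 4)) F"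
      unfolding y_def F_def by (intro tendsto_intros)
    then show ?thesis by simp
  qed
  have pos: "eventually (\<lambda>t. 0 < t \<and> t < 1) F"
    unfolding F_def by (simp add: eventually_at_right_field exI[of _ 1])
  have yAB: "eventually (\<lambda>t. y i t \<in> {A..B}) F" if "i < 4" for i
    using pos
  proof eventually_elim
    case (elim t)
    have "of_nat i * (B - A) \<le> 4 * (B - A)" using that AB by (intro mult_right_mono) auto
    then have "A + of_nat i * (B - A) / 4 \<in> {A..B}" using AB by auto
    from convexD[OF convex_closed_interval xAB[OF that] this, of "1 - t" t] elim
    show ?case by (simp add: y_def)
  qed
  have yne: "eventually (\<lambda>t. y i t \<noteq> y j t) F" if "i \<noteq> j" for i j
  proof (cases "x i = x j")
    case True
    show ?thesis using pos
      by eventually_elim (use True that AB in \<open>simp add: y_def\<close>)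
  next
    case False
    have "((\<lambda>t. y i t - y j t) \<longlongrightarrow> x i - x j) F" by (intro tendsto_intros lim)
    from tendsto_imp_eventually_ne[OF this, of 0] False show ?thesis by simp
  qed
  have dq: "((\<lambda>t. diff_quot d f (y i t) (y j t)) \<longlongrightarrow> diff_quot d f (x i) (x j)) F"
    if "i < 4" "j < 4" "i \<noteq> j" for i j
    by (rule tendsto_diff_quot[OF lim lim _ xAB[OF that(1)] xAB[OF that(2)]])
      (intro eventually_conj yAB yne that)
  have dq0: "diff_quot d f (x i) (x j) \<noteq> 0" if ij: "i < 4" "j < 4" for i j
  proof -
    obtain \<xi> where "\<xi> \<in> {min (x i) (x j)..max (x i) (x j)}" "diff_quot d f (x i) (x j) = f1 \<xi>"
      using diff_quot_mean_value[OF xAB[OF ij(1)] xAB[OF ij(2)]] by blast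
    moreover from this have "\<xi> \<in> {A..B}" using xAB[OF ij(1)] xAB[OF ij(2)] by auto
    ultimately show ?thesis using nz by metis
  qed
  have cr: "((\<lambda>t. cr_dist d f (y 0 t) (y 1 t) (y 2 t) (y 3 t)) \<longlongrightarrow> cr_dist d f (x 0) (x 1) (x 2) (x 3)) F"
    unfolding cr_dist_def by (intro tendsto_intros dq) (use dq0 in auto)
  have S': "((\<lambda>t. S (y i t)) \<longlongrightarrow> S (x i)) F" if "i < 4" for i
    by (rule continuous_on_tendsto_compose[OF S lim xAB[OF that] yAB[OF that]])
  have L: "((\<lambda>t. \<bar>cr_dist d f (y 0 t) (y 1 t) (y 2 t) (y 3 t) -
        (1 + (y 0 t - y 2 t) * (y 1 t - y 3 t) * (1 / 24 * (S (y 0 t) + S (y 1 t) + S (y 2 t) + S (y 3 t))))\<bar>)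
     \<longlongrightarrow> \<bar>cr_dist d f (x 0) (x 1) (x 2) (x 3) -
        (1 + (x 0 - x 2) * (x 1 - x 3) * (1 / 24 * (S (x 0) + S (x 1) + S (x 2) + S (x 3))))\<bar>) F"
    by (intro tendsto_intros cr lim S') auto
  have R: "((\<lambda>t. K * \<bar>(y 0 t - y 2 t) * (y 1 t - y 3 t)\<bar> * diameter {y 0 t, y 1 t, y 2 t, y 3 t} powr \<rho>)
     \<longlongrightarrow> K * \<bar>(x 0 - x 2) * (x 1 - x 3)\<bar> * diameter {x 0, x 1, x 2, x 3} powr \<rho>) F"
  proof (intro tendsto_mult tendsto_const tendsto_rabs tendsto_diff lim tendsto_powr)
    show "((\<lambda>t. diameter {y 0 t, y 1 t, y 2 t, y 3 t}) \<longlongrightarrow> diameter {x 0, x 1, x 2, x 3}) F"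
      unfolding diameter_quad by (intro tendsto_intros lim)
  qed (use \<Delta> x' in auto)
  have "eventually (\<lambda>t. \<forall>i\<in>{..<4}. y i t \<in> {A..B}) F"
    by (intro eventually_ball_finite) (simp_all add: yAB del: atLeastAtMost_iff)
  moreover have "eventually (\<lambda>t. \<forall>i\<in>{..<4}. \<forall>j\<in>{..<4}. i \<noteq> j \<longrightarrow> y i t \<noteq> y j t) F"
  proof (intro eventually_ball_finite ballI finite_lessThan)
    fix i j
    show "eventually (\<lambda>t. i \<noteq> j \<longrightarrow> y i t \<noteq> y j t) F"
      by (cases "i = j") (simp_all add: yne)
  qed
  ultimately have "eventually (\<lambda>t. y 0 t \<in> {A..B} \<and> y 1 t \<in> {A..B} \<and> y 2 t \<in> {A..B} \<and> y 3 t \<in> {A..B} \<and>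
      distinct [y 0 t, y 1 t, y 2 t, y 3 t]) F"
    by eventually_elim (simp del: atLeastAtMost_iff)
  then have "eventually (\<lambda>t. \<bar>cr_dist d f (y 0 t) (y 1 t) (y 2 t) (y 3 t) -
        (1 + (y 0 t - y 2 t) * (y 1 t - y 3 t) * (1 / 24 * (S (y 0 t) + S (y 1 t) + S (y 2 t) + S (y 3 t))))\<bar>
      \<le> K * \<bar>(y 0 t - y 2 t) * (y 1 t - y 3 t)\<bar> * diameter {y 0 t, y 1 t, y 2 t, y 3 t} powr \<rho>) F"
  proof eventually_elim
    case (elim t)
    have "distinct [y 0 t, y 1 t, y 2 t, y 3 t]" using elim by blast
    from K[rule_format, OF _ _ _ _ this] elim show ?case
      by (simp only: list.map sum_list.Cons sum_list.Nil add_0_right add.assoc)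
  qed
  from tendsto_le[OF _ R L this] show ?thesis
    unfolding x' by (simp add: F_def add.assoc)
qed

end

section \<open>Two derivatives\<close>

text \<open>The gap times the divided difference on four nodes is a difference of two divided
  differences on three nodes, and each of these is half a value of \<open>fs 2\<close>. This bounds
  the product without a third derivative.\<close>

lemma dd4_times_gap:
  assumes "distinct [x1, x2, x3, x4]"
    and E: "\<And>u v. u \<in> {lo..hi} \<Longrightarrow> v \<in> {lo..hi} \<Longrightarrow> \<bar>fs 2 u - fs 2 v\<bar> \<le> E"
    and deriv: "\<And>k x. k < 2 \<Longrightarrow> x \<in> {A..B} \<Longrightarrow> (fs k has_real_derivative fs (Suc k) x) (at x within {A..B})"
    and sub: "{x1, x2, x3, x4} \<subseteq> {lo..hi}" "{lo..hi} \<subseteq> {A..B}"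
  shows "\<bar>x1 - x4\<bar> * \<bar>dd4 (fs 0) x1 x2 x3 x4\<bar> \<le> E"
proof -
  have val: "\<exists>\<xi>\<in>{lo..hi}. fs 2 \<xi> = 2 * dd3 (fs 0) a b c" if abc: "distinct [a, b, c]" "{a, b, c} \<subseteq> {lo..hi}" for a b c
  proof -
    have "{a, b, c} \<subseteq> {A..B}" using abc(2) sub(2) by blast
    then have "\<exists>\<xi>\<in>{Min {a, b, c}..Max {a, b, c}}. fs 2 \<xi> = 2 * dd3 (fs 0) a b c"
      using abc(1) deriv by (intro dd3_mvt[where fs = fs]) auto
    moreover have "{Min {a, b, c}..Max {a, b, c}} \<subseteq> {lo..hi}"
      using abc(2) by auto
    ultimately show ?thesis by blast
  qed
  obtain u where u: "u \<in> {lo..hi}" "fs 2 u = 2 * dd3 (fs 0) x1 x2 x3"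
    using val[of x1 x2 x3] assms(1) sub(1) by auto
  obtain v where v: "v \<in> {lo..hi}" "fs 2 v = 2 * dd3 (fs 0) x2 x3 x4"
    using val[of x2 x3 x4] assms(1) sub(1) by auto
  have "(x1 - x4) * dd4 (fs 0) x1 x2 x3 x4 = (fs 2 u - fs 2 v) / 2"
    using assms(1) u v by (simp add: dd4_def)
  then have "\<bar>x1 - x4\<bar> * \<bar>dd4 (fs 0) x1 x2 x3 x4\<bar> = \<bar>fs 2 u - fs 2 v\<bar> / 2"
    by (simp flip: abs_mult)
  then show ?thesis using E[OF u(1) v(1)] by simp
qed

text \<open>By symmetry any two points can be made the outer nodes in \<open>dd4_times_gap\<close>.
  Taking the two extreme points turns the gap into \<Delta>, so \<open>\<bar>w\<bar>\<close> is at
  most \<open>L\<close> times \<Delta>^(\<alpha>-1). All other factors of the numerator are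
  bounded.\<close>

lemma distinct_expansion_second_order:
  fixes fs :: "nat \<Rightarrow> real \<Rightarrow> real"
  assumes AB: "A < B" and \<alpha>: "0 \<le> \<alpha>" "\<alpha> \<le> 1"
    and deriv: "\<And>k x. k < 2 \<Longrightarrow> x \<in> {A..B} \<Longrightarrow> (fs k has_real_derivative fs (Suc k) x) (at x within {A..B})"
    and cont: "continuous_on {A..B} (fs 2)"
    and nz: "\<And>x. x \<in> {A..B} \<Longrightarrow> fs 1 x \<noteq> 0"
    and L: "0 \<le> L" "\<And>x y. x \<in> {A..B} \<Longrightarrow> y \<in> {A..B} \<Longrightarrow> \<bar>fs 2 x - fs 2 y\<bar> \<le> L * \<bar>x - y\<bar> powr \<alpha>"
  shows "\<exists>K. \<forall>x1\<in>{A..B}. \<forall>x2\<in>{A..B}. \<forall>x3\<in>{A..B}. \<forall>x4\<in>{A..B}. distinct [x1, x2, x3, x4] \<longrightarrow>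
     \<bar>cr_dist d (fs 0) x1 x2 x3 x4 - 1\<bar> \<le> K * \<bar>(x1 - x3) * (x2 - x4)\<bar> * diameter {x1, x2, x3, x4} powr (\<alpha> - 1)"
proof -
  have cont1: "continuous_on {A..B} (fs 1)"
    using DERIV_continuous[OF deriv[of 1]] by (simp add: continuous_on_eq_continuous_within)
  obtain m where m: "m > 0" "\<And>x. x \<in> {A..B} \<Longrightarrow> m \<le> \<bar>fs 1 x\<bar>"
    using abs_bounded_below[OF _ AB, of "fs 1"] cont1 nz by auto
  obtain M where M: "\<And>x. x \<in> {A..B} \<Longrightarrow> \<bar>fs 1 x\<bar> \<le> M" "\<And>x. x \<in> {A..B} \<Longrightarrow> \<bar>fs 2 x\<bar> \<le> M"
  proof -
    have "bounded (fs 1 ` {A..B} \<union> fs 2 ` {A..B})"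
      using compact_continuous_image[OF cont1] compact_continuous_image[OF cont]
      by (simp add: compact_imp_bounded)
    then obtain M where "\<And>y. y \<in> fs 1 ` {A..B} \<union> fs 2 ` {A..B} \<Longrightarrow> norm y \<le> M"
      unfolding bounded_iff by blast
    then show ?thesis by (intro that[of M]) (auto simp flip: real_norm_def)
  qed
  have M0: "0 \<le> M" using M(1)[of A] AB by force
  have q: "m \<le> \<bar>dd2 (fs 0) x y\<bar> \<and> \<bar>dd2 (fs 0) x y\<bar> \<le> M" if xy: "x \<noteq> y" "x \<in> {A..B}" "y \<in> {A..B}" for x y
  proof -
    obtain \<xi> where "\<xi> \<in> {min x y..max x y}" and \<xi>: "fs 1 \<xi> = dd2 (fs 0) x y"
      using dd2_mean_value[OF deriv[of 0] xy] by auto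
    then have "\<xi> \<in> {A..B}" using xy by auto
    then show ?thesis using m(2) M(1) \<xi> by metis
  qed
  have t: "\<bar>dd3 (fs 0) x y z\<bar> \<le> M" if xyz: "distinct [x, y, z]" "{x, y, z} \<subseteq> {A..B}" for x y z
  proof -
    have "\<exists>\<xi>\<in>{Min {x, y, z}..Max {x, y, z}}. fs 2 \<xi> = 2 * dd3 (fs 0) x y z"
      using xyz deriv by (intro dd3_mvt[where fs = fs]) auto
    then obtain \<xi> where "\<xi> \<in> {Min {x, y, z}..Max {x, y, z}}" and \<xi>: "fs 2 \<xi> = 2 * dd3 (fs 0) x y z"
      by blast
    then have "\<xi> \<in> {A..B}" using xyz by auto
    from M(2)[OF this] show ?thesis unfolding \<xi> by (simp add: abs_mult)
  qed
  \<comment> \<open>The two summands come from \<open>f[1,2,3,4] f[3,4]\<close> and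
    \<open>f[1,3,4] f[2,3,4]\<close>; \<open>m * m\<close> is the lower bound for the
    denominator.\<close>
  define K where "K = (L * M + M * M * (B - A) powr (1 - \<alpha>)) / (m * m)"
  show ?thesis
  proof (intro exI[of _ K] ballI impI)
    fix x1 x2 x3 x4
    assume x: "x1 \<in> {A..B}" "x2 \<in> {A..B}" "x3 \<in> {A..B}" "x4 \<in> {A..B}" and dist: "distinct [x1, x2, x3, x4]"
    define X where "X = {x1, x2, x3, x4}"
    define \<Delta> where "\<Delta> = diameter X"
    define w where "w = dd4 (fs 0) x1 x2 x3 x4"
    define lo hi where "lo = Min X" and "hi = Max X"
    have fin: "finite X" "X \<noteq> {}" by (auto simp: X_def)
    have lohi: "lo \<in> X" "hi \<in> X" using Min_in[OF fin] Max_in[OF fin] by (simp_all add: lo_def hi_def)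
    have XAB: "X \<subseteq> {A..B}" using x by (auto simp: X_def)
    have sub: "X \<subseteq> {lo..hi}" "{lo..hi} \<subseteq> {A..B}"
      using fin lohi XAB by (auto simp: lo_def hi_def)
    have dX: "\<bar>u - v\<bar> \<le> \<Delta>" if "u \<in> X" "v \<in> X" for u v
      using diameter_bounded_bound[OF finite_imp_bounded[OF fin(1)] that] by (simp add: dist_real_def \<Delta>_def)
    have \<Delta>eq: "\<Delta> = \<bar>hi - lo\<bar>"
    proof (rule antisym)
      show "\<Delta> \<le> \<bar>hi - lo\<bar>" unfolding \<Delta>_def
      proof (rule diameter_le)
        fix u v assume "u \<in> X" "v \<in> X"
        with sub(1) have "u \<in> {lo..hi}" "v \<in> {lo..hi}" by blast+
        then show "norm (u - v) \<le> \<bar>hi - lo\<bar>" by auto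
      qed auto
    qed (use dX lohi in auto)
    have \<Delta>pos: "0 < \<Delta>" using dX[of x1 x2] dist by (auto simp: X_def)
    have "lo \<in> {A..B}" "hi \<in> {A..B}" using lohi XAB by blast+
    then have \<Delta>le: "\<Delta> \<le> B - A" using \<Delta>eq by auto
    have E: "\<bar>fs 2 u - fs 2 v\<bar> \<le> L * \<Delta> powr \<alpha>" if "u \<in> {lo..hi}" "v \<in> {lo..hi}" for u v
    proof -
      have "\<bar>u - v\<bar> powr \<alpha> \<le> \<Delta> powr \<alpha>" using that \<Delta>eq \<alpha> by (intro powr_mono2) auto
      then show ?thesis using L(2)[of u v] that sub(2) L(1) by (meson mult_left_mono order_trans subsetD)
    qed
    have gap: "\<bar>a - e\<bar> * \<bar>dd4 (fs 0) a b c e\<bar> \<le> L * \<Delta> powr \<alpha>" if "distinct [a, b, c, e]" "{a, b, c, e} = X" for a b c e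
      by (rule dd4_times_gap[OF that(1) E deriv _ sub(2)]) (use that sub(1) in auto)
    \<comment> \<open>The following equations bring each of the six pairs of points to the outer
      positions of \<open>dd4\<close>.\<close>
    note c = dd4_commute[where f = "fs 0"]
    have w1324: "dd4 (fs 0) x1 x3 x2 x4 = w" unfolding w_def by (rule c(2)[OF dist])
    have w14: "dd4 (fs 0) x1 x2 x3 x4 = w" by (simp add: w_def)
    have w13: "dd4 (fs 0) x1 x2 x4 x3 = w" unfolding w_def by (rule c(3)[OF dist])
    have w12: "dd4 (fs 0) x1 x3 x4 x2 = w" unfolding w1324[symmetric] by (rule c(3)) (use dist in auto)
    have w24: "dd4 (fs 0) x2 x1 x3 x4 = w" unfolding w_def by (rule c(1)[OF dist])
    have w23: "dd4 (fs 0) x2 x1 x4 x3 = w" unfolding w13[symmetric] by (rule c(1)) (use dist in auto)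
    have w34: "dd4 (fs 0) x3 x1 x2 x4 = w" unfolding w1324[symmetric] by (rule c(1)) (use dist in auto)
    have "\<bar>x1 - x4\<bar> * \<bar>w\<bar> \<le> L * \<Delta> powr \<alpha>"
      by (rule gap[of x1 x2 x3 x4, unfolded w14]) (use dist in \<open>auto simp: X_def\<close>)
    moreover have "\<bar>x1 - x3\<bar> * \<bar>w\<bar> \<le> L * \<Delta> powr \<alpha>"
      by (rule gap[of x1 x2 x4 x3, unfolded w13]) (use dist in \<open>auto simp: X_def\<close>)
    moreover have "\<bar>x1 - x2\<bar> * \<bar>w\<bar> \<le> L * \<Delta> powr \<alpha>"
      by (rule gap[of x1 x3 x4 x2, unfolded w12]) (use dist in \<open>auto simp: X_def\<close>)
    moreover have "\<bar>x2 - x4\<bar> * \<bar>w\<bar> \<le> L * \<Delta> powr \<alpha>"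
      by (rule gap[of x2 x1 x3 x4, unfolded w24]) (use dist in \<open>auto simp: X_def\<close>)
    moreover have "\<bar>x2 - x3\<bar> * \<bar>w\<bar> \<le> L * \<Delta> powr \<alpha>"
      by (rule gap[of x2 x1 x4 x3, unfolded w23]) (use dist in \<open>auto simp: X_def\<close>)
    moreover have "\<bar>x3 - x4\<bar> * \<bar>w\<bar> \<le> L * \<Delta> powr \<alpha>"
      by (rule gap[of x3 x1 x2 x4, unfolded w34]) (use dist in \<open>auto simp: X_def\<close>)
    moreover have "0 \<le> L * \<Delta> powr \<alpha>" using L(1) by simp
    ultimately have "\<bar>u - v\<bar> * \<bar>w\<bar> \<le> L * \<Delta> powr \<alpha>" if "u \<in> X" "v \<in> X" for u v
      using that unfolding X_def by (elim insertE emptyE; hypsubst) (simp_all only: abs_minus_commute diff_self abs_zero mult_zero_left)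
    from this[OF lohi(2,1)] have "\<bar>hi - lo\<bar> * \<bar>w\<bar> \<le> L * \<Delta> powr \<alpha>" .
    then have "\<bar>w\<bar> \<le> L * \<Delta> powr \<alpha> / \<Delta>"
      unfolding \<Delta>eq[symmetric] pos_le_divide_eq[OF \<Delta>pos] by (simp only: mult.commute)
    also have "\<dots> = L * \<Delta> powr (\<alpha> - 1)" using \<Delta>pos by (simp add: powr_diff)
    finally have w: "\<bar>w\<bar> \<le> L * \<Delta> powr (\<alpha> - 1)" .
    define T where "T = (w * dd2 (fs 0) x3 x4 - dd3 (fs 0) x1 x3 x4 * dd3 (fs 0) x2 x3 x4) / (dd2 (fs 0) x2 x3 * dd2 (fs 0) x1 x4)"
    have cr: "cr_dist d (fs 0) x1 x2 x3 x4 = 1 + (x1 - x3) * (x2 - x4) * T"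
      unfolding T_def w_def by (rule cr_dist_eq_dd[OF dist]) (use q[of x2 x3] q[of x1 x4] x m(1) dist in auto)
    \<comment> \<open>As \<open>\<alpha> \<le> 1\<close>, the power \<Delta>^(\<alpha>-1) is bounded
      away from 0 on the segment, so it can absorb the bounded term \<open>M * M\<close>.\<close>
    have "1 = \<Delta> powr (1 - \<alpha>) * \<Delta> powr (\<alpha> - 1)" using \<Delta>pos by (simp flip: powr_add)
    also have "\<dots> \<le> (B - A) powr (1 - \<alpha>) * \<Delta> powr (\<alpha> - 1)"
      using \<Delta>pos \<Delta>le \<alpha> by (intro mult_right_mono powr_mono2) auto
    finally have one: "1 \<le> (B - A) powr (1 - \<alpha>) * \<Delta> powr (\<alpha> - 1)" .
    have "\<bar>w * dd2 (fs 0) x3 x4 - dd3 (fs 0) x1 x3 x4 * dd3 (fs 0) x2 x3 x4\<bar>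
      \<le> \<bar>w\<bar> * \<bar>dd2 (fs 0) x3 x4\<bar> + \<bar>dd3 (fs 0) x1 x3 x4\<bar> * \<bar>dd3 (fs 0) x2 x3 x4\<bar>"
      by (metis abs_mult abs_triangle_ineq4)
    also have "\<dots> \<le> (L * \<Delta> powr (\<alpha> - 1)) * M + M * M"
      by (intro add_mono mult_mono w t conjunct2[OF q]) (use x dist M0 L(1) in auto)
    also have "\<dots> \<le> (L * \<Delta> powr (\<alpha> - 1)) * M + M * M * ((B - A) powr (1 - \<alpha>) * \<Delta> powr (\<alpha> - 1))"
      using mult_left_mono[OF one, of "M * M"] M0 by simp
    finally have num: "\<bar>w * dd2 (fs 0) x3 x4 - dd3 (fs 0) x1 x3 x4 * dd3 (fs 0) x2 x3 x4\<bar>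
      \<le> (L * M + M * M * (B - A) powr (1 - \<alpha>)) * \<Delta> powr (\<alpha> - 1)" by (simp add: algebra_simps)
    have den: "m * m \<le> \<bar>dd2 (fs 0) x2 x3 * dd2 (fs 0) x1 x4\<bar>"
      unfolding abs_mult using m(1) q[of x2 x3] q[of x1 x4] x dist by (intro mult_mono) auto
    have "\<bar>T\<bar> \<le> ((L * M + M * M * (B - A) powr (1 - \<alpha>)) * \<Delta> powr (\<alpha> - 1)) / (m * m)"
      unfolding T_def abs_divide using m(1) num den by (intro frac_le) auto
    then have "\<bar>T\<bar> \<le> K * \<Delta> powr (\<alpha> - 1)" by (simp add: K_def)
    then have "\<bar>(x1 - x3) * (x2 - x4)\<bar> * \<bar>T\<bar> \<le> \<bar>(x1 - x3) * (x2 - x4)\<bar> * (K * \<Delta> powr (\<alpha> - 1))"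
      by (rule mult_left_mono) simp
    then show "\<bar>cr_dist d (fs 0) x1 x2 x3 x4 - 1\<bar> \<le> K * \<bar>(x1 - x3) * (x2 - x4)\<bar> * diameter {x1, x2, x3, x4} powr (\<alpha> - 1)"
      unfolding cr by (simp add: abs_mult \<Delta>_def X_def mult_ac)
  qed
qed

section \<open>Hoelder classes\<close>

text \<open>For \<open>a = 0\<close> this is boundedness of the oscillation (note
  \<open>0 powr 0 = 0\<close>, harmless at \<open>x = y\<close>), so exponent 0 can be treated
  together with the others.\<close>

definition hoelder_on :: "real set \<Rightarrow> real \<Rightarrow> (real \<Rightarrow> real) \<Rightarrow> bool" where
  "hoelder_on X a g \<longleftrightarrow> (\<exists>L\<ge>0. \<forall>x\<in>X. \<forall>y\<in>X. \<bar>g x - g y\<bar> \<le> L * \<bar>x - y\<bar> powr a)"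

lemma hoelder_onE:
  assumes "hoelder_on X a g"
  obtains L where "0 \<le> L" "\<And>x y. x \<in> X \<Longrightarrow> y \<in> X \<Longrightarrow> \<bar>g x - g y\<bar> \<le> L * \<bar>x - y\<bar> powr a"
  using assms unfolding hoelder_on_def by blast

lemma hoelder_on_mult:
  assumes g: "hoelder_on X a g" "\<And>x. x \<in> X \<Longrightarrow> \<bar>g x\<bar> \<le> M" and h: "hoelder_on X a h" "\<And>x. x \<in> X \<Longrightarrow> \<bar>h x\<bar> \<le> N"
  shows "hoelder_on X a (\<lambda>x. g x * h x)"
proof -
  obtain L where L: "0 \<le> L" "\<And>x y. x \<in> X \<Longrightarrow> y \<in> X \<Longrightarrow> \<bar>g x - g y\<bar> \<le> L * \<bar>x - y\<bar> powr a"
    using hoelder_onE[OF g(1)] by blast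
  obtain L' where L': "0 \<le> L'" "\<And>x y. x \<in> X \<Longrightarrow> y \<in> X \<Longrightarrow> \<bar>h x - h y\<bar> \<le> L' * \<bar>x - y\<bar> powr a"
    using hoelder_onE[OF h(1)] by blast
  show ?thesis unfolding hoelder_on_def
  proof (intro exI[of _ "\<bar>M\<bar> * L' + \<bar>N\<bar> * L"] conjI ballI)
    fix x y assume x: "x \<in> X" "y \<in> X"
    have "\<bar>g x * h x - g y * h y\<bar> = \<bar>g x * (h x - h y) + h y * (g x - g y)\<bar>" by (simp add: algebra_simps)
    also have "\<dots> \<le> \<bar>g x\<bar> * \<bar>h x - h y\<bar> + \<bar>h y\<bar> * \<bar>g x - g y\<bar>" by (metis abs_mult abs_triangle_ineq)
    also have "\<dots> \<le> \<bar>M\<bar> * (L' * \<bar>x - y\<bar> powr a) + \<bar>N\<bar> * (L * \<bar>x - y\<bar> powr a)"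
      using g(2)[OF x(1)] h(2)[OF x(2)] L L' x by (intro add_mono mult_mono) auto
    finally show "\<bar>g x * h x - g y * h y\<bar> \<le> (\<bar>M\<bar> * L' + \<bar>N\<bar> * L) * \<bar>x - y\<bar> powr a"
      by (simp add: algebra_simps)
  qed (use L L' in auto)
qed

lemma hoelder_on_inverse:
  assumes g: "hoelder_on X a g" "\<And>x. x \<in> X \<Longrightarrow> m \<le> \<bar>g x\<bar>" and m: "0 < m"
  shows "hoelder_on X a (\<lambda>x. inverse (g x))"
proof -
  obtain L where L: "0 \<le> L" "\<And>x y. x \<in> X \<Longrightarrow> y \<in> X \<Longrightarrow> \<bar>g x - g y\<bar> \<le> L * \<bar>x - y\<bar> powr a"
    using hoelder_onE[OF g(1)] by blast
  show ?thesis unfolding hoelder_on_def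
  proof (intro exI[of _ "L / (m * m)"] conjI ballI)
    fix x y assume x: "x \<in> X" "y \<in> X"
    have nz: "g x \<noteq> 0" "g y \<noteq> 0" using g(2)[OF x(1)] g(2)[OF x(2)] m by auto
    have "\<bar>inverse (g x) - inverse (g y)\<bar> = \<bar>g x - g y\<bar> / (\<bar>g x\<bar> * \<bar>g y\<bar>)"
      using nz by (simp add: inverse_diff_inverse abs_mult divide_inverse abs_inverse abs_minus_commute)
    also have "\<dots> \<le> (L * \<bar>x - y\<bar> powr a) / (m * m)"
      using L x g(2) m by (intro frac_le mult_mono) auto
    finally show "\<bar>inverse (g x) - inverse (g y)\<bar> \<le> L / (m * m) * \<bar>x - y\<bar> powr a" by simp
  qed (use L m in auto)
qed

lemma hoelder_on_lincomb:
  assumes "hoelder_on X a g" "hoelder_on X a h"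
  shows "hoelder_on X a (\<lambda>x. g x - c * h x)"
proof -
  obtain L where L: "0 \<le> L" "\<And>x y. x \<in> X \<Longrightarrow> y \<in> X \<Longrightarrow> \<bar>g x - g y\<bar> \<le> L * \<bar>x - y\<bar> powr a"
    using hoelder_onE[OF assms(1)] by blast
  obtain L' where L': "0 \<le> L'" "\<And>x y. x \<in> X \<Longrightarrow> y \<in> X \<Longrightarrow> \<bar>h x - h y\<bar> \<le> L' * \<bar>x - y\<bar> powr a"
    using hoelder_onE[OF assms(2)] by blast
  show ?thesis unfolding hoelder_on_def
  proof (intro exI[of _ "L + \<bar>c\<bar> * L'"] conjI ballI)
    fix x y assume x: "x \<in> X" "y \<in> X"
    have "\<bar>(g x - c * h x) - (g y - c * h y)\<bar> = \<bar>(g x - g y) - c * (h x - h y)\<bar>" by (simp add: algebra_simps)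
    also have "\<dots> \<le> \<bar>g x - g y\<bar> + \<bar>c\<bar> * \<bar>h x - h y\<bar>" by (metis abs_mult abs_triangle_ineq4)
    also have "\<dots> \<le> L * \<bar>x - y\<bar> powr a + \<bar>c\<bar> * (L' * \<bar>x - y\<bar> powr a)"
      using L L' x by (intro add_mono mult_left_mono) auto
    finally show "\<bar>(g x - c * h x) - (g y - c * h y)\<bar> \<le> (L + \<bar>c\<bar> * L') * \<bar>x - y\<bar> powr a"
      by (simp add: algebra_simps)
  qed (use L L' in auto)
qed

text \<open>Of the factor \<open>\<bar>x - y\<bar>\<close> given by the mean value theorem, the part
  with exponent \<open>1 - a\<close> is bounded by a power of the length of the segment. Lower
  derivatives thus satisfy the same condition as the top one.\<close>

lemma derivative_bounded_imp_hoelder: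
  assumes AB: "A < B" and a: "0 \<le> a" "a \<le> 1"
    and g: "\<And>x. x \<in> {A..B} \<Longrightarrow> (g has_real_derivative g' x) (at x within {A..B})"
    and M: "\<And>x. x \<in> {A..B} \<Longrightarrow> \<bar>g' x\<bar> \<le> M"
  shows "hoelder_on {A..B} a g"
  unfolding hoelder_on_def
proof (intro exI[of _ "\<bar>M\<bar> * (B - A) powr (1 - a)"] conjI ballI)
  fix x y assume x: "x \<in> {A..B}" "y \<in> {A..B}"
  show "\<bar>g x - g y\<bar> \<le> \<bar>M\<bar> * (B - A) powr (1 - a) * \<bar>x - y\<bar> powr a"
  proof (cases "x = y")
    case False
    obtain \<xi> where "\<xi> \<in> {min x y..max x y}" and \<xi>: "g' \<xi> = dd2 g x y"
      using dd2_mean_value[OF g False x] by blast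
    then have "\<xi> \<in> {A..B}" using x by auto
    then have "\<bar>dd2 g x y\<bar> \<le> \<bar>M\<bar>" using M[of \<xi>] \<xi> by auto
    moreover have "g x - g y = dd2 g x y * (x - y)" using False by (simp add: dd2_def)
    ultimately have "\<bar>g x - g y\<bar> \<le> \<bar>M\<bar> * \<bar>x - y\<bar>" by (simp add: abs_mult mult_right_mono)
    also have "\<bar>x - y\<bar> = \<bar>x - y\<bar> powr (1 - a) * \<bar>x - y\<bar> powr a"
      using False by (simp flip: powr_add)
    also have "\<bar>M\<bar> * \<dots> \<le> \<bar>M\<bar> * ((B - A) powr (1 - a) * \<bar>x - y\<bar> powr a)"
      using x a by (intro mult_left_mono mult_right_mono powr_mono2) auto
    finally show ?thesis by (simp add: mult_ac)
  qed (use AB in auto)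
qed (use AB in auto)

text \<open>The difference quotient is the value of \<open>g'\<close> at a point between
  \<open>x\<close> and \<open>y\<close>. Comparing it with \<open>g' y\<close> and multiplying by
  \<open>x - y\<close> gains one order over the Hoelder exponent of \<open>g'\<close>.\<close>

lemma hoelder_derivative_remainder:
  assumes g: "\<And>x. x \<in> {A..B} \<Longrightarrow> (g has_real_derivative g' x) (at x within {A..B})"
    and "hoelder_on {A..B} a g'" and a: "0 \<le> a"
  shows "\<exists>L\<ge>0. \<forall>x\<in>{A..B}. \<forall>y\<in>{A..B}. \<bar>g x - (g y + g' y * (x - y))\<bar> \<le> L * \<bar>x - y\<bar> powr (1 + a)"
proof -
  obtain L where L: "0 \<le> L" "\<And>x y. x \<in> {A..B} \<Longrightarrow> y \<in> {A..B} \<Longrightarrow> \<bar>g' x - g' y\<bar> \<le> L * \<bar>x - y\<bar> powr a"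
    using hoelder_onE[OF assms(2)] by blast
  show ?thesis
  proof (intro exI[of _ L] conjI ballI)
    fix x y assume x: "x \<in> {A..B}" "y \<in> {A..B}"
    show "\<bar>g x - (g y + g' y * (x - y))\<bar> \<le> L * \<bar>x - y\<bar> powr (1 + a)"
    proof (cases "x = y")
      case False
      obtain \<xi> where \<xi>: "\<xi> \<in> {min x y..max x y}" "g' \<xi> = dd2 g x y"
        using dd2_mean_value[OF g False x] by blast
      then have \<xi>AB: "\<xi> \<in> {A..B}" using x by auto
      have "g x - (g y + g' y * (x - y)) = (g' \<xi> - g' y) * (x - y)"
      proof -
        have "dd2 g x y * (x - y) = g x - g y" using False by (simp add: dd2_def)
        then show ?thesis by (simp add: \<xi>(2) left_diff_distrib)
      qed
      then have "\<bar>g x - (g y + g' y * (x - y))\<bar> = \<bar>g' \<xi> - g' y\<bar> * \<bar>x - y\<bar>" by (simp add: abs_mult)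
      also have "\<dots> \<le> (L * \<bar>\<xi> - y\<bar> powr a) * \<bar>x - y\<bar>" using L(2)[OF \<xi>AB x(2)] by (intro mult_right_mono) auto
      also have "\<dots> \<le> (L * \<bar>x - y\<bar> powr a) * \<bar>x - y\<bar>"
        using L(1) \<xi>(1) a by (intro mult_right_mono mult_left_mono powr_mono2) auto
      also have "\<dots> = L * \<bar>x - y\<bar> powr (1 + a)" using False by (simp add: powr_add)
      finally show ?thesis .
    qed simp
  qed (use L in auto)
qed

section \<open>Derivatives of functions of class C^(k+a)\<close>

lemma C_Holder_has_derivative:
  assumes "C_Holder k a A B f" "j < k" "x \<in> {A..B}"
  shows "((segment_deriv A B ^^ j) f has_real_derivative (segment_deriv A B ^^ Suc j) f x) (at x within {A..B})"
  using assms unfolding C_Holder_def differentiable_on_def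
  by (auto simp: segment_deriv_def has_real_derivative_iff_has_vector_derivative simp flip: vector_derivative_works)

lemma C_Holder_continuous_on:
  assumes "C_Holder k a A B f" "j \<le> k"
  shows "continuous_on {A..B} ((segment_deriv A B ^^ j) f)"
proof (cases "j = k")
  case False
  with assms have "j < k" by simp
  then show ?thesis
    using DERIV_continuous[OF C_Holder_has_derivative[OF assms(1)]] by (simp add: continuous_on_eq_continuous_within)
qed (use assms in \<open>simp add: C_Holder_def\<close>)

lemma C_Holder_bounded:
  assumes "C_Holder k a A B f" "j \<le> k"
  obtains M where "0 \<le> M" "\<And>x. x \<in> {A..B} \<Longrightarrow> \<bar>(segment_deriv A B ^^ j) f x\<bar> \<le> M"
proof -
  have "bounded ((segment_deriv A B ^^ j) f ` {A..B})"
    using compact_continuous_image[OF C_Holder_continuous_on[OF assms]] by (simp add: compact_imp_bounded)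
  then obtain M where M: "\<And>y. y \<in> (segment_deriv A B ^^ j) f ` {A..B} \<Longrightarrow> norm y \<le> M"
    unfolding bounded_iff by blast
  have "\<bar>(segment_deriv A B ^^ j) f x\<bar> \<le> \<bar>M\<bar>" if "x \<in> {A..B}" for x
    using M[OF imageI[OF that]] by simp
  then show ?thesis by (intro that[of "\<bar>M\<bar>"]) auto
qed

text \<open>There are three sources: the definition for \<open>j = k\<close> and
  \<open>a > 0\<close>, boundedness of the top derivative for \<open>j = k\<close> and
  \<open>a = 0\<close>, and boundedness of the next derivative for \<open>j < k\<close>.\<close>

lemma C_Holder_hoelder_on:
  assumes f: "C_Holder k a A B f" and j: "j \<le> k" and AB: "A < B" and a: "0 \<le> a" "a \<le> 1"
  shows "hoelder_on {A..B} a ((segment_deriv A B ^^ j) f)"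
proof (cases "j = k")
  case True
  obtain M where M: "0 \<le> M" "\<And>x. x \<in> {A..B} \<Longrightarrow> \<bar>(segment_deriv A B ^^ k) f x\<bar> \<le> M"
    using C_Holder_bounded[OF f order_refl] by blast
  show ?thesis
  proof (cases "a > 0")
    case True
    then obtain L where L: "\<And>x y. x \<in> {A..B} \<Longrightarrow> y \<in> {A..B} \<Longrightarrow>
        \<bar>(segment_deriv A B ^^ k) f x - (segment_deriv A B ^^ k) f y\<bar> \<le> L * \<bar>x - y\<bar> powr a"
      using f unfolding C_Holder_def by blast
    have "L * \<bar>x - y\<bar> powr a \<le> \<bar>L\<bar> * \<bar>x - y\<bar> powr a" for x y :: real by (intro mult_right_mono) auto
    with L show ?thesis unfolding hoelder_on_def \<open>j = k\<close> by (meson abs_ge_zero order_trans)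
  next
    case False
    with a have "a = 0" by simp
    have "\<bar>(segment_deriv A B ^^ k) f x - (segment_deriv A B ^^ k) f y\<bar> \<le> (2 * M) * \<bar>x - y\<bar> powr a"
      if "x \<in> {A..B}" "y \<in> {A..B}" for x y
      using M(2)[OF that(1)] M(2)[OF that(2)] \<open>a = 0\<close> by (cases "x = y") auto
    then show ?thesis unfolding hoelder_on_def \<open>j = k\<close> using M(1) by (intro exI[of _ "2 * M"]) auto
  qed
next
  case False
  then have "j < k" using j by simp
  obtain M where M: "0 \<le> M" "\<And>x. x \<in> {A..B} \<Longrightarrow> \<bar>(segment_deriv A B ^^ Suc j) f x\<bar> \<le> M"
    using C_Holder_bounded[OF f, of "Suc j"] \<open>j < k\<close> by auto
  show ?thesis
    by (rule derivative_bounded_imp_hoelder[OF AB a C_Holder_has_derivative[OF f \<open>j < k\<close>] M(2)])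
qed

section \<open>The three estimates on a segment\<close>

lemma error_term_exists:
  fixes D P s :: real
  assumes "\<bar>D - (1 + P * s)\<bar> \<le> K * \<bar>P\<bar> * r" "0 \<le> r"
  shows "\<exists>e. \<bar>e\<bar> \<le> \<bar>K\<bar> * r \<and> D = 1 + P * (s + e)"
proof (cases "P = 0")
  case True
  \<comment> \<open>When \<open>P = 0\<close> the hypothesis forces \<open>D = 1\<close>, so the
    error 0 serves. Without the factor \<open>\<bar>P\<bar>\<close> in the bound nothing could be
    said here.\<close>
  then show ?thesis using assms by (intro exI[of _ 0]) auto
next
  case False
  define e where "e = (D - (1 + P * s)) / P"
  have D: "D = 1 + P * (s + e)" using False by (simp add: e_def field_simps)
  have "\<bar>P\<bar> * \<bar>e\<bar> \<le> \<bar>P\<bar> * (K * r)" using assms(1) by (simp add: D distrib_left mult_ac flip: abs_mult)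
  then have "\<bar>e\<bar> \<le> K * r" using False by simp
  also have "\<dots> \<le> \<bar>K\<bar> * r" using assms(2) by (intro mult_right_mono) auto
  finally show ?thesis using D by blast
qed

text \<open>Since \<open>1 / 6 * t\<close> is \<open>1 / 24\<close> of \<open>4 * t\<close>,
  replacing the four values by \<open>t\<close> costs at most \<open>r / 6\<close>.\<close>

lemma average_error:
  fixes a b c d t r k e :: real
  assumes "\<bar>a - t\<bar> \<le> r" "\<bar>b - t\<bar> \<le> r" "\<bar>c - t\<bar> \<le> r" "\<bar>d - t\<bar> \<le> r" "\<bar>e\<bar> \<le> k"
  shows "\<bar>e + 1 / 24 * (a + b + c + d) - 1 / 6 * t\<bar> \<le> k + r"
  using assms by argo

context
  fixes A B :: real and f :: "real \<Rightarrow> real"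
  assumes AB: "A < B" and nz: "\<And>x. x \<in> {A..B} \<Longrightarrow> segment_deriv A B f x \<noteq> 0"
begin

private abbreviation D where "D n \<equiv> (segment_deriv A B ^^ n) f"

lemma schwarzian_eq: "schwarzian (segment_deriv A B) f x = D 3 x / D 1 x - 3 / 2 * (D 2 x / D 1 x)\<^sup>2"
  by (simp add: schwarzian_def)

text \<open>Covers diameter 0, which the limit argument leaves out: there the power of \<Delta>
  vanishes for every exponent, so the distortion must equal 1 exactly.\<close>

lemma cr_dist_diagonal:
  assumes "x \<in> {A..B}" shows "cr_dist (segment_deriv A B) f x x x x = 1"
  using nz[OF assms] by (simp add: cr_dist_def diff_quot_def)

lemma C_Holder_2_expansion:
  assumes f: "C_Holder 2 \<alpha> A B f" and \<alpha>: "0 \<le> \<alpha>" "\<alpha> \<le> 1"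
  shows "\<exists>C. \<forall>x1\<in>{A..B}. \<forall>x2\<in>{A..B}. \<forall>x3\<in>{A..B}. \<forall>x4\<in>{A..B}.
          diameter {x1, x2, x3, x4} \<noteq> 0 \<longrightarrow>
          (\<exists>e. \<bar>e\<bar> \<le> C * diameter {x1, x2, x3, x4} powr (\<alpha> - 1) \<and>
               cr_dist (segment_deriv A B) f x1 x2 x3 x4 = 1 + (x1 - x3) * (x2 - x4) * e)"
proof -
  note deriv = C_Holder_has_derivative[OF f]
  obtain L where L: "0 \<le> L" "\<And>x y. x \<in> {A..B} \<Longrightarrow> y \<in> {A..B} \<Longrightarrow> \<bar>D 2 x - D 2 y\<bar> \<le> L * \<bar>x - y\<bar> powr \<alpha>"
    using hoelder_onE[OF C_Holder_hoelder_on[OF f order_refl AB \<alpha>]] by blast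
  obtain K where K: "\<forall>x1\<in>{A..B}. \<forall>x2\<in>{A..B}. \<forall>x3\<in>{A..B}. \<forall>x4\<in>{A..B}. distinct [x1, x2, x3, x4] \<longrightarrow>
     \<bar>cr_dist (segment_deriv A B) (D 0) x1 x2 x3 x4 - 1\<bar> \<le> K * \<bar>(x1 - x3) * (x2 - x4)\<bar> * diameter {x1, x2, x3, x4} powr (\<alpha> - 1)"
    using distinct_expansion_second_order[where fs = D and d = "segment_deriv A B", OF AB \<alpha> deriv C_Holder_continuous_on[OF f order_refl] _ L] nz
    by auto
  show ?thesis
  proof (rule exI[of _ "\<bar>K\<bar>"], intro ballI impI)
    fix x1 x2 x3 x4 assume x: "x1 \<in> {A..B}" "x2 \<in> {A..B}" "x3 \<in> {A..B}" "x4 \<in> {A..B}"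
      and \<Delta>: "diameter {x1, x2, x3, x4} \<noteq> 0"
    \<comment> \<open>The vacuous sum of zeros only serves to match the general form of the limit
      lemma.\<close>
    have "\<bar>cr_dist (segment_deriv A B) f x1 x2 x3 x4 - (1 + (x1 - x3) * (x2 - x4) * (1 / 24 * (\<Sum>x\<leftarrow>[x1, x2, x3, x4]. 0)))\<bar>
      \<le> K * \<bar>(x1 - x3) * (x2 - x4)\<bar> * diameter {x1, x2, x3, x4} powr (\<alpha> - 1)"
    proof (rule expansion_from_distinct[where ?f1.0 = "D 1" and S = "\<lambda>_. 0", OF AB _ _ _ _ _ _ x \<Delta>])
      show "(f has_real_derivative D 1 x) (at x within {A..B})" if "x \<in> {A..B}" for x
        using deriv[of 0 x] that by simp
      show "continuous_on {A..B} (D 1)" by (rule C_Holder_continuous_on[OF f]) simp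
    qed (use nz K in auto)
    then show "\<exists>e. \<bar>e\<bar> \<le> \<bar>K\<bar> * diameter {x1, x2, x3, x4} powr (\<alpha> - 1) \<and>
               cr_dist (segment_deriv A B) f x1 x2 x3 x4 = 1 + (x1 - x3) * (x2 - x4) * e"
      using error_term_exists[where s = 0] by simp
  qed
qed

text \<open>\<open>E\<close> takes the place of the fourth derivative: it is \<open>D 4\<close> with
  \<open>s = 1\<close> if that exists, and 0 with \<open>s = 0\<close> when there are three
  derivatives only. One expansion thus serves both smoothness classes.\<close>

lemma C_Holder_schwarzian_expansion:
  fixes s :: real
  assumes f: "C_Holder k a A B f" and k: "3 \<le> k" and \<rho>: "0 \<le> \<rho>" "\<rho> \<le> 2"
    and E: "\<And>x. x \<in> {A..B} \<Longrightarrow> \<bar>E x\<bar> \<le> C"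
    and rem: "\<And>n x y. n \<in> {1, 2, 3} \<Longrightarrow> x \<in> {A..B} \<Longrightarrow> y \<in> {A..B} \<Longrightarrow>
       \<bar>D n x - (D n y + s * (if n = 3 then E else D (Suc n)) y * (x - y))\<bar> \<le> C * \<bar>x - y\<bar> powr \<rho>"
  shows "\<exists>C. \<forall>x1\<in>{A..B}. \<forall>x2\<in>{A..B}. \<forall>x3\<in>{A..B}. \<forall>x4\<in>{A..B}.
          (\<exists>e. \<bar>e\<bar> \<le> C * diameter {x1, x2, x3, x4} powr \<rho> \<and>
               cr_dist (segment_deriv A B) f x1 x2 x3 x4 =
                 1 + (x1 - x3) * (x2 - x4) *
                   (1 / 24 * (schwarzian (segment_deriv A B) f x1 + schwarzian (segment_deriv A B) f x2 +
                              schwarzian (segment_deriv A B) f x3 + schwarzian (segment_deriv A B) f x4) + e))"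
proof -
  let ?S = "schwarzian (segment_deriv A B) f"
  define fs where "fs n = (if n = 4 then E else D n)" for n
  have fs: "fs 0 = f" "fs 1 = D 1" "fs 2 = D 2" "fs 3 = D 3" "fs 4 = E" by (simp_all add: fs_def)
  have deriv: "(fs j has_real_derivative fs (Suc j) x) (at x within {A..B})" if "j < 3" "x \<in> {A..B}" for j x
    using C_Holder_has_derivative[OF f, of j x] that k by (simp add: fs_def)
  have c3: "continuous_on {A..B} (fs 3)" using C_Holder_continuous_on[OF f k] by (simp add: fs)
  have nz1: "fs 1 x \<noteq> 0" if "x \<in> {A..B}" for x using nz[OF that] by (simp add: fs_def)
  have rem1: "\<bar>fs n x - (fs n y + s * fs (Suc n) y * (x - y))\<bar> \<le> C * \<bar>x - y\<bar> powr \<rho>"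
    if "n \<in> {1, 2, 3}" "x \<in> {A..B}" "y \<in> {A..B}" for n x y
    using rem[OF that] that(1) by (auto simp: fs_def)
  have b4: "\<bar>fs 4 x\<bar> \<le> C" if "x \<in> {A..B}" for x using E[OF that] by (simp add: fs)
  obtain K where "\<forall>x1\<in>{A..B}. \<forall>x2\<in>{A..B}. \<forall>x3\<in>{A..B}. \<forall>x4\<in>{A..B}. distinct [x1, x2, x3, x4] \<longrightarrow>
     \<bar>cr_dist (segment_deriv A B) (fs 0) x1 x2 x3 x4 - (1 + (x1 - x3) * (x2 - x4) * (1 / 24 *
        (\<Sum>x\<leftarrow>[x1, x2, x3, x4]. fs 3 x / fs 1 x - 3 / 2 * (fs 2 x / fs 1 x)\<^sup>2)))\<bar>
      \<le> K * \<bar>(x1 - x3) * (x2 - x4)\<bar> * diameter {x1, x2, x3, x4} powr \<rho>"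
    using distinct_expansion[where fs = fs and d = "segment_deriv A B" and s = s and C = C,
        OF AB \<rho> deriv c3 nz1 rem1 b4] ..
  then have K: "\<forall>x1\<in>{A..B}. \<forall>x2\<in>{A..B}. \<forall>x3\<in>{A..B}. \<forall>x4\<in>{A..B}. distinct [x1, x2, x3, x4] \<longrightarrow>
     \<bar>cr_dist (segment_deriv A B) f x1 x2 x3 x4 - (1 + (x1 - x3) * (x2 - x4) * (1 / 24 * (\<Sum>x\<leftarrow>[x1, x2, x3, x4]. ?S x)))\<bar>
      \<le> K * \<bar>(x1 - x3) * (x2 - x4)\<bar> * diameter {x1, x2, x3, x4} powr \<rho>"
    unfolding fs schwarzian_eq .
  have S: "continuous_on {A..B} ?S"
    unfolding schwarzian_eq[abs_def] using k nz
    by (intro continuous_intros C_Holder_continuous_on[OF f]) auto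
  show ?thesis
  proof (rule exI[of _ "\<bar>K\<bar>"], intro ballI)
    fix x1 x2 x3 x4 assume x: "x1 \<in> {A..B}" "x2 \<in> {A..B}" "x3 \<in> {A..B}" "x4 \<in> {A..B}"
    let ?X = "{x1, x2, x3, x4}"
    have "\<bar>cr_dist (segment_deriv A B) f x1 x2 x3 x4 - (1 + (x1 - x3) * (x2 - x4) * (1 / 24 * (\<Sum>x\<leftarrow>[x1, x2, x3, x4]. ?S x)))\<bar>
      \<le> K * \<bar>(x1 - x3) * (x2 - x4)\<bar> * diameter ?X powr \<rho>"
    proof (cases "diameter ?X = 0")
      case True
      have "x2 = x1" "x3 = x1" "x4 = x1"
        using diameter_bounded_bound[of ?X x2 x1] diameter_bounded_bound[of ?X x3 x1] diameter_bounded_bound[of ?X x4 x1] True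
        by simp_all
      then show ?thesis using cr_dist_diagonal[OF x(1)] by simp
    next
      case False
      show ?thesis
      proof (rule expansion_from_distinct[where ?f1.0 = "D 1", OF AB _ _ _ _ S K x False])
        show "(f has_real_derivative D 1 x) (at x within {A..B})" if "x \<in> {A..B}" for x
          using deriv[of 0 x] that by (simp add: fs_def)
        show "continuous_on {A..B} (D 1)" by (rule C_Holder_continuous_on[OF f]) (use k in simp)
      qed (use nz in auto)
    qed
    from error_term_exists[OF this]
    show "\<exists>e. \<bar>e\<bar> \<le> \<bar>K\<bar> * diameter ?X powr \<rho> \<and> cr_dist (segment_deriv A B) f x1 x2 x3 x4 =
       1 + (x1 - x3) * (x2 - x4) * (1 / 24 * (?S x1 + ?S x2 + ?S x3 + ?S x4) + e)"
      by (simp add: add.assoc)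
  qed
qed

lemma C_Holder_4_expansion:
  assumes f: "C_Holder 4 \<gamma> A B f" and \<gamma>: "0 \<le> \<gamma>" "\<gamma> \<le> 1"
  shows "\<exists>C. \<forall>x1\<in>{A..B}. \<forall>x2\<in>{A..B}. \<forall>x3\<in>{A..B}. \<forall>x4\<in>{A..B}.
          (\<exists>e. \<bar>e\<bar> \<le> C * diameter {x1, x2, x3, x4} powr (1 + \<gamma>) \<and>
               cr_dist (segment_deriv A B) f x1 x2 x3 x4 =
                 1 + (x1 - x3) * (x2 - x4) *
                   (1 / 24 * (schwarzian (segment_deriv A B) f x1 + schwarzian (segment_deriv A B) f x2 +
                              schwarzian (segment_deriv A B) f x3 + schwarzian (segment_deriv A B) f x4) + e))"
proof -
  obtain M where M: "\<And>x. x \<in> {A..B} \<Longrightarrow> \<bar>D 4 x\<bar> \<le> M"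
    using C_Holder_bounded[OF f order_refl] by blast
  have "\<exists>L\<ge>0. \<forall>x\<in>{A..B}. \<forall>y\<in>{A..B}. \<bar>D n x - (D n y + D (Suc n) y * (x - y))\<bar> \<le> L * \<bar>x - y\<bar> powr (1 + \<gamma>)"
    if "n \<le> 3" for n
    using hoelder_derivative_remainder[OF C_Holder_has_derivative[OF f] C_Holder_hoelder_on[OF f _ AB \<gamma>] \<gamma>(1), of n] that
    by simp
  then obtain L where L: "\<And>n. n \<le> 3 \<Longrightarrow> 0 \<le> L n" "\<And>n x y. n \<le> 3 \<Longrightarrow> x \<in> {A..B} \<Longrightarrow> y \<in> {A..B} \<Longrightarrow>
      \<bar>D n x - (D n y + D (Suc n) y * (x - y))\<bar> \<le> L n * \<bar>x - y\<bar> powr (1 + \<gamma>)"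
    by metis
  \<comment> \<open>One constant has to dominate the fourth derivative and the three
    remainders.\<close>
  define C where "C = \<bar>M\<bar> + L 1 + L 2 + L 3"
  have LC: "L n \<le> C" if "n \<in> {1, 2, 3}" for n using that L(1)[of 1] L(1)[of 2] L(1)[of 3] by (auto simp: C_def)
  show ?thesis
  proof (rule C_Holder_schwarzian_expansion[OF f, where E = "D 4" and s = 1 and C = C])
    show "\<bar>D 4 x\<bar> \<le> C" if "x \<in> {A..B}" for x
      using M[OF that] L(1)[of 1] L(1)[of 2] L(1)[of 3] by (simp add: C_def)
    fix n x y assume n: "n \<in> {1::nat, 2, 3}" and x: "x \<in> {A..B}" "y \<in> {A..B}"
    have "(if n = 3 then D 4 else D (Suc n)) = D (Suc n)" by (simp add: eval_nat_numeral)
    moreover have "\<bar>D n x - (D n y + D (Suc n) y * (x - y))\<bar> \<le> C * \<bar>x - y\<bar> powr (1 + \<gamma>)"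
      using L(2)[of n x y] x n mult_right_mono[OF LC[OF n], of "\<bar>x - y\<bar> powr (1 + \<gamma>)"] by fastforce
    ultimately show "\<bar>D n x - (D n y + 1 * (if n = 3 then D 4 else D (Suc n)) y * (x - y))\<bar> \<le> C * \<bar>x - y\<bar> powr (1 + \<gamma>)"
      by simp
  qed (use \<gamma> in auto)
qed

lemma hoelder_on_schwarzian:
  assumes f: "C_Holder 3 \<beta> A B f" and \<beta>: "0 \<le> \<beta>" "\<beta> \<le> 1"
  shows "hoelder_on {A..B} \<beta> (schwarzian (segment_deriv A B) f)"
proof -
  have h: "hoelder_on {A..B} \<beta> (D n)" if "n \<le> 3" for n
    by (rule C_Holder_hoelder_on[OF f that AB \<beta>])
  have "\<exists>M. \<forall>x\<in>{A..B}. \<bar>D n x\<bar> \<le> M" if "n \<le> 3" for n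
    using C_Holder_bounded[OF f that] by metis
  then obtain M where M: "\<And>n x. n \<le> 3 \<Longrightarrow> x \<in> {A..B} \<Longrightarrow> \<bar>D n x\<bar> \<le> M n" by metis
  obtain m where m: "m > 0" "\<And>x. x \<in> {A..B} \<Longrightarrow> m \<le> \<bar>D 1 x\<bar>"
    using abs_bounded_below[OF _ AB, of "D 1"] C_Holder_continuous_on[OF f, of 1] nz by auto
  have i: "hoelder_on {A..B} \<beta> (\<lambda>x. inverse (D 1 x))" by (rule hoelder_on_inverse[OF h m(2,1)]) simp
  have ib: "\<bar>inverse (D 1 x)\<bar> \<le> inverse m" if "x \<in> {A..B}" for x
    using m(2)[OF that] m(1) by (simp add: abs_inverse le_imp_inverse_le del: funpow.simps)
  have q: "hoelder_on {A..B} \<beta> (\<lambda>x. D n x * inverse (D 1 x))" if "n \<le> 3" for n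
    by (rule hoelder_on_mult[OF h[OF that] M[OF that] i ib])
  have qb: "\<bar>D 2 x * inverse (D 1 x)\<bar> \<le> M 2 * inverse m" if "x \<in> {A..B}" for x
    unfolding abs_mult using M[of 2 x] ib[OF that] that by (intro mult_mono) auto
  have "hoelder_on {A..B} \<beta> (\<lambda>x. D 3 x * inverse (D 1 x) - 3 / 2 * ((D 2 x * inverse (D 1 x)) * (D 2 x * inverse (D 1 x))))"
    by (intro hoelder_on_lincomb hoelder_on_mult[OF q qb q qb] q) simp_all
  then show ?thesis unfolding schwarzian_eq[abs_def] power2_eq_square divide_inverse[of _ "D 1 _"] .
qed

text \<open>The expansion with the mean of four Schwarz derivatives already has an error of order
  \<Delta>^\<beta>. The Schwarz derivative is itself \<beta>-Hoelder and \<theta> lies within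
  \<Delta> of each point, so moving all four values to \<theta> costs the same order.\<close>

lemma C_Holder_3_expansion:
  assumes f: "C_Holder 3 \<beta> A B f" and \<beta>: "0 \<le> \<beta>" "\<beta> \<le> 1"
  shows "\<exists>C. \<forall>x1\<in>{A..B}. \<forall>x2\<in>{A..B}. \<forall>x3\<in>{A..B}. \<forall>x4\<in>{A..B}.
          \<forall>\<theta>\<in>{Min {x1, x2, x3, x4}..Max {x1, x2, x3, x4}}.
          (\<exists>e. \<bar>e\<bar> \<le> C * diameter {x1, x2, x3, x4} powr \<beta> \<and>
               cr_dist (segment_deriv A B) f x1 x2 x3 x4 =
                 1 + (x1 - x3) * (x2 - x4) * (1 / 6 * schwarzian (segment_deriv A B) f \<theta> + e))"
proof -
  let ?S = "schwarzian (segment_deriv A B) f"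
  obtain H where H: "0 \<le> H" "\<And>x y. x \<in> {A..B} \<Longrightarrow> y \<in> {A..B} \<Longrightarrow> \<bar>?S x - ?S y\<bar> \<le> H * \<bar>x - y\<bar> powr \<beta>"
    using hoelder_onE[OF hoelder_on_schwarzian[OF assms]] by blast
  have "\<exists>L\<ge>0. \<forall>x\<in>{A..B}. \<forall>y\<in>{A..B}. \<bar>D n x - D n y\<bar> \<le> L * \<bar>x - y\<bar> powr \<beta>" if "n \<le> 3" for n
    using C_Holder_hoelder_on[OF f that AB \<beta>] unfolding hoelder_on_def .
  then obtain L where L: "\<And>n. n \<le> 3 \<Longrightarrow> 0 \<le> L n" "\<And>n x y. n \<le> 3 \<Longrightarrow> x \<in> {A..B} \<Longrightarrow> y \<in> {A..B} \<Longrightarrow>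
      \<bar>D n x - D n y\<bar> \<le> L n * \<bar>x - y\<bar> powr \<beta>"
    by metis
  define C where "C = L 1 + L 2 + L 3"
  have LC: "L n \<le> C" if "n \<in> {1, 2, 3}" for n using that L(1)[of 1] L(1)[of 2] L(1)[of 3] by (auto simp: C_def)
  have "\<exists>C. \<forall>x1\<in>{A..B}. \<forall>x2\<in>{A..B}. \<forall>x3\<in>{A..B}. \<forall>x4\<in>{A..B}.
          (\<exists>e. \<bar>e\<bar> \<le> C * diameter {x1, x2, x3, x4} powr \<beta> \<and>
               cr_dist (segment_deriv A B) f x1 x2 x3 x4 =
                 1 + (x1 - x3) * (x2 - x4) * (1 / 24 * (?S x1 + ?S x2 + ?S x3 + ?S x4) + e))"
  proof (rule C_Holder_schwarzian_expansion[OF f, where E = "\<lambda>_. 0" and s = 0 and C = C])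
    show "\<bar>0\<bar> \<le> C" using L(1)[of 1] L(1)[of 2] L(1)[of 3] by (simp add: C_def)
    fix n x y assume n: "n \<in> {1::nat, 2, 3}" and x: "x \<in> {A..B}" "y \<in> {A..B}"
    have "\<bar>D n x - D n y\<bar> \<le> C * \<bar>x - y\<bar> powr \<beta>"
      using L(2)[of n x y] x n mult_right_mono[OF LC[OF n], of "\<bar>x - y\<bar> powr \<beta>"] by fastforce
    then show "\<bar>D n x - (D n y + 0 * (if n = 3 then \<lambda>_. 0 else D (Suc n)) y * (x - y))\<bar> \<le> C * \<bar>x - y\<bar> powr \<beta>"
      by simp
  qed (use \<beta> in auto)
  then obtain K where K: "\<And>x1 x2 x3 x4. x1 \<in> {A..B} \<Longrightarrow> x2 \<in> {A..B} \<Longrightarrow> x3 \<in> {A..B} \<Longrightarrow> x4 \<in> {A..B} \<Longrightarrow>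
      (\<exists>e. \<bar>e\<bar> \<le> K * diameter {x1, x2, x3, x4} powr \<beta> \<and>
               cr_dist (segment_deriv A B) f x1 x2 x3 x4 =
                 1 + (x1 - x3) * (x2 - x4) * (1 / 24 * (?S x1 + ?S x2 + ?S x3 + ?S x4) + e))"
    by meson
  show ?thesis
  proof (rule exI[of _ "K + H"], intro ballI)
    fix x1 x2 x3 x4 \<theta> assume x: "x1 \<in> {A..B}" "x2 \<in> {A..B}" "x3 \<in> {A..B}" "x4 \<in> {A..B}"
      and \<theta>: "\<theta> \<in> {Min {x1, x2, x3, x4}..Max {x1, x2, x3, x4}}"
    define X where "X = {x1, x2, x3, x4}"
    have X: "finite X" "X \<noteq> {}" "X \<subseteq> {A..B}" using x by (auto simp: X_def)
    have mm: "Min X \<in> X" "Max X \<in> X" using X by auto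
    have \<theta>': "\<theta> \<in> {Min X..Max X}" using \<theta> by (simp only: X_def)
    have "Min X \<in> {A..B}" "Max X \<in> {A..B}" using mm X(3) by blast+
    then have \<theta>AB: "\<theta> \<in> {A..B}" using \<theta>' by auto
    have S: "\<bar>?S y - ?S \<theta>\<bar> \<le> H * diameter X powr \<beta>" if "y \<in> X" for y
    proof -
      have "Min X \<le> y" "y \<le> Max X" using that X(1) by auto
      moreover have "dist (Max X) (Min X) \<le> diameter X"
        by (rule diameter_bounded_bound[OF finite_imp_bounded[OF X(1)] mm(2,1)])
      ultimately have "\<bar>y - \<theta>\<bar> \<le> diameter X" using \<theta>' by (auto simp: dist_real_def)
      then have "\<bar>y - \<theta>\<bar> powr \<beta> \<le> diameter X powr \<beta>" using \<beta> by (intro powr_mono2) auto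
      then show ?thesis using H(2)[OF _ \<theta>AB, of y] mult_left_mono[OF _ H(1)] that X(3) by (meson order_trans subsetD)
    qed
    obtain e where e: "\<bar>e\<bar> \<le> K * diameter X powr \<beta>" "cr_dist (segment_deriv A B) f x1 x2 x3 x4 =
        1 + (x1 - x3) * (x2 - x4) * (1 / 24 * (?S x1 + ?S x2 + ?S x3 + ?S x4) + e)"
      using K[OF x] unfolding X_def by blast
    let ?e = "e + 1 / 24 * (?S x1 + ?S x2 + ?S x3 + ?S x4) - 1 / 6 * ?S \<theta>"
    have mem: "x1 \<in> X" "x2 \<in> X" "x3 \<in> X" "x4 \<in> X" by (simp_all add: X_def)
    have "\<bar>?e\<bar> \<le> K * diameter X powr \<beta> + H * diameter X powr \<beta>"
      by (rule average_error[OF S S S S e(1)]) (rule mem)+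
    then have "\<bar>?e\<bar> \<le> (K + H) * diameter X powr \<beta>" by (simp add: distrib_right)
    moreover have "cr_dist (segment_deriv A B) f x1 x2 x3 x4 = 1 + (x1 - x3) * (x2 - x4) * (1 / 6 * ?S \<theta> + ?e)"
      unfolding e(2) by simp
    ultimately show "\<exists>e. \<bar>e\<bar> \<le> (K + H) * diameter {x1, x2, x3, x4} powr \<beta> \<and>
       cr_dist (segment_deriv A B) f x1 x2 x3 x4 = 1 + (x1 - x3) * (x2 - x4) * (1 / 6 * ?S \<theta> + e)"
      unfolding X_def by blast
  qed
qed

end

section \<open>Divided differences of holomorphic functions\<close>

text \<open>For \<open>g\<close> holomorphic near \<open>a\<close>, the value
  \<open>deriv g a\<close> at \<open>w = a\<close> fills the removable singularity. Iterates
  therefore make sense at repeated nodes, and coincident points need no limit argument.\<close>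

definition cdq :: "complex \<Rightarrow> (complex \<Rightarrow> complex) \<Rightarrow> complex \<Rightarrow> complex" where
  "cdq a g = (\<lambda>w. diff_quot deriv g w a)"

lemma cdq_commute: "cdq a g b = cdq b g a"
  using minus_divide_divide[of "g a - g b" "a - b"] by (simp add: cdq_def diff_quot_def)

lemma cdq_expand: "g w = g a + (w - a) * cdq a g w"
  by (simp add: cdq_def diff_quot_def)

lemma holomorphic_cdq:
  assumes "g holomorphic_on \<Omega>" "open \<Omega>"
  shows "cdq a g holomorphic_on \<Omega>"
  by (rule holomorphic_transform[OF pole_lemma_open[OF assms, of a]]) (simp add: cdq_def diff_quot_def)

text \<open>At \<open>w = a\<close> a derivative is involved, so agreement at the two points is not
  enough; agreement on an open set is.\<close>

lemma cdq_cong: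
  assumes "open \<Omega>" "\<And>z. z \<in> \<Omega> \<Longrightarrow> g z = h z" "a \<in> \<Omega>" "w \<in> \<Omega>"
  shows "cdq a g w = cdq a h w"
proof -
  have "eventually (\<lambda>z. g z = h z) (nhds w)"
    using eventually_nhds_in_open[OF assms(1,4)] assms(2) by (auto elim: eventually_mono)
  then have "deriv g w = deriv h w" by (rule deriv_cong_ev) simp
  then show ?thesis using assms(2)[OF assms(3)] assms(2)[OF assms(4)]
    by (cases "w = a") (simp_all add: cdq_def diff_quot_def)
qed

text \<open>Away from \<open>a\<close> and \<open>b\<close> this is an algebraic identity of divided
  differences; both sides are holomorphic, hence continuous, which carries it to the two exceptional
  points.\<close>

lemma cdq_cdq_commute:
  assumes g: "g holomorphic_on \<Omega>" "open \<Omega>" and "a \<in> \<Omega>" "b \<in> \<Omega>" "w \<in> \<Omega>"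
  shows "cdq a (cdq b g) w = cdq b (cdq a g) w"
proof (cases "a = b")
  case False
  have eq: "cdq a (cdq b g) z = cdq b (cdq a g) z" if "z \<noteq> a" "z \<noteq> b" for z
    using that False unfolding cdq_def diff_quot_def
    apply (auto simp: divide_simps)
    subgoal premises by algebra
    done
  have c: "(cdq x (cdq y g) \<longlongrightarrow> cdq x (cdq y g) w) (at w)" for x y
    using holomorphic_on_imp_continuous_on[OF holomorphic_cdq[OF holomorphic_cdq[OF g] g(2), of x y]]
      g(2) \<open>w \<in> \<Omega>\<close> by (simp add: continuous_on_eq_continuous_at isCont_def)
  have "eventually (\<lambda>z. z \<noteq> a \<and> z \<noteq> b) (at w)"
    by (intro eventually_conj) (metis eventually_neq_at_within)+
  then have "eventually (\<lambda>z. cdq a (cdq b g) z = cdq b (cdq a g) z) (at w)"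
    by eventually_elim (use eq in auto)
  from Lim_transform_eventually[OF c this] show ?thesis
    using tendsto_unique[OF _ _ c] by (metis at_neq_bot)
qed simp

text \<open>
  The bound holds on the same set \<open>K'\<close> on which \<open>g\<close> is bounded, so it can be iterated:
  close to \<open>a\<close> the estimate is carried over from the circle of radius \<open>r\<close> by the maximum modulus principle.
\<close>

lemma norm_cdq_le:
  assumes g: "g holomorphic_on \<Omega>" "open \<Omega>" and r: "0 < r" "cball a r \<subseteq> K'" "K' \<subseteq> \<Omega>"
    and G: "\<And>z. z \<in> K' \<Longrightarrow> norm (g z) \<le> G" and w: "w \<in> K'"
  shows "norm (cdq a g w) \<le> 2 / r * G"
proof -
  have a: "a \<in> K'" using r by auto
  \<comment> \<open>Source of the constant \<open>2 / r\<close>: the numerator is at most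
    \<open>2 * G\<close> and the denominator at least \<open>r\<close>.\<close>
  have far: "norm (cdq a g z) \<le> 2 / r * G" if "z \<in> K'" "r \<le> norm (z - a)" for z
  proof -
    have "norm (g z - g a) \<le> G + G" using G[OF that(1)] G[OF a] norm_triangle_ineq4[of "g z" "g a"] by linarith
    then have "norm (g z - g a) / norm (z - a) \<le> (G + G) / r"
      using that r(1) order_trans[OF norm_ge_zero G[OF a]] by (intro frac_le) auto
    moreover have "z \<noteq> a" using that r(1) by auto
    ultimately show ?thesis by (simp add: cdq_def diff_quot_def norm_divide)
  qed
  show ?thesis
  proof (cases "r \<le> norm (w - a)")
    case False
    have h: "cdq a g holomorphic_on \<Omega>" by (rule holomorphic_cdq[OF g])
    show ?thesis
    proof (rule maximum_modulus_frontier[of "cdq a g" "cball a r"])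
      show "cdq a g holomorphic_on interior (cball a r)"
        using h r by (meson holomorphic_on_subset interior_subset order_trans)
      show "continuous_on (closure (cball a r)) (cdq a g)"
        using holomorphic_on_imp_continuous_on[OF h] r
        by (metis closed_cball closure_closed continuous_on_subset order_trans)
      fix z assume "z \<in> frontier (cball a r)"
      then have "norm (z - a) = r" using r(1) by (simp add: frontier_cball dist_norm norm_minus_commute)
      moreover from this have "z \<in> K'" using r(2) by (auto simp: dist_norm norm_minus_commute)
      ultimately show "norm (cdq a g z) \<le> 2 / r * G" using far by simp
    qed (use False in \<open>auto simp: dist_norm norm_minus_commute\<close>)
  qed (use far w in auto)
qed

text \<open>Brings the quotient at \<open>a\<close> to the outside, where \<open>cdq_commute\<close>
  can exchange \<open>a\<close> with the point of evaluation.\<close>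

lemma cdq_funpow_commute:
  assumes g: "g holomorphic_on \<Omega>" "open \<Omega>" and ab: "a \<in> \<Omega>" "c \<in> \<Omega>" and "w \<in> \<Omega>"
  shows "(cdq c ^^ n) (cdq a g) w = cdq a ((cdq c ^^ n) g) w"
  using \<open>w \<in> \<Omega>\<close>
proof (induction n arbitrary: w)
  case (Suc n)
  have h: "(cdq c ^^ n) g holomorphic_on \<Omega>"
    by (induction n) (simp_all add: g(1) holomorphic_cdq[OF _ g(2)])
  have "(cdq c ^^ Suc n) (cdq a g) w = cdq c (cdq a ((cdq c ^^ n) g)) w"
    using cdq_cong[OF g(2) Suc.IH ab(2) Suc.prems] by simp
  then show ?case using cdq_cdq_commute[OF h g(2) ab(2,1) Suc.prems] by simp
qed simp

text \<open>Leibniz' rule for \<open>(w - z) * cdq z g w\<close>: at \<open>w = z\<close> only the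
  term with exactly one derivative on \<open>w - z\<close> survives.\<close>

lemma higher_deriv_cdq:
  assumes g: "g holomorphic_on \<Omega>" "open \<Omega>" and z: "z \<in> \<Omega>"
  shows "(deriv ^^ n) (cdq z g) z = (deriv ^^ Suc n) g z / of_nat (Suc n)"
proof -
  let ?h = "cdq z g"
  have h: "?h holomorphic_on \<Omega>" by (rule holomorphic_cdq[OF g])
  have lin: "(\<lambda>w. w - z) holomorphic_on \<Omega>" by (intro holomorphic_intros)
  have "(deriv ^^ Suc n) g z = (deriv ^^ Suc n) (\<lambda>w. g z + (w - z) * ?h w) z"
    using cdq_expand[of g _ z] by (metis ext)
  also have "\<dots> = (deriv ^^ Suc n) (\<lambda>w. (w - z) * ?h w) z"
    using higher_deriv_add[OF holomorphic_on_const holomorphic_on_mult[OF lin h] g(2) z, of "Suc n" "g z"]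
    by (simp add: higher_deriv_const del: funpow.simps)
  also have "\<dots> = (\<Sum>i = 0..Suc n. of_nat (Suc n choose i) * (deriv ^^ i) (\<lambda>w. w - z) z * (deriv ^^ (Suc n - i)) ?h z)"
    by (rule higher_deriv_mult[OF lin h g(2) z])
  also have "\<dots> = (\<Sum>i = 0..Suc n. if i = 1 then of_nat (Suc n) * (deriv ^^ n) ?h z else 0)"
  proof (intro sum.cong refl)
    fix i
    have "deriv (\<lambda>w. w - z) = (\<lambda>w. 1)" by (intro ext DERIV_imp_deriv) (auto intro!: derivative_eq_intros)
    then have "(deriv ^^ i) (\<lambda>w. w - z) z = (if i = 1 then 1 else 0)"
      by (cases i; cases "i - 1") (simp_all add: funpow_Suc_right higher_deriv_const del: funpow.simps)
    then show "of_nat (Suc n choose i) * (deriv ^^ i) (\<lambda>w. w - z) z * (deriv ^^ (Suc n - i)) ?h z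
      = (if i = 1 then of_nat (Suc n) * (deriv ^^ n) ?h z else 0)" by auto
  qed
  also have "\<dots> = of_nat (Suc n) * (deriv ^^ n) ?h z" by simp
  finally show ?thesis by (simp del: funpow.simps of_nat_Suc)
qed

text \<open>Iterated quotients with all nodes at \<open>z\<close> are the Taylor coefficients at
  \<open>z\<close>; this lets the Schwarz derivative be expanded by the same lemma as the
  distortion.\<close>

lemma funpow_cdq_eq_higher_deriv:
  assumes "g holomorphic_on \<Omega>" "open \<Omega>" "z \<in> \<Omega>"
  shows "(deriv ^^ n) g z = fact n * (cdq z ^^ n) g z"
  using assms(1)
proof (induction n arbitrary: g)
  case (Suc n)
  have "fact (Suc n) * (cdq z ^^ Suc n) g z = of_nat (Suc n) * (fact n * (cdq z ^^ n) (cdq z g) z)"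
    by (simp add: funpow_Suc_right del: funpow.simps of_nat_Suc)
  also have "\<dots> = of_nat (Suc n) * (deriv ^^ n) (cdq z g) z"
    using Suc.IH[OF holomorphic_cdq[OF Suc.prems assms(2)]] by simp
  also have "\<dots> = (deriv ^^ Suc n) g z"
    unfolding higher_deriv_cdq[OF Suc.prems assms(2,3)] by (simp del: funpow.simps of_nat_Suc)
  finally show ?case by simp
qed simp

lemma holomorphic_funpow_cdq:
  assumes "g holomorphic_on \<Omega>" "open \<Omega>"
  shows "(cdq c ^^ n) g holomorphic_on \<Omega>"
  by (induction n) (simp_all add: assms holomorphic_cdq)

lemma norm_funpow_cdq_le:
  assumes \<Omega>: "open \<Omega>" "K' \<subseteq> \<Omega>" and c: "0 < \<rho>" "cball c \<rho> \<subseteq> K'"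
    and g: "g holomorphic_on \<Omega>" "\<forall>z\<in>K'. norm (g z) \<le> G"
  shows "\<forall>z\<in>K'. norm ((cdq c ^^ m) g z) \<le> (2 / \<rho>) ^ m * G"
proof (induction m)
  case (Suc m)
  have "norm (cdq c ((cdq c ^^ m) g) z) \<le> 2 / \<rho> * ((2 / \<rho>) ^ m * G)" if "z \<in> K'" for z
    using norm_cdq_le[OF holomorphic_funpow_cdq[OF g(1) \<Omega>(1)] \<Omega>(1) c \<Omega>(2) _ that] Suc by blast
  then show ?case by (simp add: mult_ac)
qed (use g(2) in simp)

text \<open>Induction on the nodes, removing them one at a time. \<open>N\<close> is chosen before
  \<open>g\<close> and \<open>G\<close>, so the induction hypothesis applies to
  \<open>cdq a g\<close>, which is bounded by \<open>r * G\<close> on the same set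
  \<open>K'\<close>. The empty list is Taylor's formula of second order at \<open>c\<close>.\<close>

lemma cdq_foldl_taylor:
  assumes \<Omega>: "open \<Omega>" "K' \<subseteq> \<Omega>" and K: "0 < \<rho>" "\<And>z. z \<in> K \<Longrightarrow> cball z \<rho> \<subseteq> K'"
  shows "\<exists>N\<ge>0. \<forall>as g G b c \<Delta>. length as = n \<longrightarrow> g holomorphic_on \<Omega> \<longrightarrow> (\<forall>z\<in>K'. norm (g z) \<le> G) \<longrightarrow>
     set as \<subseteq> K \<longrightarrow> b \<in> K \<longrightarrow> c \<in> K \<longrightarrow> (\<forall>z\<in>insert b (set as). norm (z - c) \<le> \<Delta>) \<longrightarrow>
     norm (foldl (\<lambda>g a. cdq a g) g as b - ((cdq c ^^ n) g c + ((\<Sum>a\<leftarrow>as. a - c) + (b - c)) * (cdq c ^^ Suc n) g c))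
       \<le> N * G * \<Delta>\<^sup>2"
proof -
  define r where "r = 2 / \<rho>"
  have r0: "0 < r" using K(1) by (simp add: r_def)
  have KK: "z \<in> K'" if "z \<in> K" for z using K(1) K(2)[OF that] by auto
  then have K\<Omega>: "z \<in> \<Omega>" if "z \<in> K" for z using that \<Omega>(2) by blast
  note bound = norm_funpow_cdq_le[OF \<Omega> K(1) K(2), folded r_def]
  have G0: "0 \<le> G" if "\<forall>z\<in>K'. norm (g z) \<le> G" "z \<in> K" for g :: "complex \<Rightarrow> complex" and G z
    using that KK order_trans[OF norm_ge_zero] by blast
  show ?thesis
  proof (induction n)
    case 0
    show ?case
    proof (intro exI[of _ "r\<^sup>2"] conjI allI impI)
      fix as :: "complex list" and g G b c \<Delta>
      assume as: "length as = 0" and g: "g holomorphic_on \<Omega>" "\<forall>z\<in>K'. norm (g z) \<le> G"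
        and bc: "b \<in> K" "c \<in> K" and \<Delta>: "\<forall>z\<in>insert b (set as). norm (z - c) \<le> \<Delta>"
      have "g b - (g c + (b - c) * cdq c g c) = (b - c)\<^sup>2 * (cdq c ^^ 2) g b"
        using cdq_expand[of g b c] cdq_expand[of "cdq c g" b c] by (simp add: numeral_2_eq_2 algebra_simps)
      moreover have "norm ((b - c)\<^sup>2 * (cdq c ^^ 2) g b) \<le> \<Delta>\<^sup>2 * (r\<^sup>2 * G)"
        unfolding norm_mult norm_power
        using bound[OF bc(2) g, of 2] KK[OF bc(1)] \<Delta> by (intro mult_mono power_mono) auto
      ultimately show "norm (foldl (\<lambda>g a. cdq a g) g as b - ((cdq c ^^ 0) g c + ((\<Sum>a\<leftarrow>as. a - c) + (b - c)) * (cdq c ^^ Suc 0) g c))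
        \<le> r\<^sup>2 * G * \<Delta>\<^sup>2" using as by (simp add: mult_ac)
    qed simp
  next
    case (Suc n)
    then obtain N where N: "0 \<le> N" and IH: "\<And>as g G b c \<Delta>. length as = n \<Longrightarrow> g holomorphic_on \<Omega> \<Longrightarrow> (\<forall>z\<in>K'. norm (g z) \<le> G) \<Longrightarrow>
       set as \<subseteq> K \<Longrightarrow> b \<in> K \<Longrightarrow> c \<in> K \<Longrightarrow> (\<forall>z\<in>insert b (set as). norm (z - c) \<le> \<Delta>) \<Longrightarrow>
       norm (foldl (\<lambda>g a. cdq a g) g as b - ((cdq c ^^ n) g c + ((\<Sum>a\<leftarrow>as. a - c) + (b - c)) * (cdq c ^^ Suc n) g c))
         \<le> N * G * \<Delta>\<^sup>2" by blast
    \<comment> \<open>\<open>N * r\<close> comes from the induction hypothesis for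
      \<open>cdq a g\<close>, the other two summands from moving the node \<open>a\<close> to
      \<open>c\<close> in the constant and in the linear term.\<close>
    let ?M = "N * r + r ^ (n + 3) + (real n + 1) * r ^ (n + 3)"
    show ?case
    proof (intro exI[of _ ?M] conjI allI impI)
      fix as' :: "complex list" and g G b c \<Delta>
      assume as': "length as' = Suc n" "set as' \<subseteq> K" and g: "g holomorphic_on \<Omega>" "\<forall>z\<in>K'. norm (g z) \<le> G"
        and bc: "b \<in> K" "c \<in> K" and \<Delta>: "\<forall>z\<in>insert b (set as'). norm (z - c) \<le> \<Delta>"
      obtain a as where as: "as' = a # as" "length as = n" using as'(1) by (cases as') auto
      have a: "a \<in> K" "norm (a - c) \<le> \<Delta>" using as as'(2) \<Delta> by auto
      have \<Delta>0: "0 \<le> \<Delta>" using a(2) norm_ge_zero order_trans by blast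
      let ?k = "\<lambda>m. (cdq c ^^ m) g"
      define s where "s = (\<Sum>a\<leftarrow>as. a - c) + (b - c)"
      have s: "norm s \<le> (real n + 1) * \<Delta>"
      proof -
        have "norm (\<Sum>a\<leftarrow>as. a - c) \<le> real (length as) * \<Delta>"
          using \<Delta> unfolding as(1)
        proof (induction as)
          case (Cons z zs)
          then have "norm (z - c + (\<Sum>a\<leftarrow>zs. a - c)) \<le> \<Delta> + real (length zs) * \<Delta>"
            by (intro norm_triangle_mono) auto
          then show ?case by (simp add: algebra_simps)
        qed simp
        then have "norm s \<le> real n * \<Delta> + \<Delta>" unfolding s_def as(2) using \<Delta> by (intro norm_triangle_mono) auto
        then show ?thesis by (simp add: algebra_simps)
      qed
      have hb: "\<forall>z\<in>K'. norm (cdq a g z) \<le> r * G"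
        using norm_cdq_le[OF g(1) \<Omega>(1) K(1) K(2)[OF a(1)] \<Omega>(2)] g(2) by (auto simp: r_def)
      have E1: "norm (foldl (\<lambda>g a. cdq a g) (cdq a g) as b - ((cdq c ^^ n) (cdq a g) c + s * (cdq c ^^ Suc n) (cdq a g) c))
          \<le> N * (r * G) * \<Delta>\<^sup>2"
        unfolding s_def using as as'(2) \<Delta> by (intro IH hb bc holomorphic_cdq[OF g(1) \<Omega>(1)]) auto
      \<comment> \<open>Symmetry turns the node \<open>a\<close> into the argument: the coefficients
        of \<open>cdq a g\<close> at \<open>c\<close> become values at \<open>a\<close> of a
        function depending on \<open>c\<close> only, which can be expanded around
        \<open>c\<close>.\<close>
      have swap: "(cdq c ^^ m) (cdq a g) c = ?k (Suc m) a" for m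
        using cdq_funpow_commute[OF g(1) \<Omega>(1) K\<Omega>[OF a(1)] K\<Omega>[OF bc(2)] K\<Omega>[OF bc(2)], of m]
          cdq_commute[of a "(cdq c ^^ m) g" c] by simp
      have x1: "?k m a = ?k m c + (a - c) * ?k (Suc m) a" for m
        using cdq_expand[of "?k m" a c] by simp
      have e: "(cdq c ^^ n) (cdq a g) c + s * (cdq c ^^ Suc n) (cdq a g) c
          = ?k (Suc n) c + ((a - c) + s) * ?k (Suc (Suc n)) c
            + ((a - c)\<^sup>2 * ?k (n + 3) a + s * ((a - c) * ?k (n + 3) a))"
        unfolding swap x1[of "Suc n"] x1[of "Suc (Suc n)"]
        by (simp add: power2_eq_square algebra_simps numeral_3_eq_3 del: funpow.simps)
      have ka: "norm (?k (n + 3) a) \<le> r ^ (n + 3) * G" using bound[OF bc(2) g] KK[OF a(1)] by blast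
      have G: "0 \<le> G" by (rule G0[OF g(2) a(1)])
      have E2: "norm ((a - c)\<^sup>2 * ?k (n + 3) a + s * ((a - c) * ?k (n + 3) a))
          \<le> \<Delta>\<^sup>2 * (r ^ (n + 3) * G) + ((real n + 1) * \<Delta>) * (\<Delta> * (r ^ (n + 3) * G))"
        by (intro norm_triangle_mono; unfold norm_mult norm_power; intro mult_mono power_mono a(2) s ka)
          (use \<Delta>0 G r0 in auto)
      have "foldl (\<lambda>g a. cdq a g) g as' b - (?k (Suc n) c + ((\<Sum>a\<leftarrow>as'. a - c) + (b - c)) * ?k (Suc (Suc n)) c)
         = (foldl (\<lambda>g a. cdq a g) (cdq a g) as b - ((cdq c ^^ n) (cdq a g) c + s * (cdq c ^^ Suc n) (cdq a g) c))
           + ((a - c)\<^sup>2 * ?k (n + 3) a + s * ((a - c) * ?k (n + 3) a))"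
        unfolding e as(1) by (simp add: s_def algebra_simps del: funpow.simps)
      then have "norm (foldl (\<lambda>g a. cdq a g) g as' b - (?k (Suc n) c + ((\<Sum>a\<leftarrow>as'. a - c) + (b - c)) * ?k (Suc (Suc n)) c))
         \<le> N * (r * G) * \<Delta>\<^sup>2 + (\<Delta>\<^sup>2 * (r ^ (n + 3) * G) + ((real n + 1) * \<Delta>) * (\<Delta> * (r ^ (n + 3) * G)))"
        using norm_triangle_mono[OF E1 E2] by simp
      also have "\<dots> = ?M * G * \<Delta>\<^sup>2" by (simp add: algebra_simps power2_eq_square)
      finally show "norm (foldl (\<lambda>g a. cdq a g) g as' b - (?k (Suc n) c + ((\<Sum>a\<leftarrow>as'. a - c) + (b - c)) * ?k (Suc (Suc n)) c))
         \<le> ?M * G * \<Delta>\<^sup>2" .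
    qed (use N r0 in auto)
  qed
qed

text \<open>Same cancellation as for distinct real points, but valid for coincident points as well.
  \<open>cdq_commute\<close> and \<open>cdq_cdq_commute\<close> replace the symmetry of divided
  differences.\<close>

lemma cdq_cross_identity:
  assumes F: "F holomorphic_on \<Omega>" "open \<Omega>" and z: "z1 \<in> \<Omega>" "z2 \<in> \<Omega>" "z3 \<in> \<Omega>" "z4 \<in> \<Omega>"
  shows "cdq z2 F z1 * cdq z4 F z3 - cdq z3 F z2 * cdq z1 F z4 = (z1 - z3) * (z2 - z4) *
    (cdq z4 (cdq z3 (cdq z1 F)) z2 * cdq z4 F z3 - cdq z3 (cdq z1 F) z4 * cdq z2 (cdq z3 F) z4)"
proof -
  have "cdq z3 (cdq z2 F) z1 = cdq z3 (cdq z1 F) z2"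
    using cdq_cdq_commute[OF F z(3,2,1)] cdq_commute[of z2 "cdq z3 F" z1] cdq_cdq_commute[OF F z(1,3,2)] by simp
  then have "cdq z2 F z1 = cdq z2 F z3 + (z1 - z3) * cdq z3 (cdq z1 F) z2"
    using cdq_expand[of "cdq z2 F" z1 z3] by simp
  moreover have "cdq z4 F z3 = cdq z4 F z1 + (z3 - z1) * cdq z3 (cdq z1 F) z4"
    using cdq_expand[of "cdq z4 F" z3 z1] cdq_cdq_commute[OF F z(1,4,3)] cdq_commute[of z4 "cdq z1 F" z3] by simp
  moreover have "cdq z3 (cdq z1 F) z2 = cdq z3 (cdq z1 F) z4 + (z2 - z4) * cdq z4 (cdq z3 (cdq z1 F)) z2"
    by (rule cdq_expand)
  moreover have "cdq z3 F z4 = cdq z3 F z2 + (z4 - z2) * cdq z2 (cdq z3 F) z4"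
    by (rule cdq_expand)
  ultimately show ?thesis
    unfolding cdq_commute[of z2 F z3] cdq_commute[of z4 F z3] cdq_commute[of z4 F z1] by algebra
qed

text \<open>Close to the diagonal the quotient differs little from \<open>deriv F a\<close>, which
  is bounded below on \<open>K\<close>. Pairs at distance at least \<delta> form a compact set,
  where injectivity keeps the quotient away from 0. Without injectivity it may vanish there, so only
  close pairs are covered.\<close>

lemma cdq_lower_bound:
  assumes \<Omega>: "open \<Omega>" "K' \<subseteq> \<Omega>" and \<rho>: "0 < \<rho>" "\<And>z. z \<in> K \<Longrightarrow> cball z \<rho> \<subseteq> K'"
    and F: "F holomorphic_on \<Omega>" "\<forall>z\<in>K'. norm (F z) \<le> G" and K: "compact K"
    and nz: "\<And>z. z \<in> \<Omega> \<Longrightarrow> deriv F z \<noteq> 0"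
  shows "\<exists>m>0. \<exists>\<delta>>0. \<forall>a\<in>K. \<forall>b\<in>K. inj_on F K \<or> dist a b < \<delta> \<longrightarrow> m \<le> norm (cdq a F b)"
proof (cases "K = {}")
  case True
  then show ?thesis by (auto intro!: exI[of _ 1])
next
  case False
  have KK: "z \<in> K'" if "z \<in> K" for z using \<rho>(1) \<rho>(2)[OF that] by auto
  have K\<Omega>: "K \<subseteq> \<Omega>" using KK \<Omega>(2) by blast
  have "continuous_on K (\<lambda>z. norm (deriv F z))"
    using holomorphic_on_imp_continuous_on[OF holomorphic_deriv[OF F(1) \<Omega>(1)]] K\<Omega>
    by (intro continuous_intros) (rule continuous_on_subset)
  from continuous_attains_inf[OF K False this]
  obtain x where x: "x \<in> K" "\<And>y. y \<in> K \<Longrightarrow> norm (deriv F x) \<le> norm (deriv F y)" by blast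
  define m0 where "m0 = norm (deriv F x)"
  have m0: "0 < m0" using nz[of x] x(1) K\<Omega> by (auto simp: m0_def)
  define Q where "Q = (2 / \<rho>)\<^sup>2 * G"
  have Q: "norm ((cdq a ^^ 2) F b) \<le> Q" if "a \<in> K" "b \<in> K" for a b
    unfolding Q_def using norm_funpow_cdq_le[OF \<Omega> \<rho>(1) \<rho>(2)[OF that(1)] F, of 2] KK[OF that(2)] by blast
  have Q0: "0 \<le> Q" using Q[OF x(1) x(1)] norm_ge_zero order_trans by blast
  \<comment> \<open>Chosen so that \<open>\<delta> * Q \<le> m0 / 2\<close>; the added 1 takes care
    of \<open>Q = 0\<close>.\<close>
  define \<delta> where "\<delta> = m0 / (2 * (Q + 1))"
  have \<delta>: "0 < \<delta>" using m0 Q0 by (simp add: \<delta>_def)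
  have near: "m0 / 2 \<le> norm (cdq a F b)" if "a \<in> K" "b \<in> K" "dist a b < \<delta>" for a b
  proof -
    have "cdq a F b = deriv F a + (b - a) * (cdq a ^^ 2) F b"
      using cdq_expand[of "cdq a F" b a] by (simp add: numeral_2_eq_2) (simp add: cdq_def diff_quot_def)
    then have "norm (deriv F a) - norm ((b - a) * (cdq a ^^ 2) F b) \<le> norm (cdq a F b)"
      by (metis norm_diff_ineq)
    moreover have "norm ((b - a) * (cdq a ^^ 2) F b) \<le> \<delta> * Q"
      unfolding norm_mult using that Q[OF that(1,2)] Q0 \<delta>
      by (intro mult_mono) (auto simp: dist_norm norm_minus_commute)
    moreover have "\<delta> * Q \<le> m0 / 2" using m0 Q0 by (simp add: \<delta>_def field_simps)
    moreover have "m0 \<le> norm (deriv F a)" using x(2)[OF that(1)] by (simp add: m0_def)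
    ultimately show ?thesis by linarith
  qed
  show ?thesis
  proof (cases "inj_on F K")
    case False
    then show ?thesis using near m0 \<delta> by (intro exI[of _ "m0 / 2"] conjI exI[of _ \<delta>]) auto
  next
    case inj: True
    define W where "W = (K \<times> K) \<inter> {p. \<delta> \<le> dist (fst p) (snd p)}"
    have "compact W" unfolding W_def
      by (intro compact_Int_closed compact_Times K closed_Collect_le continuous_intros)
    have FK: "continuous_on K F"
      using holomorphic_on_imp_continuous_on[OF F(1)] K\<Omega> continuous_on_subset by blast
    have cW: "continuous_on W (\<lambda>p. norm ((F (snd p) - F (fst p)) / (snd p - fst p)))"
      using \<delta> by (intro continuous_intros continuous_on_compose2[OF FK]) (auto simp: W_def)
    have "\<exists>\<mu>>0. \<forall>p\<in>W. \<mu> \<le> norm ((F (snd p) - F (fst p)) / (snd p - fst p))"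
    proof (cases "W = {}")
      case False
      from continuous_attains_inf[OF \<open>compact W\<close> False cW]
      obtain p where p: "p \<in> W" "\<And>y. y \<in> W \<Longrightarrow> norm ((F (snd p) - F (fst p)) / (snd p - fst p))
          \<le> norm ((F (snd y) - F (fst y)) / (snd y - fst y))" by blast
      have "fst p \<noteq> snd p" "fst p \<in> K" "snd p \<in> K" using p(1) \<delta> by (auto simp: W_def)
      then have "F (fst p) \<noteq> F (snd p)" using inj by (auto dest: inj_onD)
      then have "0 < norm ((F (snd p) - F (fst p)) / (snd p - fst p))" using \<open>fst p \<noteq> snd p\<close> by simp
      then show ?thesis using p(2) by blast
    qed (auto intro: exI[of _ 1])
    then obtain \<mu> where \<mu>: "0 < \<mu>" "\<And>p. p \<in> W \<Longrightarrow> \<mu> \<le> norm ((F (snd p) - F (fst p)) / (snd p - fst p))" by blast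
    have "min (m0 / 2) \<mu> \<le> norm (cdq a F b)" if "a \<in> K" "b \<in> K" for a b
    proof (cases "dist a b < \<delta>")
      case True
      then show ?thesis using near[OF that] by (simp add: min_le_iff_disj)
    next
      case False
      then have "(a, b) \<in> W" "a \<noteq> b" using that \<delta> by (auto simp: W_def)
      then show ?thesis using \<mu>(2)[of "(a, b)"] by (simp add: cdq_def diff_quot_def min_le_iff_disj)
    qed
    then show ?thesis using m0 \<mu>(1) \<delta> by (intro exI[of _ "min (m0 / 2) \<mu>"] conjI exI[of _ \<delta>]) auto
  qed
qed

section \<open>Uniform expansion on a compact subset of the domain\<close>

lemma holomorphic_expansion:
  assumes \<Omega>: "open \<Omega>" and F: "F holomorphic_on \<Omega>" and nz: "\<And>z. z \<in> \<Omega> \<Longrightarrow> deriv F z \<noteq> 0"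
    and K: "compact K" "K \<subseteq> \<Omega>"
  shows "\<exists>C. \<exists>\<delta>>0. \<forall>z1\<in>K. \<forall>z2\<in>K. \<forall>z3\<in>K. \<forall>z4\<in>K.
          inj_on F K \<or> diameter {z1, z2, z3, z4} < \<delta> \<longrightarrow>
          (\<exists>e. norm e \<le> C * diameter {z1, z2, z3, z4} ^ 2 \<and>
               cr_dist deriv F z1 z2 z3 z4 =
                 1 + (z1 - z3) * (z2 - z4) *
                   (1 / 24 * (schwarzian deriv F z1 + schwarzian deriv F z2 +
                              schwarzian deriv F z3 + schwarzian deriv F z4) + e))"
proof -
  obtain \<rho> where \<rho>: "0 < \<rho>" "(\<Union>z\<in>K. cball z \<rho>) \<subseteq> \<Omega>"
    using compact_subset_open_imp_cball_epsilon_subset[OF K(1) \<Omega> K(2)] by blast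
  \<comment> \<open>The closed \<rho>-neighbourhood of \<open>K\<close>, written as a sum of two
    compact sets so that its compactness is immediate.\<close>
  define K' where "K' = {x + y |x y. x \<in> K \<and> y \<in> cball 0 \<rho>}"
  have K'\<Omega>: "K' \<subseteq> \<Omega>"
  proof
    fix z assume "z \<in> K'"
    then obtain x y where "z = x + y" "x \<in> K" "norm y \<le> \<rho>" by (auto simp: K'_def)
    then have "z \<in> cball x \<rho>" by (simp add: dist_norm)
    then show "z \<in> \<Omega>" using \<rho>(2) \<open>x \<in> K\<close> by blast
  qed
  have ball: "cball z \<rho> \<subseteq> K'" if "z \<in> K" for z
  proof
    fix w assume "w \<in> cball z \<rho>"
    then have "w = z + (w - z)" "w - z \<in> cball 0 \<rho>" by (auto simp: dist_norm norm_minus_commute)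
    then show "w \<in> K'" using that unfolding K'_def by blast
  qed
  have "compact K'" unfolding K'_def by (intro compact_sums K compact_cball)
  then have "bounded (F ` K')"
    using holomorphic_on_imp_continuous_on[OF F] K'\<Omega>
    by (intro compact_imp_bounded compact_continuous_image) (auto intro: continuous_on_subset)
  then obtain G where G: "\<forall>z\<in>K'. norm (F z) \<le> G" unfolding bounded_iff by blast
  obtain m \<delta> where m: "0 < m" "0 < \<delta>" "\<And>a b. a \<in> K \<Longrightarrow> b \<in> K \<Longrightarrow> inj_on F K \<or> dist a b < \<delta> \<Longrightarrow> m \<le> norm (cdq a F b)"
    using cdq_lower_bound[OF \<Omega> K'\<Omega> \<rho>(1) ball F G K(1) nz] by blast
  \<comment> \<open>Exactly the quadruples for which \<open>m\<close> bounds every difference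
    quotient from below.\<close>
  define P where "P = {p :: nat \<Rightarrow> complex. {p 1, p 2, p 3, p 4} \<subseteq> K \<and> (inj_on F K \<or> diameter {p 1, p 2, p 3, p 4} < \<delta>)}"
  define Fl where "Fl = principal P"
  define \<Delta> where "\<Delta> = (\<lambda>p :: nat \<Rightarrow> complex. diameter {p 1, p 2, p 3, p 4})"
  define I where "I = {1::nat, 2, 3, 4}"
  have \<Delta>0: "0 \<le> \<Delta> p" for p
    unfolding \<Delta>_def by (rule diameter_ge_0) auto
  have \<Delta>: "norm (p i - p j) \<le> \<Delta> p" if "i \<in> I" "j \<in> I" for p i j
    using dist_le_diameter_quad[of i j p] that by (simp add: \<Delta>_def I_def)
  have PI: "p i \<in> K" if "p \<in> P" "i \<in> I" for p i
    using that by (auto simp: P_def I_def)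
  have \<Delta>le: "\<Delta> p \<le> diameter K" if "p \<in> P" for p
    unfolding \<Delta>_def by (rule diameter_subset) (use that compact_imp_bounded[OF K(1)] in \<open>auto simp: P_def\<close>)
  have low: "m \<le> norm (cdq (p i) F (p j))" if "p \<in> P" "i \<in> I" "j \<in> I" for p i j
  proof (rule m(3)[OF PI PI])
    show "inj_on F K \<or> dist (p i) (p j) < \<delta>"
      using that(1) \<Delta>[OF that(2,3), of p] unfolding P_def \<Delta>_def by (auto simp: dist_norm)
  qed (use that in auto)
  interpret jet_calculus Fl "\<lambda>p. complex_of_real (\<Delta> p)" "\<lambda>p. complex_of_real ((\<Delta> p)\<^sup>2)"
  proof
    show "(\<lambda>p. complex_of_real (\<Delta> p)) \<in> O[Fl](\<lambda>_. 1)"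
      unfolding Fl_def by (rule bigo_principalI[of _ _ "diameter K"]) (use \<Delta>0 \<Delta>le in simp)
    show "(\<lambda>p. complex_of_real ((\<Delta> p)\<^sup>2)) \<in> O[Fl](\<lambda>_. 1)"
      unfolding Fl_def by (rule bigo_principalI[of _ _ "(diameter K)\<^sup>2"])
        (use \<Delta>0 \<Delta>le in \<open>simp add: norm_power power_mono\<close>)
    show "(\<lambda>p. complex_of_real (\<Delta> p) * complex_of_real (\<Delta> p)) \<in> O[Fl](\<lambda>p. complex_of_real ((\<Delta> p)\<^sup>2))"
      by (simp add: power2_eq_square)
  qed
  \<comment> \<open>Divided difference of \<open>F\<close> as a function of its last node, with the
    other nodes in a list.\<close>
  define cdqs where "cdqs = foldl (\<lambda>g a. cdq a g) F"
  define a where "a = (\<lambda>n (p :: nat \<Rightarrow> complex). (cdq (p 1) ^^ n) F (p 1))"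
  define h where "h = (\<lambda>i (p :: nat \<Rightarrow> complex). p i - p 1)"
  have h: "h i \<in> O[Fl](\<lambda>p. complex_of_real (\<Delta> p))" if "i \<in> I" for i
    unfolding Fl_def h_def using \<Delta>[OF that, of 1] \<Delta>0
    by (intro bigo_principalI[of _ _ 1]) (auto simp: I_def)
  have a: "a n \<in> O[Fl](\<lambda>_. 1)" for n
    unfolding Fl_def
  proof (rule bigo_principalI)
    fix p assume "p \<in> P"
    then have p: "p 1 \<in> K" using PI by (simp add: I_def)
    then have "p 1 \<in> K'" using ball[OF p] \<rho>(1) by auto
    then show "norm (a n p) \<le> ((2 / \<rho>) ^ n * G) * norm (1 :: complex)"
      using norm_funpow_cdq_le[OF \<Omega> K'\<Omega> \<rho>(1) ball[OF p] F G, of n] by (simp add: a_def)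
  qed
  have J: "jet (\<lambda>p. cdqs (map p is) (p j)) (a (length is)) (\<lambda>p. a (Suc (length is)) p * ((\<Sum>i\<leftarrow>is. h i p) + h j p))"
    if I: "set is \<subseteq> I" "j \<in> I" for "is" j
  proof -
    obtain N where N: "\<And>as g G b c \<Delta>. length as = length is \<Longrightarrow> g holomorphic_on \<Omega> \<Longrightarrow> (\<forall>z\<in>K'. norm (g z) \<le> G) \<Longrightarrow>
       set as \<subseteq> K \<Longrightarrow> b \<in> K \<Longrightarrow> c \<in> K \<Longrightarrow> (\<forall>z\<in>insert b (set as). norm (z - c) \<le> \<Delta>) \<Longrightarrow>
       norm (foldl (\<lambda>g a. cdq a g) g as b - ((cdq c ^^ length is) g c
         + ((\<Sum>a\<leftarrow>as. a - c) + (b - c)) * (cdq c ^^ Suc (length is)) g c)) \<le> N * G * \<Delta>\<^sup>2"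
      using cdq_foldl_taylor[OF \<Omega> K'\<Omega> \<rho>(1) ball, of K "length is"] by blast
    have hs: "(\<lambda>p. (\<Sum>i\<leftarrow>is. h i p) + h j p) \<in> O[Fl](\<lambda>p. complex_of_real (\<Delta> p))"
      using I(1)
    proof (induction "is")
      case (Cons i js)
      then show ?case using sum_in_bigo(1)[OF h[of i] Cons.IH] by (simp add: add.assoc)
    qed (use h[OF I(2)] in simp)
    show ?thesis
    proof (rule jetI[OF a bigo_1_mult[OF a hs]])
      let ?r = "\<lambda>p. cdqs (map p is) (p j) - (a (length is) p + a (Suc (length is)) p * ((\<Sum>i\<leftarrow>is. h i p) + h j p))"
      show "?r \<in> O[Fl](\<lambda>p. complex_of_real ((\<Delta> p)\<^sup>2))"
        unfolding Fl_def
      proof (rule bigo_principalI)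
        fix p assume p: "p \<in> P"
        have "norm (foldl (\<lambda>g a. cdq a g) F (map p is) (p j) - ((cdq (p 1) ^^ length is) F (p 1)
           + ((\<Sum>a\<leftarrow>map p is. a - p 1) + (p j - p 1)) * (cdq (p 1) ^^ Suc (length is)) F (p 1))) \<le> N * G * (\<Delta> p)\<^sup>2"
          by (rule N[OF _ F G]) (use PI[OF p] I \<Delta>[of _ 1 p] in \<open>auto simp: I_def\<close>)
        then show "norm (?r p) \<le> (N * G) * norm (complex_of_real ((\<Delta> p)\<^sup>2))"
          by (simp add: cdqs_def a_def h_def norm_power comp_def mult.commute del: funpow.simps)
      qed
    qed simp
  qed
  have inv: "eventually (\<lambda>p. x p \<noteq> 0) Fl \<and> (\<lambda>p. inverse (x p)) \<in> O[Fl](\<lambda>_. 1)"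
    if "\<And>p. p \<in> P \<Longrightarrow> m \<le> norm (x p)" for x :: "_ \<Rightarrow> complex"
  proof
    show "eventually (\<lambda>p. x p \<noteq> 0) Fl"
      using m(1) that unfolding Fl_def eventually_principal by fastforce
    show "(\<lambda>p. inverse (x p)) \<in> O[Fl](\<lambda>_. 1)"
      unfolding Fl_def by (rule bigo_principalI[of _ _ "inverse m"])
        (use m(1) that in \<open>simp add: norm_inverse le_imp_inverse_le\<close>)
  qed
  have derivs: "(deriv ^^ n) F z = fact n * cdqs (replicate n z) z" if "z \<in> \<Omega>" for n z
  proof -
    have "foldl (\<lambda>g a. cdq a g) g (replicate n z) = (cdq z ^^ n) g" for g z
      by (induction n arbitrary: g) (simp_all add: funpow_swap1)
    then show ?thesis using funpow_cdq_eq_higher_deriv[OF F \<Omega> that] by (simp add: cdqs_def)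
  qed
  have Jd: "jet (\<lambda>p. fact n * cdqs (replicate n (p i)) (p i)) (\<lambda>p. fact n * a n p)
      (\<lambda>p. fact n * (a (Suc n) p * (of_nat (Suc n) * h i p)))" if i: "i \<in> I" for n i
  proof -
    have "(\<Sum>i\<leftarrow>replicate n i. h i p) + h i p = of_nat (Suc n) * h i p" for p
      by (simp add: sum_list_replicate algebra_simps)
    then show ?thesis
      using jet_cmult[OF J[of "replicate n i" i], of "fact n"] i by (simp add: set_replicate_conv_if)
  qed
  have a1: "eventually (\<lambda>p. a 1 p \<noteq> 0) Fl" "(\<lambda>p. inverse (a 1 p)) \<in> O[Fl](\<lambda>_. 1)"
    using inv[of "a 1"] low[of _ 1 1] by (simp_all add: a_def I_def)
  \<comment> \<open>The Schwarz derivative written with repeated nodes: \<open>deriv F\<close>, its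
    second and third iterates are 1, 2 and 6 times divided differences.\<close>
  define S where "S = (\<lambda>z. cdqs [z, z, z] z * 6 / cdqs [z] z - 3 / 2 * (2 * cdqs [z, z] z / cdqs [z] z)\<^sup>2)"
  have S: "schwarzian deriv F (p i) = S (p i)" if "p \<in> P" "i \<in> I" for p i
  proof -
    have "p i \<in> \<Omega>" using PI[OF that] K(2) by blast
    from derivs[OF this, of 1] derivs[OF this, of 2] derivs[OF this, of 3] show ?thesis
      unfolding schwarzian_def S_def by (simp add: numeral_2_eq_2 numeral_3_eq_3 mult.commute)
  qed
  have JS: "jet (\<lambda>p. S (p i))
     (\<lambda>p. 6 * (a 3 p * inverse (a 1 p) - (a 2 p)\<^sup>2 * (inverse (a 1 p))\<^sup>2))
     (\<lambda>p. 24 * (a 4 p * inverse (a 1 p) - 2 * a 2 p * a 3 p * (inverse (a 1 p))\<^sup>2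
        + a 2 p ^ 3 * (inverse (a 1 p)) ^ 3) * h i p)" if i: "i \<in> I" for i
    unfolding S_def
  proof (rule jet_schwarzian[OF _ _ _ _ _ a1])
    show "jet (\<lambda>p. cdqs [p i] (p i)) (a 1) (\<lambda>p. 2 * a 2 p * h i p)"
      using Jd[OF i, of 1] by (simp add: numeral_2_eq_2 mult_ac)
    show "jet (\<lambda>p. 2 * cdqs [p i, p i] (p i)) (\<lambda>p. 2 * a 2 p) (\<lambda>p. 6 * a 3 p * h i p)"
      using Jd[OF i, of 2] by (simp add: numeral_2_eq_2 numeral_3_eq_3 algebra_simps)
    show "jet (\<lambda>p. cdqs [p i, p i, p i] (p i) * 6) (\<lambda>p. 6 * a 3 p) (\<lambda>p. 24 * a 4 p * h i p)"
      using Jd[OF i, of 3] by (simp add: eval_nat_numeral algebra_simps)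
    show "eventually (\<lambda>p. cdqs [p i] (p i) \<noteq> 0) Fl" "(\<lambda>p. inverse (cdqs [p i] (p i))) \<in> O[Fl](\<lambda>_. 1)"
      using inv[of "\<lambda>p. cdqs [p i] (p i)"] low[OF _ i i] by (simp_all add: cdqs_def)
  qed
  have JSS: "jet (\<lambda>p. S (p 1) + S (p 2) + S (p 3) + S (p 4))
     (\<lambda>p. 24 * (a 3 p * inverse (a 1 p) - (a 2 p)\<^sup>2 * (inverse (a 1 p))\<^sup>2))
     (\<lambda>p. 24 * (a 4 p * inverse (a 1 p) - 2 * a 2 p * a 3 p * (inverse (a 1 p))\<^sup>2
        + a 2 p ^ 3 * (inverse (a 1 p)) ^ 3) * (h 1 p + h 2 p + h 3 p + h 4 p))"
    by (rule jet_eqI[OF jet_add[OF jet_add[OF jet_add[OF JS[of 1] JS[of 2]] JS[of 3]] JS[of 4]]])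
      (simp_all add: I_def distrib_left)
  \<comment> \<open>The order of the nodes follows the nesting in
    \<open>cdq_cross_identity\<close>.\<close>
  define T where "T = (\<lambda>p :: nat \<Rightarrow> complex. (cdqs [p 1, p 3, p 4] (p 2) * cdqs [p 4] (p 3)
     - cdqs [p 1, p 3] (p 4) * cdqs [p 3, p 2] (p 4)) / (cdqs [p 3] (p 2) * cdqs [p 1] (p 4)))"
  have "(\<lambda>p. T p - 1 / 24 * (S (p 1) + S (p 2) + S (p 3) + S (p 4))) \<in> O[Fl](\<lambda>p. complex_of_real ((\<Delta> p)\<^sup>2))"
    unfolding T_def
  proof (rule jet_distortion[OF _ _ _ _ _ _ _ _ _ _ a1 JSS])
    show "jet (\<lambda>p. cdqs [p 4] (p 3)) (a 1) (\<lambda>p. a 2 p * (h 3 p + h 4 p))"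
      using J[of "[4]" 3] by (simp add: I_def numeral_2_eq_2 add_ac)
    show "jet (\<lambda>p. cdqs [p 3] (p 2)) (a 1) (\<lambda>p. a 2 p * (h 2 p + h 3 p))"
      using J[of "[3]" 2] by (simp add: I_def numeral_2_eq_2 add_ac)
    show "jet (\<lambda>p. cdqs [p 1] (p 4)) (a 1) (\<lambda>p. a 2 p * (h 1 p + h 4 p))"
      using J[of "[1]" 4] by (simp add: I_def numeral_2_eq_2 add_ac)
    show "jet (\<lambda>p. cdqs [p 1, p 3] (p 4)) (a 2) (\<lambda>p. a 3 p * (h 1 p + h 3 p + h 4 p))"
      using J[of "[1, 3]" 4] by (simp add: I_def numeral_2_eq_2 numeral_3_eq_3 add_ac)
    show "jet (\<lambda>p. cdqs [p 3, p 2] (p 4)) (a 2) (\<lambda>p. a 3 p * (h 2 p + h 3 p + h 4 p))"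
      using J[of "[3, 2]" 4] by (simp add: I_def numeral_2_eq_2 numeral_3_eq_3 add_ac)
    show "jet (\<lambda>p. cdqs [p 1, p 3, p 4] (p 2)) (a 3) (\<lambda>p. a 4 p * (h 1 p + h 2 p + h 3 p + h 4 p))"
      using J[of "[1, 3, 4]" 2] by (simp add: I_def eval_nat_numeral add_ac)
    show "eventually (\<lambda>p. cdqs [p 3] (p 2) \<noteq> 0) Fl" "(\<lambda>p. inverse (cdqs [p 3] (p 2))) \<in> O[Fl](\<lambda>_. 1)"
      "eventually (\<lambda>p. cdqs [p 1] (p 4) \<noteq> 0) Fl" "(\<lambda>p. inverse (cdqs [p 1] (p 4))) \<in> O[Fl](\<lambda>_. 1)"
      using inv[of "\<lambda>p. cdqs [p 3] (p 2)"] inv[of "\<lambda>p. cdqs [p 1] (p 4)"] low[of _ 3 2] low[of _ 1 4]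
      by (simp_all add: cdqs_def I_def)
  qed
  then obtain C where C: "C > 0" "\<And>p. p \<in> P \<Longrightarrow>
      norm (T p - 1 / 24 * (S (p 1) + S (p 2) + S (p 3) + S (p 4))) \<le> C * norm (complex_of_real ((\<Delta> p)\<^sup>2))"
    unfolding Fl_def by (rule bigo_principalE) auto
  show ?thesis
  proof (rule exI[of _ C], rule exI[of _ \<delta>], intro conjI m(2) ballI impI)
    fix z1 z2 z3 z4
    assume z: "z1 \<in> K" "z2 \<in> K" "z3 \<in> K" "z4 \<in> K" "inj_on F K \<or> diameter {z1, z2, z3, z4} < \<delta>"
    define p where "p = (\<lambda>i. [0, z1, z2, z3, z4] ! i)"
    have p: "p 1 = z1" "p 2 = z2" "p 3 = z3" "p 4 = z4" by (simp_all add: p_def)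
    have "p \<in> P" using z unfolding P_def mem_Collect_eq p by auto
    have SP: "schwarzian deriv F z1 = S z1" "schwarzian deriv F z2 = S z2"
      "schwarzian deriv F z3 = S z3" "schwarzian deriv F z4 = S z4"
      using S[OF \<open>p \<in> P\<close>, of 1] S[OF \<open>p \<in> P\<close>, of 2] S[OF \<open>p \<in> P\<close>, of 3] S[OF \<open>p \<in> P\<close>, of 4]
      unfolding p by (simp_all add: I_def)
    have z\<Omega>: "z1 \<in> \<Omega>" "z2 \<in> \<Omega>" "z3 \<in> \<Omega>" "z4 \<in> \<Omega>" using z K(2) by auto
    let ?q = "cdq z3 F z2 * cdq z1 F z4"
    have q: "?q \<noteq> 0" using low[OF \<open>p \<in> P\<close>, of 3 2] low[OF \<open>p \<in> P\<close>, of 1 4] m(1)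
      unfolding p by (auto simp: I_def)
    have "cr_dist deriv F z1 z2 z3 z4 = (cdq z2 F z1 * cdq z4 F z3) / ?q"
      by (simp add: cr_dist_def cdq_def)
    also have "cdq z2 F z1 * cdq z4 F z3 = ?q + (z1 - z3) * (z2 - z4) * (T p * ?q)"
    proof -
      have "T p * ?q = cdq z4 (cdq z3 (cdq z1 F)) z2 * cdq z4 F z3 - cdq z3 (cdq z1 F) z4 * cdq z2 (cdq z3 F) z4"
        using q unfolding T_def p by (simp add: cdqs_def)
      then show ?thesis using cdq_cross_identity[OF F \<Omega> z\<Omega>] by (simp add: diff_eq_eq add.commute)
    qed
    also have "\<dots> / ?q = 1 + (z1 - z3) * (z2 - z4) * T p"
      using q by (simp add: add_divide_distrib)
    finally have cr: "cr_dist deriv F z1 z2 z3 z4 = 1 + (z1 - z3) * (z2 - z4) * T p" .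
    show "\<exists>e. norm e \<le> C * diameter {z1, z2, z3, z4} ^ 2 \<and>
               cr_dist deriv F z1 z2 z3 z4 = 1 + (z1 - z3) * (z2 - z4) *
                   (1 / 24 * (schwarzian deriv F z1 + schwarzian deriv F z2 +
                              schwarzian deriv F z3 + schwarzian deriv F z4) + e)"
      using C(2)[OF \<open>p \<in> P\<close>] unfolding SP cr p \<Delta>_def
      by (intro exI[of _ "T p - 1 / 24 * (S z1 + S z2 + S z3 + S z4)"]) (simp add: norm_power)
  qed
qed

theorem theorem1:
  shows
  "(\<forall>(A::real) B f. A < B \<longrightarrow> (\<forall>x\<in>{A..B}. segment_deriv A B f x \<noteq> 0) \<longrightarrow>
     (\<forall>\<alpha>\<in>{0..1}. C_Holder 2 \<alpha> A B f \<longrightarrow>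
       (\<exists>C. \<forall>x1\<in>{A..B}. \<forall>x2\<in>{A..B}. \<forall>x3\<in>{A..B}. \<forall>x4\<in>{A..B}.
          diameter {x1, x2, x3, x4} \<noteq> 0 \<longrightarrow>
          (\<exists>e. \<bar>e\<bar> \<le> C * diameter {x1, x2, x3, x4} powr (\<alpha> - 1) \<and>
               cr_dist (segment_deriv A B) f x1 x2 x3 x4 = 1 + (x1 - x3) * (x2 - x4) * e))) \<and>
     (\<forall>\<beta>\<in>{0..1}. C_Holder 3 \<beta> A B f \<longrightarrow>
       (\<exists>C. \<forall>x1\<in>{A..B}. \<forall>x2\<in>{A..B}. \<forall>x3\<in>{A..B}. \<forall>x4\<in>{A..B}.
          \<forall>\<theta>\<in>{Min {x1, x2, x3, x4}..Max {x1, x2, x3, x4}}.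
          (\<exists>e. \<bar>e\<bar> \<le> C * diameter {x1, x2, x3, x4} powr \<beta> \<and>
               cr_dist (segment_deriv A B) f x1 x2 x3 x4 =
                 1 + (x1 - x3) * (x2 - x4) * (1 / 6 * schwarzian (segment_deriv A B) f \<theta> + e)))) \<and>
     (\<forall>\<gamma>\<in>{0..1}. C_Holder 4 \<gamma> A B f \<longrightarrow>
       (\<exists>C. \<forall>x1\<in>{A..B}. \<forall>x2\<in>{A..B}. \<forall>x3\<in>{A..B}. \<forall>x4\<in>{A..B}.
          (\<exists>e. \<bar>e\<bar> \<le> C * diameter {x1, x2, x3, x4} powr (1 + \<gamma>) \<and>
               cr_dist (segment_deriv A B) f x1 x2 x3 x4 =
                 1 + (x1 - x3) * (x2 - x4) *
                   (1 / 24 * (schwarzian (segment_deriv A B) f x1 + schwarzian (segment_deriv A B) f x2 +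
                              schwarzian (segment_deriv A B) f x3 + schwarzian (segment_deriv A B) f x4) + e))))) \<and>
   (\<forall>\<Omega> F. open \<Omega> \<and> connected \<Omega> \<and> \<Omega> \<noteq> {} \<and> quasiconvex \<Omega> \<longrightarrow>
     F holomorphic_on \<Omega> \<longrightarrow> (\<forall>z\<in>\<Omega>. deriv F z \<noteq> 0) \<longrightarrow>
     (\<forall>K. compact K \<and> K \<subseteq> \<Omega> \<longrightarrow>
       (\<exists>C. \<exists>\<delta>>0. \<forall>z1\<in>K. \<forall>z2\<in>K. \<forall>z3\<in>K. \<forall>z4\<in>K.
          inj_on F K \<or> diameter {z1, z2, z3, z4} < \<delta> \<longrightarrow>
          (\<exists>e. norm e \<le> C * diameter {z1, z2, z3, z4} ^ 2 \<and>
               cr_dist deriv F z1 z2 z3 z4 =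
                 1 + (z1 - z3) * (z2 - z4) *
                   (1 / 24 * (schwarzian deriv F z1 + schwarzian deriv F z2 +
                              schwarzian deriv F z3 + schwarzian deriv F z4) + e)))))"
proof (intro conjI allI impI ballI, goal_cases)
  case (1 A B f \<alpha>)
  then show ?case by (intro C_Holder_2_expansion) auto
next
  case (2 A B f \<beta>)
  then show ?case by (intro C_Holder_3_expansion) auto
next
  case (3 A B f \<gamma>)
  then show ?case by (intro C_Holder_4_expansion) auto
next
  case (4 \<Omega> F K)
  then show ?case by (intro holomorphic_expansion[of \<Omega>]) auto
qed

end
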